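(* Let $\mathcal{B}$ be a cocommutative Hopf algebra with antipode $S$ and let $L:\mathcal{B}\otimes\mathcal{B}\to\mathbb{C}$ be the generator of an additive deformation of $\mathcal{B}$. Let $\sigma:=L\circ(\mathrm{id}\otimes S)\circ\Delta$. Then $L=L_1+L_2$ with $$L_1=\tfrac12\,\partial\sigma,\qquad L_2=\tfrac12\bigl(L-L\circ(S\otimes S)\circ\tau\bigr),$$ where $L_1$ is the generator of a trivial deformation and $L_2$ is the generator of an additive deformation $\widetilde\mu_t=\mu\star e_\star^{tL_2}$ ($t\in\mathbb{R}$) with constant antipodes, i.e. $\widetilde\mu_t\circ(S\otimes\mathrm{id})\circ\Delta=\widetilde\mu_t\circ(\mathrm{id}\otimes S)\circ\Delta=\mathbf 1\delta$ for all $t\in\mathbb{R}$.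
   Context: All vector spaces are over $\mathbb{C}$. $(\mathcal{B},\mu,\mathbf 1,\Delta,\delta)$: multiplication, unit, comultiplication, counit; $\tau$ is the flip; cocommutative means $\Delta=\tau\circ\Delta$; $\mathbf 1\delta$ is the map $a\mapsto\delta(a)\mathbf 1$. $\mathcal{B}\otimes\mathcal{B}$ is a coalgebra with comultiplication $(\mathrm{id}\otimes\tau\otimes\mathrm{id})\circ(\Delta\otimes\Delta)$ and counit $\delta\otimes\delta$. Convolution: $(\mu\star L)(a\otimes b)=a_{(1)}b_{(1)}L(a_{(2)}\otimes b_{(2)})$, $(L\star\mu)(a\otimes b)=L(a_{(1)}\otimes b_{(1)})a_{(2)}b_{(2)}$, $(L\star L')(a\otimes b)=L(a_{(1)}\otimes b_{(1)})L'(a_{(2)}\otimes b_{(2)})$; $e_\star^{tL}=\sum_{n\ge0}t^nL^{\star n}/n!$ (pointwise convergent), with $L^{\star0}=\delta\otimes\delta$. For linear $\psi:\mathcal{B}\to\mathbb{C}$: $\partial\psi(a\otimes b)=\delta(a)\psi(b)-\psi(ab)+\psi(a)\delta(b)$. An additive deformation of $\mathcal{B}$ is a family $(\mu_t)_{t\ge0}$ of linear maps $\mathcal{B}\otimes\mathcal{B}\to\mathcal{B}$ with $(\mathcal{B},\mu_t,\mathbf 1)$ a unital algebra, $\mu_0=\mu$, $\Delta\circ\mu_{t+s}=(\mu_t\otimes\mu_s)\circ(\mathrm{id}\otimes\tau\otimes\mathrm{id})\circ(\Delta\otimes\Delta)$, and $\delta\circ\mu_t\to\delta\otimes\delta$ pointwise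 as $t\to0$. Its generator is $L=\frac{\mathrm d}{\mathrm dt}(\delta\circ\mu_t)|_{t=0}$. By a theorem of Wirth (known), $\mu_t=\mu\star e_\star^{tL}$, and the generators are exactly the linear maps $L:\mathcal{B}\otimes\mathcal{B}\to\mathbb{C}$ with $\mu\star L=L\star\mu$, $L(\mathbf 1\otimes\mathbf 1)=0$, and $\delta(a)L(b\otimes c)-L(ab\otimes c)+L(a\otimes bc)-L(a\otimes b)\delta(c)=0$ for all $a,b,c$. Additive deformations are viewed as indexed by all $t\in\mathbb{R}$ via $\mu_t=\mu\star e_\star^{tL}$. A trivial deformation is one whose generator is of the form $\partial\psi$ with $\psi:\mathcal{B}\to\mathbb{C}$ linear, $\psi(\mathbf 1)=0$, and $\psi(a_{(1)})a_{(2)}=a_{(1)}\psi(a_{(2)})$ for all $a$. *)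

theory Defs
  imports Complex_Main "HOL-Library.Poly_Mapping"
begin

section \<open>Complex vector spaces\<close>

class complex_vector = ab_group_add +
  fixes scaleC :: "complex \<Rightarrow> 'a \<Rightarrow> 'a" (infixr "*\<^sub>C" 75)
  assumes scaleC_right_distrib: "c *\<^sub>C (x + y) = c *\<^sub>C x + c *\<^sub>C y"
    and scaleC_left_distrib: "(c + d) *\<^sub>C x = c *\<^sub>C x + d *\<^sub>C x"
    and scaleC_scaleC: "c *\<^sub>C d *\<^sub>C x = (c * d) *\<^sub>C x"
    and scaleC_one: "1 *\<^sub>C x = x"

interpretation complex_vector: vector_space "scaleC :: complex \<Rightarrow> 'a::complex_vector \<Rightarrow> 'a"
  by unfold_locales
    (simp_all add: scaleC_right_distrib scaleC_left_distrib scaleC_scaleC scaleC_one)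

abbreviation clinear :: "('a::complex_vector \<Rightarrow> 'b::complex_vector) \<Rightarrow> bool"
  where "clinear \<equiv> Vector_Spaces.linear scaleC scaleC"

definition cbilinear :: "('a::complex_vector \<Rightarrow> 'b::complex_vector \<Rightarrow> 'c::complex_vector) \<Rightarrow> bool"
  where "cbilinear f \<longleftrightarrow> (\<forall>b. clinear (\<lambda>a. f a b)) \<and> (\<forall>a. clinear (f a))"

lemma clinear_iff:
  "clinear f \<longleftrightarrow> (\<forall>x y. f (x + y) = f x + f y) \<and> (\<forall>c x. f (c *\<^sub>C x) = c *\<^sub>C f x)"
  by (simp add: Vector_Spaces.linear_def module_hom_def module_hom_axioms_def
      module_iff_vector_space complex_vector.vector_space_axioms)

lemma cbilinear_iff:
  "cbilinear f \<longleftrightarrow>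
     (\<forall>a a' b. f (a + a') b = f a b + f a' b) \<and> (\<forall>a b b'. f a (b + b') = f a b + f a b') \<and>
     (\<forall>c a b. f (c *\<^sub>C a) b = c *\<^sub>C f a b) \<and> (\<forall>c a b. f a (c *\<^sub>C b) = c *\<^sub>C f a b)"
  unfolding cbilinear_def clinear_iff by blast

instantiation complex :: complex_vector
begin
definition scaleC_complex :: "complex \<Rightarrow> complex \<Rightarrow> complex"
  where [simp]: "scaleC_complex c x = c * x"
instance by standard (auto simp: algebra_simps)
end

instantiation poly_mapping :: (type, complex_vector) complex_vector
begin
definition scaleC_poly_mapping :: "complex \<Rightarrow> ('a \<Rightarrow>\<^sub>0 'b) \<Rightarrow> ('a \<Rightarrow>\<^sub>0 'b)"
  where "scaleC_poly_mapping c x = Poly_Mapping.map (scaleC c) x"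

lemma lookup_scaleC [simp]: "Poly_Mapping.lookup (c *\<^sub>C x) p = c *\<^sub>C Poly_Mapping.lookup x p"
  for x :: "'a \<Rightarrow>\<^sub>0 'b"
  unfolding scaleC_poly_mapping_def by (simp add: map.rep_eq when_def)

instance
  by standard (auto intro!: poly_mapping_eqI simp: lookup_add scaleC_right_distrib
      scaleC_left_distrib scaleC_scaleC scaleC_one)
end


section \<open>The algebraic tensor product\<close>

text \<open>The quotient of the free vector space on pairs by the subspace generated by the
  bilinearity relations.\<close>

definition tensor_relators ::
  "(('a::complex_vector \<times> 'b::complex_vector) \<Rightarrow>\<^sub>0 complex) set" where
  "tensor_relators =
     {Poly_Mapping.single (a + a', b) 1 - Poly_Mapping.single (a, b) 1 -
        Poly_Mapping.single (a', b) 1 | a a' b. True} \<union>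
     {Poly_Mapping.single (a, b + b') 1 - Poly_Mapping.single (a, b) 1 -
        Poly_Mapping.single (a, b') 1 | a b b'. True} \<union>
     {Poly_Mapping.single (c *\<^sub>C a, b) 1 - c *\<^sub>C Poly_Mapping.single (a, b) 1 | c a b. True} \<union>
     {Poly_Mapping.single (a, c *\<^sub>C b) 1 - c *\<^sub>C Poly_Mapping.single (a, b) 1 | c a b. True}"

definition tensor_eq ::
  "(('a::complex_vector \<times> 'b::complex_vector) \<Rightarrow>\<^sub>0 complex) \<Rightarrow> ('a \<times> 'b \<Rightarrow>\<^sub>0 complex) \<Rightarrow> bool"
  where "tensor_eq x y \<longleftrightarrow> x - y \<in> complex_vector.span tensor_relators"

lemma equivp_tensor_eq: "equivp tensor_eq"
proof (rule equivpI)
  show "reflp tensor_eq"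
    by (auto simp: reflp_def tensor_eq_def complex_vector.span_zero)
  show "symp tensor_eq"
    unfolding symp_def tensor_eq_def using complex_vector.span_neg by fastforce
  show "transp tensor_eq"
    unfolding transp_def tensor_eq_def using complex_vector.span_add by fastforce
qed

quotient_type (overloaded) ('a, 'b) tensor (infixr "\<otimes>" 75) =
  "('a::complex_vector \<times> 'b::complex_vector) \<Rightarrow>\<^sub>0 complex" / tensor_eq
  by (rule equivp_tensor_eq)

instantiation tensor :: (complex_vector, complex_vector) complex_vector
begin

lift_definition zero_tensor :: "'a \<otimes> 'b" is 0 .

lift_definition plus_tensor :: "'a \<otimes> 'b \<Rightarrow> 'a \<otimes> 'b \<Rightarrow> 'a \<otimes> 'b" is plus
proof -
  fix x x' y y' :: "('a \<times> 'b) \<Rightarrow>\<^sub>0 complex"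
  assume "tensor_eq x x'" "tensor_eq y y'"
  then show "tensor_eq (x + y) (x' + y')"
    unfolding tensor_eq_def using complex_vector.span_add by (fastforce simp: algebra_simps)
qed

lift_definition minus_tensor :: "'a \<otimes> 'b \<Rightarrow> 'a \<otimes> 'b \<Rightarrow> 'a \<otimes> 'b" is minus
proof -
  fix x x' y y' :: "('a \<times> 'b) \<Rightarrow>\<^sub>0 complex"
  assume "tensor_eq x x'" "tensor_eq y y'"
  then have "(x - x') - (y - y') \<in> complex_vector.span tensor_relators"
    unfolding tensor_eq_def by (rule complex_vector.span_diff)
  then show "tensor_eq (x - y) (x' - y')"
    unfolding tensor_eq_def by (simp add: algebra_simps)
qed

lift_definition uminus_tensor :: "'a \<otimes> 'b \<Rightarrow> 'a \<otimes> 'b" is uminus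
proof -
  fix x x' :: "('a \<times> 'b) \<Rightarrow>\<^sub>0 complex"
  assume "tensor_eq x x'"
  then have "- (x - x') \<in> complex_vector.span tensor_relators"
    unfolding tensor_eq_def by (rule complex_vector.span_neg)
  then show "tensor_eq (- x) (- x')"
    unfolding tensor_eq_def by (simp add: algebra_simps)
qed

lift_definition scaleC_tensor :: "complex \<Rightarrow> 'a \<otimes> 'b \<Rightarrow> 'a \<otimes> 'b" is scaleC
proof -
  fix c and x x' :: "('a \<times> 'b) \<Rightarrow>\<^sub>0 complex"
  assume "tensor_eq x x'"
  then have "c *\<^sub>C (x - x') \<in> complex_vector.span tensor_relators"
    unfolding tensor_eq_def by (rule complex_vector.span_scale)
  then show "tensor_eq (c *\<^sub>C x) (c *\<^sub>C x')"
    unfolding tensor_eq_def by (simp add: complex_vector.scale_right_diff_distrib)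
qed

instance
proof
  fix x y z :: "'a \<otimes> 'b" and c d :: complex
  note [simp] = tensor_eq_def complex_vector.span_zero
  show "x + y + z = x + (y + z)" by transfer (simp add: add.assoc)
  show "x + y = y + x" by transfer (simp add: add.commute)
  show "0 + x = x" by transfer simp
  show "- x + x = 0" by transfer simp
  show "x - y = x + - y" by transfer simp
  show "c *\<^sub>C (x + y) = c *\<^sub>C x + c *\<^sub>C y" by transfer (simp add: scaleC_right_distrib)
  show "(c + d) *\<^sub>C x = c *\<^sub>C x + d *\<^sub>C x" by transfer (simp add: scaleC_left_distrib)
  show "c *\<^sub>C d *\<^sub>C x = (c * d) *\<^sub>C x" by transfer simp
  show "1 *\<^sub>C x = x" by transfer simp
qed
end

lift_definition tensor_of :: "'a::complex_vector \<Rightarrow> 'b::complex_vector \<Rightarrow> 'a \<otimes> 'b" (infixr "\<otimes>" 75)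
  is "\<lambda>a b. Poly_Mapping.single (a, b) 1" .

lemma cbilinear_tensor_of: "cbilinear (\<otimes>)"
  unfolding cbilinear_iff
proof (intro conjI allI)
  fix a a' :: 'a and b b' :: 'b and c :: complex
  show "(a + a') \<otimes> b = a \<otimes> b + a' \<otimes> b"
    by (transfer, unfold tensor_eq_def, rule complex_vector.span_base)
      (unfold tensor_relators_def diff_diff_eq[symmetric], blast)
  show "a \<otimes> (b + b') = a \<otimes> b + a \<otimes> b'"
    by (transfer, unfold tensor_eq_def, rule complex_vector.span_base)
      (unfold tensor_relators_def diff_diff_eq[symmetric], blast)
  show "(c *\<^sub>C a) \<otimes> b = c *\<^sub>C (a \<otimes> b)"
    by (transfer, unfold tensor_eq_def, rule complex_vector.span_base)
      (unfold tensor_relators_def, blast)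
  show "a \<otimes> (c *\<^sub>C b) = c *\<^sub>C (a \<otimes> b)"
    by (transfer, unfold tensor_eq_def, rule complex_vector.span_base)
      (unfold tensor_relators_def, blast)
qed

lemma tensor_of_simps:
  fixes a a' :: "'a::complex_vector" and b b' :: "'b::complex_vector"
  shows "(a + a') \<otimes> b = a \<otimes> b + a' \<otimes> b" "a \<otimes> (b + b') = a \<otimes> b + a \<otimes> b'"
  "(c *\<^sub>C a) \<otimes> b = c *\<^sub>C (a \<otimes> b)" "a \<otimes> (c *\<^sub>C b) = c *\<^sub>C (a \<otimes> b)"
  using cbilinear_tensor_of[where ?'a = 'a and ?'b = 'b] unfolding cbilinear_iff by blast+

definition free_lift ::
  "('a \<Rightarrow> 'b \<Rightarrow> 'c::complex_vector) \<Rightarrow> (('a \<times> 'b) \<Rightarrow>\<^sub>0 complex) \<Rightarrow> 'c" where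
  "free_lift f x = (\<Sum>(a, b) \<in> Poly_Mapping.keys x. Poly_Mapping.lookup x (a, b) *\<^sub>C f a b)"

lemma free_lift_superset:
  assumes "finite A" "Poly_Mapping.keys x \<subseteq> A"
  shows "free_lift f x = (\<Sum>(a, b) \<in> A. Poly_Mapping.lookup x (a, b) *\<^sub>C f a b)"
  unfolding free_lift_def using assms
  by (intro sum.mono_neutral_left) (auto simp: in_keys_iff)

lemma clinear_free_lift: "clinear (free_lift f)"
  unfolding clinear_iff
proof (intro conjI allI)
  fix x y :: "('a \<times> 'b) \<Rightarrow>\<^sub>0 complex" and c :: complex
  let ?A = "Poly_Mapping.keys x \<union> Poly_Mapping.keys y"
  have "Poly_Mapping.keys (x + y) \<subseteq> ?A" by (rule keys_add)
  then show "free_lift f (x + y) = free_lift f x + free_lift f y"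
    by (simp add: free_lift_superset[of ?A] lookup_add scaleC_left_distrib sum.distrib
        case_prod_beta)
  have "Poly_Mapping.keys (c *\<^sub>C x) \<subseteq> Poly_Mapping.keys x"
    by (auto simp: in_keys_iff)
  then show "free_lift f (c *\<^sub>C x) = c *\<^sub>C free_lift f x"
    by (simp add: free_lift_superset[of "Poly_Mapping.keys x"] complex_vector.scale_sum_right
        case_prod_beta)
qed

lemma free_lift_single [simp]: "free_lift f (Poly_Mapping.single (a, b) c) = c *\<^sub>C f a b"
  by (subst free_lift_superset[of "{(a, b)}"]) auto

lemma free_lift_add: "free_lift f (x + y) = free_lift f x + free_lift f y"
  and free_lift_scaleC: "free_lift f (c *\<^sub>C x) = c *\<^sub>C free_lift f x"
  using clinear_free_lift[of f] by (auto simp: clinear_iff)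

lemma free_lift_diff: "free_lift f (x - y) = free_lift f x - free_lift f y"
  using free_lift_add[of f "x - y" y] by simp

lemma free_lift_tensor_eq:
  assumes "cbilinear f" "tensor_eq x y"
  shows "free_lift f x = free_lift f y"
proof -
  have "tensor_relators \<subseteq> {z. free_lift f z = 0}"
    using assms(1) unfolding tensor_relators_def cbilinear_iff
    by (auto simp: free_lift_diff free_lift_scaleC)
  moreover have "complex_vector.subspace {z. free_lift f z = 0}"
    using free_lift_diff[of f 0 0]
    by (auto intro!: complex_vector.subspaceI simp: free_lift_add free_lift_scaleC)
  ultimately have "complex_vector.span tensor_relators \<subseteq> {z. free_lift f z = 0}"
    by (rule complex_vector.span_minimal)
  with assms(2) show ?thesis
    by (auto simp: tensor_eq_def free_lift_diff)
qed

text \<open>The linear map out of a tensor product induced by a bilinear map; the argument is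
  only ever instantiated by bilinear maps.\<close>

definition tensor_lift ::
  "('a::complex_vector \<Rightarrow> 'b::complex_vector \<Rightarrow> 'c::complex_vector) \<Rightarrow> 'a \<otimes> 'b \<Rightarrow> 'c" where
  "tensor_lift f t = free_lift f (rep_tensor t)"

lemma tensor_lift_abs:
  assumes "cbilinear f"
  shows "tensor_lift f (abs_tensor x) = free_lift f x"
  unfolding tensor_lift_def
  using free_lift_tensor_eq[OF assms] Quotient3_rep_abs[OF Quotient3_tensor]
    equivp_reflp[OF equivp_tensor_eq] by metis

lemma tensor_lift_tensor [simp]: "cbilinear f \<Longrightarrow> tensor_lift f (a \<otimes> b) = f a b"
  by (simp add: tensor_of.abs_eq tensor_lift_abs scaleC_one)

lemma clinear_tensor_lift: "cbilinear f \<Longrightarrow> clinear (tensor_lift f)"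
  unfolding clinear_iff
proof (intro conjI allI)
  fix t u :: "'a \<otimes> 'b" and c :: complex
  assume f: "cbilinear f"
  obtain x y where "t = abs_tensor x" "u = abs_tensor y"
    using Quotient3_abs_rep[OF Quotient3_tensor] by metis
  then show "tensor_lift f (t + u) = tensor_lift f t + tensor_lift f u"
    and "tensor_lift f (c *\<^sub>C t) = c *\<^sub>C tensor_lift f t"
    by (simp_all add: plus_tensor.abs_eq scaleC_tensor.abs_eq tensor_lift_abs[OF f]
        free_lift_add free_lift_scaleC)
qed

lemma tensor_induct [case_names zero tensor add]:
  fixes t :: "'a::complex_vector \<otimes> 'b::complex_vector"
  assumes "P 0" and "\<And>a b. P (a \<otimes> b)" and "\<And>t u. P t \<Longrightarrow> P u \<Longrightarrow> P (t + u)"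
  shows "P t"
proof -
  obtain x where t: "t = abs_tensor x" using Quotient3_abs_rep[OF Quotient3_tensor] by metis
  have single: "P (abs_tensor (Poly_Mapping.single p c))" for p c
  proof -
    have "Poly_Mapping.single p c = c *\<^sub>C Poly_Mapping.single p 1"
      by (rule poly_mapping_eqI) (simp add: lookup_single when_def)
    then have "abs_tensor (Poly_Mapping.single p c) = c *\<^sub>C (fst p \<otimes> snd p)"
      by (simp add: scaleC_tensor.abs_eq tensor_of.abs_eq)
    also have "\<dots> = (c *\<^sub>C fst p) \<otimes> snd p"
      by (simp only: tensor_of_simps)
    finally show ?thesis using assms(2) by simp
  qed
  have "P (abs_tensor (\<Sum>p\<in>A. Poly_Mapping.single p (Poly_Mapping.lookup x p)))"
    if "finite A" for A
    using that
  proof (induction A)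
    case empty
    then show ?case using assms(1) by (simp add: zero_tensor.abs_eq)
  next
    case (insert p A)
    then show ?case
      using assms(3)[OF single insert.IH] by (simp add: plus_tensor.abs_eq)
  qed
  moreover have "x = (\<Sum>p\<in>Poly_Mapping.keys x. Poly_Mapping.single p (Poly_Mapping.lookup x p))"
    by (rule poly_mapping_eqI)
      (simp add: lookup_sum lookup_single when_def in_keys_iff)
  ultimately show ?thesis unfolding t by (metis finite_keys)
qed

lemma clinear_tensor_eqI:
  assumes "clinear f" "clinear g" "\<And>a b. f (a \<otimes> b) = g (a \<otimes> b)"
  shows "f = g"
proof
  fix t
  have "f 0 = 0" "g 0 = 0"
    using assms(1,2) unfolding clinear_iff by (metis add_cancel_right_left)+
  then show "f t = g t"
    using assms by (induction t rule: tensor_induct) (auto simp: clinear_iff)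
qed


section \<open>Structural maps\<close>

definition tensor_map ::
  "('a::complex_vector \<Rightarrow> 'c::complex_vector) \<Rightarrow> ('b::complex_vector \<Rightarrow> 'd::complex_vector) \<Rightarrow>
   'a \<otimes> 'b \<Rightarrow> 'c \<otimes> 'd" (infixr "\<otimes>\<^sub>m" 75) where
  "f \<otimes>\<^sub>m g = tensor_lift (\<lambda>a b. f a \<otimes> g b)"

definition flip :: "'a::complex_vector \<otimes> 'b::complex_vector \<Rightarrow> 'b \<otimes> 'a" where
  "flip = tensor_lift (\<lambda>a b. b \<otimes> a)"

definition assoc ::
  "('a::complex_vector \<otimes> 'b::complex_vector) \<otimes> 'c::complex_vector \<Rightarrow> 'a \<otimes> ('b \<otimes> 'c)" where
  "assoc = tensor_lift (\<lambda>x c. tensor_lift (\<lambda>a b. a \<otimes> (b \<otimes> c)) x)"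

text \<open>\<open>id \<otimes> \<tau> \<otimes> id\<close> on a four-fold tensor product\<close>

definition middle_flip ::
  "('a::complex_vector \<otimes> 'b::complex_vector) \<otimes> ('c::complex_vector \<otimes> 'd::complex_vector) \<Rightarrow>
   ('a \<otimes> 'c) \<otimes> ('b \<otimes> 'd)" where
  "middle_flip = tensor_lift (\<lambda>x y. tensor_lift (\<lambda>a b.
     tensor_lift (\<lambda>c d. (a \<otimes> c) \<otimes> (b \<otimes> d)) y) x)"

text \<open>The canonical isomorphisms \<open>\<complex> \<otimes> V \<cong> V\<close> and \<open>V \<otimes> \<complex> \<cong> V\<close>\<close>

definition lunit :: "complex \<otimes> 'a::complex_vector \<Rightarrow> 'a" where
  "lunit = tensor_lift (\<lambda>c a. c *\<^sub>C a)"

definition runit :: "'a::complex_vector \<otimes> complex \<Rightarrow> 'a" where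
  "runit = tensor_lift (\<lambda>a c. c *\<^sub>C a)"

lemma cbilinear_tensor_map:
  assumes "clinear f" "clinear g"
  shows "cbilinear (\<lambda>a b. f a \<otimes> g b)"
  using assms by (simp add: cbilinear_iff clinear_iff tensor_of_simps)

lemma tensor_map_tensor [simp]:
  "clinear f \<Longrightarrow> clinear g \<Longrightarrow> (f \<otimes>\<^sub>m g) (a \<otimes> b) = f a \<otimes> g b"
  unfolding tensor_map_def by (simp add: cbilinear_tensor_map)

lemma clinear_tensor_map: "clinear f \<Longrightarrow> clinear g \<Longrightarrow> clinear (f \<otimes>\<^sub>m g)"
  unfolding tensor_map_def by (intro clinear_tensor_lift cbilinear_tensor_map)

lemma cbilinear_flip: "cbilinear (\<lambda>a b. b \<otimes> a)"
  by (simp add: cbilinear_iff tensor_of_simps)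

lemma flip_tensor [simp]: "flip (a \<otimes> b) = b \<otimes> a"
  unfolding flip_def by (simp add: cbilinear_flip)

lemma clinear_flip: "clinear flip"
  unfolding flip_def by (intro clinear_tensor_lift cbilinear_flip)

lemma tensor_lift_add_fun:
  "tensor_lift (\<lambda>a b. f a b + g a b) x = tensor_lift f x + tensor_lift g x"
  by (simp add: tensor_lift_def free_lift_def scaleC_right_distrib sum.distrib case_prod_beta)

lemma tensor_lift_scaleC_fun: "tensor_lift (\<lambda>a b. c *\<^sub>C f a b) x = c *\<^sub>C tensor_lift f x"
  by (simp add: tensor_lift_def free_lift_def complex_vector.scale_sum_right case_prod_beta
      mult.commute)

lemma cbilinear_tensor_lift:
  assumes "\<And>y. cbilinear (\<lambda>a b. f a b y)" "\<And>a b. clinear (f a b)"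
  shows "cbilinear (\<lambda>x y. tensor_lift (\<lambda>a b. f a b y) x)"
  unfolding cbilinear_iff
  using clinear_tensor_lift[OF assms(1)] assms(2)
  by (simp add: clinear_iff tensor_lift_add_fun tensor_lift_scaleC_fun)

lemma cbilinear_assoc_inner: "cbilinear (\<lambda>a b. a \<otimes> (b \<otimes> c))"
  by (simp add: cbilinear_iff tensor_of_simps)

lemma cbilinear_assoc: "cbilinear (\<lambda>x c. tensor_lift (\<lambda>a b. a \<otimes> (b \<otimes> c)) x)"
  by (rule cbilinear_tensor_lift) (simp_all add: cbilinear_assoc_inner clinear_iff tensor_of_simps)

lemma assoc_tensor [simp]: "assoc ((a \<otimes> b) \<otimes> c) = a \<otimes> (b \<otimes> c)"
  unfolding assoc_def by (simp add: cbilinear_assoc cbilinear_assoc_inner)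

lemma clinear_assoc: "clinear assoc"
  unfolding assoc_def by (intro clinear_tensor_lift cbilinear_assoc)

lemma cbilinear_middle_flip_inner: "cbilinear (\<lambda>c d. (a \<otimes> c) \<otimes> (b \<otimes> d))"
  by (simp add: cbilinear_iff tensor_of_simps)

lemma cbilinear_middle_flip_outer:
  "cbilinear (\<lambda>a b. tensor_lift (\<lambda>c d. (a \<otimes> c) \<otimes> (b \<otimes> d)) y)"
  by (simp add: cbilinear_iff tensor_of_simps tensor_lift_add_fun tensor_lift_scaleC_fun)

lemma cbilinear_middle_flip:
  "cbilinear (\<lambda>x y. tensor_lift (\<lambda>a b. tensor_lift (\<lambda>c d. (a \<otimes> c) \<otimes> (b \<otimes> d)) y) x)"
  by (rule cbilinear_tensor_lift)
    (simp_all add: cbilinear_middle_flip_outer clinear_tensor_lift cbilinear_middle_flip_inner)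

lemma middle_flip_tensor [simp]:
  "middle_flip ((a \<otimes> b) \<otimes> (c \<otimes> d)) = (a \<otimes> c) \<otimes> (b \<otimes> d)"
  unfolding middle_flip_def
  by (simp add: cbilinear_middle_flip cbilinear_middle_flip_outer cbilinear_middle_flip_inner)

lemma clinear_middle_flip: "clinear middle_flip"
  unfolding middle_flip_def by (intro clinear_tensor_lift cbilinear_middle_flip)

lemma cbilinear_units:
  "cbilinear (\<lambda>c a::'a::complex_vector. c *\<^sub>C a)" "cbilinear (\<lambda>(a::'a) c. c *\<^sub>C a)"
  by (simp_all add: cbilinear_iff complex_vector.scale_left_distrib
      complex_vector.scale_right_distrib mult.commute)

lemma lunit_tensor [simp]: "lunit (c \<otimes> a) = c *\<^sub>C a"
  and runit_tensor [simp]: "runit (a \<otimes> c) = c *\<^sub>C a"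
  unfolding lunit_def runit_def by (simp_all add: cbilinear_units)

lemma clinear_lunit: "clinear lunit" and clinear_runit: "clinear runit"
  unfolding lunit_def runit_def by (simp_all add: clinear_tensor_lift cbilinear_units)


section \<open>Hopf algebras\<close>

locale unital_algebra =
  fixes mult :: "'b \<otimes> 'b \<Rightarrow> 'b::complex_vector" and one :: 'b
  assumes clinear_mult: "clinear mult"
    and mult_assoc: "mult \<circ> (mult \<otimes>\<^sub>m id) = mult \<circ> (id \<otimes>\<^sub>m mult) \<circ> assoc"
    and mult_one_left: "mult (one \<otimes> a) = a"
    and mult_one_right: "mult (a \<otimes> one) = a"

locale coalgebra =
  fixes \<Delta> :: "'b \<Rightarrow> 'b::complex_vector \<otimes> 'b" and \<delta> :: "'b \<Rightarrow> complex"
  assumes clinear_comult: "clinear \<Delta>"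
    and clinear_counit: "clinear \<delta>"
    and coassoc: "assoc \<circ> (\<Delta> \<otimes>\<^sub>m id) \<circ> \<Delta> = (id \<otimes>\<^sub>m \<Delta>) \<circ> \<Delta>"
    and counit_left: "lunit \<circ> (\<delta> \<otimes>\<^sub>m id) \<circ> \<Delta> = id"
    and counit_right: "runit \<circ> (id \<otimes>\<^sub>m \<delta>) \<circ> \<Delta> = id"

definition tensor_comult ::
  "('b::complex_vector \<Rightarrow> 'b \<otimes> 'b) \<Rightarrow> 'b \<otimes> 'b \<Rightarrow> ('b \<otimes> 'b) \<otimes> ('b \<otimes> 'b)" where
  "tensor_comult \<Delta> = middle_flip \<circ> (\<Delta> \<otimes>\<^sub>m \<Delta>)"

definition tensor_counit :: "('b::complex_vector \<Rightarrow> complex) \<Rightarrow> 'b \<otimes> 'b \<Rightarrow> complex" where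
  "tensor_counit \<delta> = lunit \<circ> (\<delta> \<otimes>\<^sub>m \<delta>)"

locale bialgebra = unital_algebra mult one + coalgebra \<Delta> \<delta>
  for mult :: "'b \<otimes> 'b \<Rightarrow> 'b::complex_vector" and one :: 'b
    and \<Delta> :: "'b \<Rightarrow> 'b \<otimes> 'b" and \<delta> :: "'b \<Rightarrow> complex" +
  assumes comult_mult: "\<Delta> \<circ> mult = (mult \<otimes>\<^sub>m mult) \<circ> tensor_comult \<Delta>"
    and comult_one: "\<Delta> one = one \<otimes> one"
    and counit_mult: "\<delta> \<circ> mult = tensor_counit \<delta>"
    and counit_one: "\<delta> one = 1"

locale hopf_algebra = bialgebra mult one \<Delta> \<delta>
  for mult :: "'b \<otimes> 'b \<Rightarrow> 'b::complex_vector" and one :: 'b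
    and \<Delta> :: "'b \<Rightarrow> 'b \<otimes> 'b" and \<delta> :: "'b \<Rightarrow> complex" +
  fixes S :: "'b \<Rightarrow> 'b"
  assumes clinear_antipode: "clinear S"
    and antipode_left: "mult \<circ> (S \<otimes>\<^sub>m id) \<circ> \<Delta> = (\<lambda>a. \<delta> a *\<^sub>C one)"
    and antipode_right: "mult \<circ> (id \<otimes>\<^sub>m S) \<circ> \<Delta> = (\<lambda>a. \<delta> a *\<^sub>C one)"

definition cocommutative :: "('b::complex_vector \<Rightarrow> 'b \<otimes> 'b) \<Rightarrow> bool" where
  "cocommutative \<Delta> \<longleftrightarrow> \<Delta> = flip \<circ> \<Delta>"


section \<open>Convolution\<close>

text \<open>Convolution over a coalgebra with comultiplication \<open>\<Lambda>\<close>, where one factor is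
  scalar-valued. If both are, the two versions agree.\<close>

definition conv_left ::
  "('c \<Rightarrow> 'c::complex_vector \<otimes> 'c) \<Rightarrow> ('c \<Rightarrow> complex) \<Rightarrow> ('c \<Rightarrow> 'd::complex_vector) \<Rightarrow> 'c \<Rightarrow> 'd" where
  "conv_left \<Lambda> L f = lunit \<circ> (L \<otimes>\<^sub>m f) \<circ> \<Lambda>"

definition conv_right ::
  "('c \<Rightarrow> 'c::complex_vector \<otimes> 'c) \<Rightarrow> ('c \<Rightarrow> 'd::complex_vector) \<Rightarrow> ('c \<Rightarrow> complex) \<Rightarrow> 'c \<Rightarrow> 'd" where
  "conv_right \<Lambda> f L = runit \<circ> (f \<otimes>\<^sub>m L) \<circ> \<Lambda>"

primrec conv_power ::
  "('c \<Rightarrow> 'c::complex_vector \<otimes> 'c) \<Rightarrow> ('c \<Rightarrow> complex) \<Rightarrow> ('c \<Rightarrow> complex) \<Rightarrow> nat \<Rightarrow> 'c \<Rightarrow> complex" where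
  "conv_power \<Lambda> \<epsilon> L 0 = \<epsilon>"
| "conv_power \<Lambda> \<epsilon> L (Suc n) = conv_left \<Lambda> L (conv_power \<Lambda> \<epsilon> L n)"

text \<open>\<open>conv_exp \<Lambda> \<epsilon> t L\<close> is the convolution exponential of \<open>t L\<close>.\<close>

definition conv_exp ::
  "('c \<Rightarrow> 'c::complex_vector \<otimes> 'c) \<Rightarrow> ('c \<Rightarrow> complex) \<Rightarrow> real \<Rightarrow> ('c \<Rightarrow> complex) \<Rightarrow> 'c \<Rightarrow> complex" where
  "conv_exp \<Lambda> \<epsilon> t L x = suminf (\<lambda>n. of_real (t ^ n / fact n) * conv_power \<Lambda> \<epsilon> L n x)"


section \<open>Additive deformations\<close>

text \<open>Only the values of the family at times \<open>t \<ge> 0\<close> are relevant.\<close>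

definition additive_deformation ::
  "('b \<otimes> 'b \<Rightarrow> 'b::complex_vector) \<Rightarrow> 'b \<Rightarrow> ('b \<Rightarrow> 'b \<otimes> 'b) \<Rightarrow> ('b \<Rightarrow> complex) \<Rightarrow>
   (real \<Rightarrow> 'b \<otimes> 'b \<Rightarrow> 'b) \<Rightarrow> bool" where
  "additive_deformation mult one \<Delta> \<delta> \<mu> \<longleftrightarrow>
     (\<forall>t\<ge>0. unital_algebra (\<mu> t) one) \<and>
     \<mu> 0 = mult \<and>
     (\<forall>t\<ge>0. \<forall>s\<ge>0. \<Delta> \<circ> \<mu> (t + s) = (\<mu> t \<otimes>\<^sub>m \<mu> s) \<circ> tensor_comult \<Delta>) \<and>
     (\<forall>x. ((\<lambda>t. \<delta> (\<mu> t x)) \<longlongrightarrow> tensor_counit \<delta> x) (at_right 0))"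

definition has_generator ::
  "('b::complex_vector \<Rightarrow> complex) \<Rightarrow> (real \<Rightarrow> 'b \<otimes> 'b \<Rightarrow> 'b) \<Rightarrow> ('b \<otimes> 'b \<Rightarrow> complex) \<Rightarrow> bool" where
  "has_generator \<delta> \<mu> L \<longleftrightarrow>
     (\<forall>x. ((\<lambda>t. \<delta> (\<mu> t x)) has_vector_derivative L x) (at 0 within {0..}))"

definition deformation_by ::
  "('b \<otimes> 'b \<Rightarrow> 'b::complex_vector) \<Rightarrow> ('b \<Rightarrow> 'b \<otimes> 'b) \<Rightarrow> ('b \<Rightarrow> complex) \<Rightarrow>
   ('b \<otimes> 'b \<Rightarrow> complex) \<Rightarrow> real \<Rightarrow> 'b \<otimes> 'b \<Rightarrow> 'b" where
  "deformation_by mult \<Delta> \<delta> L t =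
     conv_right (tensor_comult \<Delta>) mult (conv_exp (tensor_comult \<Delta>) (tensor_counit \<delta>) t L)"

definition coboundary ::
  "('b \<otimes> 'b \<Rightarrow> 'b::complex_vector) \<Rightarrow> ('b \<Rightarrow> complex) \<Rightarrow> ('b \<Rightarrow> complex) \<Rightarrow> 'b \<otimes> 'b \<Rightarrow> complex" where
  "coboundary mult \<delta> \<psi> =
     tensor_lift (\<lambda>a b. \<delta> a * \<psi> b - \<psi> (mult (a \<otimes> b)) + \<psi> a * \<delta> b)"

lemma coboundary_tensor:
  assumes "clinear mult" "clinear \<delta>" "clinear \<psi>"
  shows "coboundary mult \<delta> \<psi> (a \<otimes> b) = \<delta> a * \<psi> b - \<psi> (mult (a \<otimes> b)) + \<psi> a * \<delta> b"
proof -
  have "cbilinear (\<lambda>a b. \<delta> a * \<psi> b - \<psi> (mult (a \<otimes> b)) + \<psi> a * \<delta> b)"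
    using assms by (simp add: cbilinear_iff clinear_iff tensor_of_simps algebra_simps)
  then show ?thesis unfolding coboundary_def by simp
qed

definition trivial_deformation ::
  "('b \<otimes> 'b \<Rightarrow> 'b::complex_vector) \<Rightarrow> 'b \<Rightarrow> ('b \<Rightarrow> 'b \<otimes> 'b) \<Rightarrow> ('b \<Rightarrow> complex) \<Rightarrow>
   (real \<Rightarrow> 'b \<otimes> 'b \<Rightarrow> 'b) \<Rightarrow> bool" where
  "trivial_deformation mult one \<Delta> \<delta> \<mu> \<longleftrightarrow>
     additive_deformation mult one \<Delta> \<delta> \<mu> \<and>
     (\<exists>\<psi>. clinear \<psi> \<and> \<psi> one = 0 \<and> conv_left \<Delta> \<psi> id = conv_right \<Delta> id \<psi> \<and>
          has_generator \<delta> \<mu> (coboundary mult \<delta> \<psi>))"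

definition constant_antipode ::
  "'b \<Rightarrow> ('b::complex_vector \<Rightarrow> 'b \<otimes> 'b) \<Rightarrow> ('b \<Rightarrow> complex) \<Rightarrow> ('b \<Rightarrow> 'b) \<Rightarrow>
   (real \<Rightarrow> 'b \<otimes> 'b \<Rightarrow> 'b) \<Rightarrow> bool" where
  "constant_antipode one \<Delta> \<delta> S \<mu> \<longleftrightarrow>
     (\<forall>t. \<mu> t \<circ> (S \<otimes>\<^sub>m id) \<circ> \<Delta> = (\<lambda>a. \<delta> a *\<^sub>C one) \<and>
          \<mu> t \<circ> (id \<otimes>\<^sub>m S) \<circ> \<Delta> = (\<lambda>a. \<delta> a *\<^sub>C one))"

end

theory Submission
  imports Defs
begin

text \<open>Write \<open>L\<^sup>S(a \<otimes> b) = L(S(b) \<otimes> S(a))\<close>. A generator of an additive deformation is a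
  normalized Hochschild 2-cocycle for the trivial bimodule: this is the derivative at \<open>t = 0\<close>
  of the associativity of \<open>\<mu>\<^sub>t\<close> (\<open>normalized_cocycle_generator\<close>). Applying the cocycle
  identity twice to \<open>\<sigma>(a b) = L(a\<^bsub>(1)\<^esub>b\<^bsub>(1)\<^esub> \<otimes> S(a\<^bsub>(2)\<^esub>b\<^bsub>(2)\<^esub>))\<close> gives \<open>\<partial>\<sigma> = L + L\<^sup>S\<close>
  (\<open>cocycle_antipode\<close>). So the symmetric part \<open>L\<^sub>1\<close> of \<open>L\<close> under this involution is the
  coboundary of \<open>\<sigma>/2\<close>, and the skew part \<open>L\<^sub>2 = L - L\<^sub>1\<close> is again a normalized cocycle.

  Conversely, on a cocommutative bialgebra every normalized cocycle \<open>L\<close> generates the additive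
  deformation \<open>\<mu> \<star> e\<^sup>t\<^sup>L\<close> (\<open>additive_deformation_cocycle\<close>). The convolution algebra of
  functionals on a cocommutative coalgebra is commutative, so the exponential turns sums into
  convolution products (\<open>conv_exp_add\<close>), and associativity of \<open>\<mu> \<star> e\<^sup>t\<^sup>L\<close> becomes the
  exponential of the cocycle identity on the triple tensor product (\<open>deformation_assoc\<close>). The
  exponential series converges because each element lies in a finite-dimensional space that is
  invariant under convolution with \<open>L\<close> (\<open>conv_power_bound\<close>).

  Finally, cocommutativity makes \<open>S\<close> an involutive coalgebra map. A skew cocycle therefore
  vanishes on \<open>S(a\<^bsub>(1)\<^esub>) \<otimes> a\<^bsub>(2)\<^esub>\<close> and \<open>a\<^bsub>(1)\<^esub> \<otimes> S(a\<^bsub>(2)\<^esub>)\<close>; these expressions are coalgebra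
  maps in \<open>a\<close>, so the exponential of \<open>L\<^sub>2\<close> restricts along them to the counit, and the
  antipode of \<open>\<mu>\<close> is one for every \<open>\<mu> \<star> e\<^sup>t\<^sup>L\<close> with \<open>L = L\<^sub>2\<close>
  (\<open>constant_antipode_deformation\<close>).\<close>

section \<open>Linear maps and Sweedler sums\<close>

lemma clinear_id: "clinear (\<lambda>x. x)"
  by (simp add: clinear_iff)

lemma clinear_comp: "clinear f \<Longrightarrow> clinear g \<Longrightarrow> clinear (\<lambda>x. f (g x))"
  by (simp add: clinear_iff)

lemma clinear_add_fun: "clinear f \<Longrightarrow> clinear g \<Longrightarrow> clinear (\<lambda>x. f x + g x)"
  by (simp add: clinear_iff scaleC_right_distrib algebra_simps)

lemma clinear_scaleC_left: "clinear f \<Longrightarrow> clinear (\<lambda>x. f x *\<^sub>C y)"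
  by (simp add: clinear_iff scaleC_left_distrib scaleC_scaleC)

lemma clinear_scaleC_right: "clinear f \<Longrightarrow> clinear (\<lambda>x. c *\<^sub>C f x)"
  by (simp add: clinear_iff scaleC_right_distrib scaleC_scaleC mult.commute)

lemma clinear_mult_left: "clinear f \<Longrightarrow> clinear (\<lambda>x. f x * (c::complex))"
  by (simp add: clinear_iff algebra_simps)

lemma clinear_mult_right: "clinear f \<Longrightarrow> clinear (\<lambda>x. (c::complex) * f x)"
  by (simp add: clinear_iff algebra_simps)

lemma clinear_tensor_left: "clinear f \<Longrightarrow> clinear (\<lambda>x. f x \<otimes> b)"
  by (simp add: clinear_iff tensor_of_simps)

lemma clinear_tensor_right: "clinear f \<Longrightarrow> clinear (\<lambda>x. a \<otimes> f x)"
  by (simp add: clinear_iff tensor_of_simps)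

lemma clinear_0: "clinear f \<Longrightarrow> f 0 = 0"
  unfolding clinear_iff by (metis add_cancel_right_left)

lemma clinear_sum: "clinear f \<Longrightarrow> f (\<Sum>i\<in>A. g i) = (\<Sum>i\<in>A. f (g i))"
proof (induction A rule: infinite_finite_induct)
  case (insert x F)
  then show ?case by (simp add: clinear_iff)
qed (simp_all add: clinear_0)

lemma cbilinearI:
  "(\<And>b. clinear (\<lambda>a. f a b)) \<Longrightarrow> (\<And>a. clinear (\<lambda>b. f a b)) \<Longrightarrow> cbilinear f"
  by (simp add: cbilinear_def)

text \<open>The Sweedler sum \<open>f (x\<^bsub>(1)\<^esub>, x\<^bsub>(2)\<^esub>)\<close>. It is evaluated on one chosen representative
  of \<open>\<Delta> x\<close>, so it is an honest finite sum whatever \<open>f\<close> is: exchanging two such sums or pulling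
  out a linear map has no side condition. Only the coalgebra axioms ask for (multi)linearity
  of \<open>f\<close>, because they compare different representatives.\<close>

definition sweedler ::
  "('c \<Rightarrow> 'a::complex_vector \<otimes> 'b::complex_vector) \<Rightarrow> 'c \<Rightarrow> ('a \<Rightarrow> 'b \<Rightarrow> 'd::complex_vector) \<Rightarrow> 'd"
  where "sweedler \<Delta> x f = tensor_lift f (\<Delta> x)"

lemma sweedler_sum:
  "sweedler \<Delta> x f = (\<Sum>p\<in>Poly_Mapping.keys (rep_tensor (\<Delta> x)).
     Poly_Mapping.lookup (rep_tensor (\<Delta> x)) p *\<^sub>C f (fst p) (snd p))"
  by (simp add: sweedler_def tensor_lift_def free_lift_def case_prod_beta)

lemma sweedler_linear: "clinear g \<Longrightarrow> g (sweedler \<Delta> x f) = sweedler \<Delta> x (\<lambda>u v. g (f u v))"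
  unfolding sweedler_sum by (simp add: clinear_sum) (simp add: clinear_iff)

lemma sweedler_swap:
  "sweedler \<Delta> x (\<lambda>u v. sweedler \<Delta>' y (\<lambda>p q. f u v p q)) =
   sweedler \<Delta>' y (\<lambda>p q. sweedler \<Delta> x (\<lambda>u v. f u v p q))"
  unfolding sweedler_sum complex_vector.scale_sum_right
  by (subst sum.swap) (simp add: scaleC_scaleC mult.commute)

lemma sweedler_add: "sweedler \<Delta> x (\<lambda>u v. f u v + g u v) = sweedler \<Delta> x f + sweedler \<Delta> x g"
  by (simp add: sweedler_def tensor_lift_add_fun)

lemma sweedler_mult: "sweedler \<Delta> x (\<lambda>u v. c * f u v) = (c::complex) * sweedler \<Delta> x f"
  using sweedler_linear[OF clinear_mult_right[OF clinear_id, of c], where \<Delta> = \<Delta> and x = x and f = f] by simp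

lemma sweedler_mult_right: "sweedler \<Delta> x (\<lambda>u v. f u v * c) = sweedler \<Delta> x f * (c::complex)"
  using sweedler_linear[OF clinear_mult_left[OF clinear_id, of c], where \<Delta> = \<Delta> and x = x and f = f] by simp

lemma sweedler_scaleC: "sweedler \<Delta> x (\<lambda>u v. c *\<^sub>C f u v) = c *\<^sub>C sweedler \<Delta> x f"
  by (simp add: sweedler_def tensor_lift_scaleC_fun)

lemma sweedler_scaleC_left: "sweedler \<Delta> x (\<lambda>u v. f u v *\<^sub>C y) = sweedler \<Delta> x f *\<^sub>C y"
  using sweedler_linear[OF clinear_scaleC_left[OF clinear_id, of y], where \<Delta> = \<Delta> and x = x and f = f] by simp

lemma sweedler_diff: "sweedler \<Delta> x (\<lambda>u v. f u v - g u v) = sweedler \<Delta> x f - sweedler \<Delta> x g"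
  using sweedler_add[of \<Delta> x "\<lambda>u v. f u v - g u v" g] by simp

lemma sweedler_0: "sweedler \<Delta> x (\<lambda>u v. 0) = 0"
  by (simp add: sweedler_sum)

lemma sweedler_sum_fun:
  "sweedler \<Delta> x (\<lambda>u v. \<Sum>i\<in>A. f i u v) = (\<Sum>i\<in>A. sweedler \<Delta> x (f i))"
  by (induction A rule: infinite_finite_induct) (simp_all add: sweedler_0 sweedler_add)

lemma sweedler_sums:
  fixes f :: "nat \<Rightarrow> 'a::complex_vector \<Rightarrow> 'b::complex_vector \<Rightarrow> complex"
  assumes "\<And>u v. (\<lambda>n. f n u v) sums g u v"
  shows "(\<lambda>n. sweedler \<Delta> x (f n)) sums sweedler \<Delta> x g"
  unfolding sweedler_sum scaleC_complex_def by (intro sums_sum sums_mult assms)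

lemma sweedler_has_vector_derivative:
  fixes f :: "real \<Rightarrow> 'a::complex_vector \<Rightarrow> 'b::complex_vector \<Rightarrow> complex"
  assumes "\<And>u v. ((\<lambda>t. f t u v) has_vector_derivative g u v) F"
  shows "((\<lambda>t. sweedler \<Delta> x (f t)) has_vector_derivative sweedler \<Delta> x g) F"
  unfolding sweedler_sum scaleC_complex_def
  by (intro has_vector_derivative_sum has_vector_derivative_mult_right assms)

lemma clinear_sweedler:
  assumes "clinear \<Delta>" "clinear g" "\<And>b. clinear (\<lambda>a. f a b)" "\<And>a. clinear (\<lambda>b. f a b)"
  shows "clinear (\<lambda>x. sweedler \<Delta> (g x) f)"
  unfolding sweedler_def
  by (intro clinear_comp[OF clinear_tensor_lift] clinear_comp[OF assms(1)] cbilinearI assms)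

lemma clinear_sweedler_fun:
  assumes "\<And>u v. clinear (\<lambda>y. f y u v)"
  shows "clinear (\<lambda>y. sweedler \<Delta> x (f y))"
proof -
  have "f (y + z) = (\<lambda>u v. f y u v + f z u v)" "f (c *\<^sub>C y) = (\<lambda>u v. c *\<^sub>C f y u v)" for c y z
    using assms by (simp_all add: clinear_iff fun_eq_iff)
  then show ?thesis by (simp add: clinear_iff sweedler_add sweedler_scaleC)
qed

text \<open>These rules reduce the linearity of a composite expression in one variable to that
  of its building blocks; together with facts of the form \<open>clinear_comp[OF _]\<close> for each linear
  map involved, they discharge the multilinearity conditions of the Sweedler rules.\<close>

lemmas clinear_intros = clinear_id clinear_add_fun clinear_scaleC_left clinear_scaleC_right
  clinear_mult_left clinear_mult_right clinear_tensor_left clinear_tensor_right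
  clinear_sweedler_fun

lemma tensor_expand:
  assumes "clinear g"
  shows "g t = tensor_lift (\<lambda>a b. g (a \<otimes> b)) t"
proof -
  have *: "cbilinear (\<lambda>a b. g (a \<otimes> b))"
    by (intro cbilinearI clinear_comp[OF assms] clinear_intros)
  have "g = tensor_lift (\<lambda>a b. g (a \<otimes> b))"
    by (rule clinear_tensor_eqI[OF assms clinear_tensor_lift[OF *]]) (simp add: *)
  then show ?thesis by (rule fun_cong)
qed

lemma linear_sweedler:
  "clinear g \<Longrightarrow> g (\<Delta> x) = sweedler \<Delta> x (\<lambda>u v. g (u \<otimes> v))"
  unfolding sweedler_def by (rule tensor_expand)

lemma comult_sweedler: "\<Delta> x = sweedler \<Delta> x (\<lambda>u v. u \<otimes> v)"
  by (rule linear_sweedler[OF clinear_id])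

lemma sweedler_cong: "(\<And>u v. f u v = g u v) \<Longrightarrow> sweedler \<Delta> x f = sweedler \<Delta> x g"
  by (rule arg_cong[where f = "sweedler \<Delta> x"]) (intro ext)

lemma clinear_runit_tensor: "clinear f \<Longrightarrow> clinear g \<Longrightarrow> clinear (\<lambda>t. runit ((f \<otimes>\<^sub>m g) t))"
  by (intro clinear_comp[OF clinear_runit] clinear_tensor_map)
lemma clinear_lunit_tensor: "clinear f \<Longrightarrow> clinear g \<Longrightarrow> clinear (\<lambda>t. lunit ((f \<otimes>\<^sub>m g) t))"
  by (intro clinear_comp[OF clinear_lunit] clinear_tensor_map)

lemma conv_right_sweedler:
  "clinear f \<Longrightarrow> clinear g \<Longrightarrow> conv_right \<Delta> f g x = sweedler \<Delta> x (\<lambda>u v. g v *\<^sub>C f u)"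
  using linear_sweedler[OF clinear_runit_tensor, of f g \<Delta> x] by (simp only: conv_right_def) simp

lemma conv_left_sweedler:
  "clinear f \<Longrightarrow> clinear g \<Longrightarrow> conv_left \<Delta> f g x = sweedler \<Delta> x (\<lambda>u v. f u *\<^sub>C g v)"
  using linear_sweedler[OF clinear_lunit_tensor, of f g \<Delta> x] by (simp only: conv_left_def) simp

lemma coassoc_left:
  assumes "clinear \<Delta>"
  shows "(assoc \<circ> (\<Delta> \<otimes>\<^sub>m id) \<circ> \<Delta>) x = sweedler \<Delta> x (\<lambda>u v. sweedler \<Delta> u (\<lambda>p q. p \<otimes> (q \<otimes> v)))"
proof -
  have "assoc ((\<Delta> \<otimes>\<^sub>m id) (\<Delta> x)) = sweedler \<Delta> x (\<lambda>u v. assoc ((\<Delta> \<otimes>\<^sub>m id) (u \<otimes> v)))"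
    using assms
    by (intro linear_sweedler clinear_comp[OF clinear_assoc] clinear_tensor_map)
       (simp_all add: clinear_iff)
  also have "\<dots> = sweedler \<Delta> x (\<lambda>u v. assoc (\<Delta> u \<otimes> v))"
    using assms by (simp add: complex_vector.linear_id)
  also have "\<dots> = sweedler \<Delta> x (\<lambda>u v. sweedler \<Delta> u (\<lambda>p q. assoc ((p \<otimes> q) \<otimes> v)))"
    by (intro sweedler_cong linear_sweedler clinear_comp[OF clinear_assoc] clinear_intros)
  finally show ?thesis by simp
qed

lemma coassoc_right:
  assumes "clinear \<Delta>"
  shows "((id \<otimes>\<^sub>m \<Delta>) \<circ> \<Delta>) x = sweedler \<Delta> x (\<lambda>u v. sweedler \<Delta> v (\<lambda>p q. u \<otimes> (p \<otimes> q)))"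
proof -
  have "(id \<otimes>\<^sub>m \<Delta>) (\<Delta> x) = sweedler \<Delta> x (\<lambda>u v. (id \<otimes>\<^sub>m \<Delta>) (u \<otimes> v))"
    using assms by (intro linear_sweedler clinear_tensor_map) (simp_all add: clinear_iff)
  also have "\<dots> = sweedler \<Delta> x (\<lambda>u v. u \<otimes> \<Delta> v)"
    using assms by (simp add: complex_vector.linear_id)
  also have "\<dots> = sweedler \<Delta> x (\<lambda>u v. sweedler \<Delta> v (\<lambda>p q. u \<otimes> (p \<otimes> q)))"
    by (intro sweedler_cong linear_sweedler clinear_intros)
  finally show ?thesis by simp
qed

lemma coalgebraI:
  assumes "clinear \<Delta>" "clinear \<epsilon>"
    and "\<And>x. sweedler \<Delta> x (\<lambda>u v. sweedler \<Delta> u (\<lambda>p q. p \<otimes> (q \<otimes> v))) =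
             sweedler \<Delta> x (\<lambda>u v. sweedler \<Delta> v (\<lambda>p q. u \<otimes> (p \<otimes> q)))"
    and "\<And>x. sweedler \<Delta> x (\<lambda>u v. \<epsilon> u *\<^sub>C v) = x" "\<And>x. sweedler \<Delta> x (\<lambda>u v. \<epsilon> v *\<^sub>C u) = x"
  shows "coalgebra \<Delta> \<epsilon>"
proof (rule coalgebra.intro)
  show "assoc \<circ> (\<Delta> \<otimes>\<^sub>m id) \<circ> \<Delta> = (id \<otimes>\<^sub>m \<Delta>) \<circ> \<Delta>"
    using assms(3) by (simp only: fun_eq_iff coassoc_left[OF assms(1)] coassoc_right[OF assms(1)]) simp
  show "lunit \<circ> (\<epsilon> \<otimes>\<^sub>m id) \<circ> \<Delta> = id" "runit \<circ> (id \<otimes>\<^sub>m \<epsilon>) \<circ> \<Delta> = id"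
    using assms conv_left_sweedler[OF assms(2) complex_vector.linear_id, of \<Delta>]
      conv_right_sweedler[OF complex_vector.linear_id assms(2), of \<Delta>]
    by (simp_all add: fun_eq_iff conv_left_def conv_right_def)
qed (rule assms)+

context coalgebra
begin

lemma sweedler_counit_left: "clinear f \<Longrightarrow> sweedler \<Delta> x (\<lambda>u v. \<delta> u *\<^sub>C f v) = f x"
proof -
  assume f: "clinear f"
  have "x = (lunit \<circ> (\<delta> \<otimes>\<^sub>m id) \<circ> \<Delta>) x" by (simp add: counit_left)
  also have "\<dots> = sweedler \<Delta> x (\<lambda>u v. \<delta> u *\<^sub>C v)"
    using conv_left_sweedler[OF clinear_counit complex_vector.linear_id, of \<Delta> x]
    by (simp add: conv_left_def)
  finally have "f x = f (sweedler \<Delta> x (\<lambda>u v. \<delta> u *\<^sub>C v))" by simp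
  with f show ?thesis by (simp add: sweedler_linear) (simp add: clinear_iff)
qed

lemma sweedler_counit_right: "clinear f \<Longrightarrow> sweedler \<Delta> x (\<lambda>u v. \<delta> v *\<^sub>C f u) = f x"
proof -
  assume f: "clinear f"
  have "x = (runit \<circ> (id \<otimes>\<^sub>m \<delta>) \<circ> \<Delta>) x" by (simp add: counit_right)
  also have "\<dots> = sweedler \<Delta> x (\<lambda>u v. \<delta> v *\<^sub>C u)"
    using conv_right_sweedler[OF complex_vector.linear_id clinear_counit, of \<Delta> x]
    by (simp add: conv_right_def)
  finally have "f x = f (sweedler \<Delta> x (\<lambda>u v. \<delta> v *\<^sub>C u))" by simp
  with f show ?thesis by (simp add: sweedler_linear) (simp add: clinear_iff)
qed

lemma sweedler_counit_mult:
  fixes f :: "'b \<Rightarrow> complex"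
  assumes "clinear f"
  shows "sweedler \<Delta> x (\<lambda>u v. \<delta> u * f v) = f x" "sweedler \<Delta> x (\<lambda>u v. f u * \<delta> v) = f x"
proof -
  show "sweedler \<Delta> x (\<lambda>u v. \<delta> u * f v) = f x"
    using sweedler_counit_left[OF assms] by simp
  have "(\<lambda>u v. f u * \<delta> v) = (\<lambda>u v. \<delta> v *\<^sub>C f u)" by (simp add: mult.commute)
  then show "sweedler \<Delta> x (\<lambda>u v. f u * \<delta> v) = f x"
    using sweedler_counit_right[OF assms] by metis
qed

lemma sweedler_coassoc:
  assumes "\<And>v w. clinear (\<lambda>u. f u v w)" "\<And>u w. clinear (\<lambda>v. f u v w)" "\<And>u v. clinear (\<lambda>w. f u v w)"
  shows "sweedler \<Delta> x (\<lambda>u v. sweedler \<Delta> u (\<lambda>p q. f p q v)) =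
         sweedler \<Delta> x (\<lambda>u v. sweedler \<Delta> v (\<lambda>p q. f u p q))"
proof -
  define g where "g = tensor_lift (\<lambda>a y. tensor_lift (\<lambda>b c. f a b c) y)"
  have 1: "cbilinear (\<lambda>b c. f a b c)" for a
    using assms by (intro cbilinearI)
  have 2: "cbilinear (\<lambda>a y. tensor_lift (\<lambda>b c. f a b c) y)"
    using clinear_sweedler_fun[where \<Delta> = "\<lambda>y. y" and f = f] assms(1)
    by (intro cbilinearI clinear_tensor_lift[OF 1]) (simp add: sweedler_def)
  have g: "clinear g" "g (a \<otimes> (b \<otimes> c)) = f a b c" for a b c
    using 1 2 by (simp_all add: g_def clinear_tensor_lift)
  show ?thesis
    using arg_cong[OF fun_cong[OF coassoc, of x], of g]
    by (simp only: coassoc_left[OF clinear_comult] coassoc_right[OF clinear_comult]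
        sweedler_linear[OF g(1)] g(2))
qed

end

lemma sweedler_cocommutative:
  assumes "cocommutative \<Delta>" "\<And>b. clinear (\<lambda>a. f a b)" "\<And>a. clinear (\<lambda>b. f a b)"
  shows "sweedler \<Delta> x f = sweedler \<Delta> x (\<lambda>u v. f v u)"
proof -
  have f: "cbilinear f" by (intro cbilinearI assms)
  have "sweedler \<Delta> x f = tensor_lift f (flip (\<Delta> x))"
    using assms(1) unfolding cocommutative_def sweedler_def by (metis comp_apply)
  also have "\<dots> = sweedler \<Delta> x (\<lambda>u v. tensor_lift f (flip (u \<otimes> v)))"
    by (intro linear_sweedler clinear_comp[OF clinear_tensor_lift[OF f]] clinear_flip)
  finally show ?thesis using f by simp
qed

lemma cocommutative_iff_sweedler:
  "cocommutative \<Delta> \<longleftrightarrow> (\<forall>x. sweedler \<Delta> x (\<lambda>u v. u \<otimes> v) = sweedler \<Delta> x (\<lambda>u v. v \<otimes> u))"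
  unfolding cocommutative_def
  unfolding fun_eq_iff comp_apply linear_sweedler[OF clinear_flip, of \<Delta>] flip_tensor
  by (subst comult_sweedler[of \<Delta>]) (rule refl)

section \<open>Tensor products and morphisms of coalgebras\<close>

text \<open>In Sweedler notation, \<open>f (x\<^bsub>(1)\<^esub>, x\<^bsub>(2)\<^esub>, x\<^bsub>(3)\<^esub>, x\<^bsub>(4)\<^esub>) = f (x\<^bsub>(1)\<^esub>, x\<^bsub>(3)\<^esub>,
  x\<^bsub>(2)\<^esub>, x\<^bsub>(4)\<^esub>)\<close>: after rebracketing, the two middle factors come from a single
  comultiplication, to which cocommutativity applies.\<close>

lemma (in coalgebra) sweedler_middle_swap:
  assumes "cocommutative \<Delta>"
    and "\<And>b c d. clinear (\<lambda>a. f a b c d)" "\<And>a c d. clinear (\<lambda>b. f a b c d)"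
    "\<And>a b d. clinear (\<lambda>c. f a b c d)" "\<And>a b c. clinear (\<lambda>d. f a b c d)"
  shows "sweedler \<Delta> x (\<lambda>u v. sweedler \<Delta> u (\<lambda>a b. sweedler \<Delta> v (\<lambda>c d. f a b c d))) =
         sweedler \<Delta> x (\<lambda>u v. sweedler \<Delta> u (\<lambda>a b. sweedler \<Delta> v (\<lambda>c d. f a c b d)))"
proof -
  have right: "sweedler \<Delta> x (\<lambda>u v. sweedler \<Delta> u (\<lambda>a b. sweedler \<Delta> v (\<lambda>c d. g a b c d))) =
      sweedler \<Delta> x (\<lambda>a w. sweedler \<Delta> w (\<lambda>z d. sweedler \<Delta> z (\<lambda>b c. g a b c d)))"
    if g: "\<And>b c d. clinear (\<lambda>a. g a b c d)" "\<And>a c d. clinear (\<lambda>b. g a b c d)"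
    "\<And>a b d. clinear (\<lambda>c. g a b c d)" "\<And>a b c. clinear (\<lambda>d. g a b c d)" for g :: "'b \<Rightarrow> 'b \<Rightarrow> 'b \<Rightarrow> 'b \<Rightarrow> 'a"
  proof -
    have "sweedler \<Delta> x (\<lambda>u v. sweedler \<Delta> u (\<lambda>a b. sweedler \<Delta> v (\<lambda>c d. g a b c d))) =
      sweedler \<Delta> x (\<lambda>a w. sweedler \<Delta> w (\<lambda>b v. sweedler \<Delta> v (\<lambda>c d. g a b c d)))"
      by (rule sweedler_coassoc) (intro clinear_intros clinear_sweedler clinear_comult g)+
    also have "\<dots> = sweedler \<Delta> x (\<lambda>a w. sweedler \<Delta> w (\<lambda>z d. sweedler \<Delta> z (\<lambda>b c. g a b c d)))"
      by (intro sweedler_cong sweedler_coassoc[symmetric] g)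
    finally show ?thesis .
  qed
  have "sweedler \<Delta> x (\<lambda>a w. sweedler \<Delta> w (\<lambda>z d. sweedler \<Delta> z (\<lambda>b c. f a b c d))) =
        sweedler \<Delta> x (\<lambda>a w. sweedler \<Delta> w (\<lambda>z d. sweedler \<Delta> z (\<lambda>b c. f a c b d)))"
    by (intro sweedler_cong sweedler_cocommutative[OF assms(1)] assms(2-))
  then show ?thesis using right[of f] right[of "\<lambda>a b c d. f a c b d"] assms(2-) by simp
qed

definition comult_prod ::
  "('a::complex_vector \<Rightarrow> 'a \<otimes> 'a) \<Rightarrow> ('b::complex_vector \<Rightarrow> 'b \<otimes> 'b) \<Rightarrow> 'a \<otimes> 'b \<Rightarrow> ('a \<otimes> 'b) \<otimes> ('a \<otimes> 'b)"
  where "comult_prod \<Delta> \<Delta>' = middle_flip \<circ> (\<Delta> \<otimes>\<^sub>m \<Delta>')"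

definition counit_prod ::
  "('a::complex_vector \<Rightarrow> complex) \<Rightarrow> ('b::complex_vector \<Rightarrow> complex) \<Rightarrow> 'a \<otimes> 'b \<Rightarrow> complex"
  where "counit_prod \<epsilon> \<epsilon>' = lunit \<circ> (\<epsilon> \<otimes>\<^sub>m \<epsilon>')"

lemma tensor_comult_eq: "tensor_comult \<Delta> = comult_prod \<Delta> \<Delta>"
  and tensor_counit_eq: "tensor_counit \<epsilon> = counit_prod \<epsilon> \<epsilon>"
  by (simp_all add: tensor_comult_def comult_prod_def tensor_counit_def counit_prod_def)

lemma clinear_comult_prod: "clinear \<Delta> \<Longrightarrow> clinear \<Delta>' \<Longrightarrow> clinear (comult_prod \<Delta> \<Delta>')"
  unfolding comult_prod_def o_def by (intro clinear_comp[OF clinear_middle_flip] clinear_tensor_map)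

lemma clinear_counit_prod: "clinear \<epsilon> \<Longrightarrow> clinear \<epsilon>' \<Longrightarrow> clinear (counit_prod \<epsilon> \<epsilon>')"
  unfolding counit_prod_def o_def by (rule clinear_lunit_tensor)

lemma counit_prod_tensor: "clinear \<epsilon> \<Longrightarrow> clinear \<epsilon>' \<Longrightarrow> counit_prod \<epsilon> \<epsilon>' (a \<otimes> b) = \<epsilon> a * \<epsilon>' b"
  by (simp add: counit_prod_def)

lemma sweedler_comult_prod:
  assumes "clinear \<Delta>" "clinear \<Delta>'" "\<And>b. clinear (\<lambda>a. f a b)" "\<And>a. clinear (\<lambda>b. f a b)"
  shows "sweedler (comult_prod \<Delta> \<Delta>') (x \<otimes> y) f =
         sweedler \<Delta> x (\<lambda>u u'. sweedler \<Delta>' y (\<lambda>v v'. f (u \<otimes> v) (u' \<otimes> v')))"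
proof -
  have f: "cbilinear f" by (intro cbilinearI assms)
  let ?g = "\<lambda>t. tensor_lift f (middle_flip t)"
  have g: "clinear ?g" by (intro clinear_comp[OF clinear_tensor_lift[OF f]] clinear_middle_flip)
  have "sweedler (comult_prod \<Delta> \<Delta>') (x \<otimes> y) f = ?g (\<Delta> x \<otimes> \<Delta>' y)"
    using assms by (simp add: sweedler_def comult_prod_def)
  also have "\<dots> = sweedler \<Delta> x (\<lambda>u u'. ?g ((u \<otimes> u') \<otimes> \<Delta>' y))"
    by (intro linear_sweedler clinear_comp[OF g] clinear_intros)
  also have "\<dots> = sweedler \<Delta> x (\<lambda>u u'. sweedler \<Delta>' y (\<lambda>v v'. ?g ((u \<otimes> u') \<otimes> (v \<otimes> v'))))"
    by (intro sweedler_cong linear_sweedler clinear_comp[OF g] clinear_intros)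
  finally show ?thesis using f by simp
qed

lemma coalgebra_prod:
  assumes "coalgebra \<Delta> \<epsilon>" "coalgebra \<Delta>' \<epsilon>'"
  shows "coalgebra (comult_prod \<Delta> \<Delta>') (counit_prod \<epsilon> \<epsilon>')"
proof -
  interpret C: coalgebra \<Delta> \<epsilon> by fact
  interpret D: coalgebra \<Delta>' \<epsilon>' by fact
  let ?D = "comult_prod \<Delta> \<Delta>'" and ?e = "counit_prod \<epsilon> \<epsilon>'"
  note D = clinear_comult_prod[OF C.clinear_comult D.clinear_comult]
  note e = clinear_counit_prod[OF C.clinear_counit D.clinear_counit]
  note lin = clinear_intros clinear_sweedler D e C.clinear_comult D.clinear_comult
    clinear_comp[OF e] clinear_comp[OF C.clinear_counit] clinear_comp[OF D.clinear_counit]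
  note sw = sweedler_comult_prod[OF C.clinear_comult D.clinear_comult]
  show ?thesis
  proof (rule coalgebraI)
    fix x
    have "sweedler ?D (a \<otimes> b) (\<lambda>u v. sweedler ?D u (\<lambda>p q. p \<otimes> (q \<otimes> v))) =
          sweedler ?D (a \<otimes> b) (\<lambda>u v. sweedler ?D v (\<lambda>p q. u \<otimes> (p \<otimes> q)))" for a b
    proof -
      have "sweedler ?D (a \<otimes> b) (\<lambda>u v. sweedler ?D u (\<lambda>p q. p \<otimes> (q \<otimes> v))) =
        sweedler \<Delta> a (\<lambda>u u'. sweedler \<Delta>' b (\<lambda>v v'. sweedler ?D (u \<otimes> v) (\<lambda>p q. p \<otimes> (q \<otimes> (u' \<otimes> v')))))"
        by (rule sw) (intro lin)+
      also have "\<dots> = sweedler \<Delta> a (\<lambda>u u'. sweedler \<Delta>' b (\<lambda>v v'. sweedler \<Delta> u (\<lambda>p p'.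
          sweedler \<Delta>' v (\<lambda>q q'. (p \<otimes> q) \<otimes> ((p' \<otimes> q') \<otimes> (u' \<otimes> v'))))))"
        by (intro sweedler_cong sw lin)
      also have "\<dots> = sweedler \<Delta> a (\<lambda>u u'. sweedler \<Delta> u (\<lambda>p p'. sweedler \<Delta>' b (\<lambda>v v'.
          sweedler \<Delta>' v (\<lambda>q q'. (p \<otimes> q) \<otimes> ((p' \<otimes> q') \<otimes> (u' \<otimes> v'))))))"
        by (intro sweedler_cong sweedler_swap)
      also have "\<dots> = sweedler \<Delta> a (\<lambda>u u'. sweedler \<Delta> u (\<lambda>p p'. sweedler \<Delta>' b (\<lambda>v v'.
          sweedler \<Delta>' v' (\<lambda>q q'. (p \<otimes> v) \<otimes> ((p' \<otimes> q) \<otimes> (u' \<otimes> q'))))))"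
        by (intro sweedler_cong D.sweedler_coassoc lin)
      also have "\<dots> = sweedler \<Delta> a (\<lambda>u u'. sweedler \<Delta> u' (\<lambda>p p'. sweedler \<Delta>' b (\<lambda>v v'.
          sweedler \<Delta>' v' (\<lambda>q q'. (u \<otimes> v) \<otimes> ((p \<otimes> q) \<otimes> (p' \<otimes> q'))))))"
        by (rule C.sweedler_coassoc) (intro lin)+
      also have "\<dots> = sweedler \<Delta> a (\<lambda>u u'. sweedler \<Delta>' b (\<lambda>v v'. sweedler \<Delta> u' (\<lambda>p p'.
          sweedler \<Delta>' v' (\<lambda>q q'. (u \<otimes> v) \<otimes> ((p \<otimes> q) \<otimes> (p' \<otimes> q'))))))"
        by (intro sweedler_cong sweedler_swap)
      also have "\<dots> = sweedler \<Delta> a (\<lambda>u u'. sweedler \<Delta>' b (\<lambda>v v'. sweedler ?D (u' \<otimes> v') (\<lambda>p q. (u \<otimes> v) \<otimes> (p \<otimes> q))))"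
        by (intro sweedler_cong sw[symmetric] lin)
      also have "\<dots> = sweedler ?D (a \<otimes> b) (\<lambda>u v. sweedler ?D v (\<lambda>p q. u \<otimes> (p \<otimes> q)))"
        by (rule sw[symmetric]) (intro lin)+
      finally show ?thesis .
    qed
    then have "(\<lambda>x. sweedler ?D x (\<lambda>u v. sweedler ?D u (\<lambda>p q. p \<otimes> (q \<otimes> v)))) =
               (\<lambda>x. sweedler ?D x (\<lambda>u v. sweedler ?D v (\<lambda>p q. u \<otimes> (p \<otimes> q))))"
      by (intro clinear_tensor_eqI lin)
    then show "sweedler ?D x (\<lambda>u v. sweedler ?D u (\<lambda>p q. p \<otimes> (q \<otimes> v))) =
               sweedler ?D x (\<lambda>u v. sweedler ?D v (\<lambda>p q. u \<otimes> (p \<otimes> q)))"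
      by (rule fun_cong)
    have "sweedler ?D (a \<otimes> b) (\<lambda>u v. ?e u *\<^sub>C v) = a \<otimes> b" for a b
    proof -
      have "sweedler ?D (a \<otimes> b) (\<lambda>u v. ?e u *\<^sub>C v) =
        sweedler \<Delta> a (\<lambda>u u'. sweedler \<Delta>' b (\<lambda>v v'. ?e (u \<otimes> v) *\<^sub>C (u' \<otimes> v')))"
        by (rule sw) (intro lin)+
      also have "\<dots> = sweedler \<Delta> a (\<lambda>u u'. sweedler \<Delta>' b (\<lambda>v v'. (\<epsilon> u *\<^sub>C u') \<otimes> (\<epsilon>' v *\<^sub>C v')))"
        by (simp add: counit_prod_tensor C.clinear_counit D.clinear_counit tensor_of_simps scaleC_scaleC
            mult.commute)
      also have "\<dots> = a \<otimes> b"
        by (simp add: sweedler_linear[OF clinear_tensor_right[OF clinear_id], symmetric]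
          sweedler_linear[OF clinear_tensor_left[OF clinear_id], symmetric]
          C.sweedler_counit_left[OF clinear_id] D.sweedler_counit_left[OF clinear_id])
      finally show ?thesis .
    qed
    then have "(\<lambda>x. sweedler ?D x (\<lambda>u v. ?e u *\<^sub>C v)) = (\<lambda>x. x)"
      by (intro clinear_tensor_eqI lin)
    then show "sweedler ?D x (\<lambda>u v. ?e u *\<^sub>C v) = x"
      by (rule fun_cong)
    have "sweedler ?D (a \<otimes> b) (\<lambda>u v. ?e v *\<^sub>C u) = a \<otimes> b" for a b
    proof -
      have "sweedler ?D (a \<otimes> b) (\<lambda>u v. ?e v *\<^sub>C u) =
        sweedler \<Delta> a (\<lambda>u u'. sweedler \<Delta>' b (\<lambda>v v'. ?e (u' \<otimes> v') *\<^sub>C (u \<otimes> v)))"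
        by (rule sw) (intro lin)+
      also have "\<dots> = sweedler \<Delta> a (\<lambda>u u'. sweedler \<Delta>' b (\<lambda>v v'. (\<epsilon> u' *\<^sub>C u) \<otimes> (\<epsilon>' v' *\<^sub>C v)))"
        by (simp add: counit_prod_tensor C.clinear_counit D.clinear_counit tensor_of_simps scaleC_scaleC
            mult.commute)
      also have "\<dots> = a \<otimes> b"
        by (simp add: sweedler_linear[OF clinear_tensor_right[OF clinear_id], symmetric]
          sweedler_linear[OF clinear_tensor_left[OF clinear_id], symmetric]
          C.sweedler_counit_right[OF clinear_id] D.sweedler_counit_right[OF clinear_id])
      finally show ?thesis .
    qed
    then have "(\<lambda>x. sweedler ?D x (\<lambda>u v. ?e v *\<^sub>C u)) = (\<lambda>x. x)"
      by (intro clinear_tensor_eqI lin)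
    then show "sweedler ?D x (\<lambda>u v. ?e v *\<^sub>C u) = x"
      by (rule fun_cong)
  qed (intro D e)+
qed

lemma cocommutative_prod:
  assumes "clinear \<Delta>" "clinear \<Delta>'" "cocommutative \<Delta>" "cocommutative \<Delta>'"
  shows "cocommutative (comult_prod \<Delta> \<Delta>')"
proof -
  let ?D = "comult_prod \<Delta> \<Delta>'"
  note lin = clinear_intros clinear_sweedler clinear_comult_prod assms(1,2)
  have "sweedler ?D (a \<otimes> b) (\<lambda>u v. u \<otimes> v) = sweedler ?D (a \<otimes> b) (\<lambda>u v. v \<otimes> u)" for a b
  proof -
    have "sweedler ?D (a \<otimes> b) (\<lambda>u v. u \<otimes> v) =
      sweedler \<Delta> a (\<lambda>u u'. sweedler \<Delta>' b (\<lambda>v v'. (u \<otimes> v) \<otimes> (u' \<otimes> v')))"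
      by (rule sweedler_comult_prod) (intro lin)+
    also have "\<dots> = sweedler \<Delta> a (\<lambda>u u'. sweedler \<Delta>' b (\<lambda>v v'. (u' \<otimes> v) \<otimes> (u \<otimes> v')))"
      by (rule sweedler_cocommutative[OF assms(3)]) (intro lin)+
    also have "\<dots> = sweedler \<Delta> a (\<lambda>u u'. sweedler \<Delta>' b (\<lambda>v v'. (u' \<otimes> v') \<otimes> (u \<otimes> v)))"
      by (intro sweedler_cong sweedler_cocommutative[OF assms(4)] lin)
    also have "\<dots> = sweedler ?D (a \<otimes> b) (\<lambda>u v. v \<otimes> u)"
      by (rule sweedler_comult_prod[symmetric]) (intro lin)+
    finally show ?thesis .
  qed
  then have "(\<lambda>x. sweedler ?D x (\<lambda>u v. u \<otimes> v)) = (\<lambda>x. sweedler ?D x (\<lambda>u v. v \<otimes> u))"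
    by (intro clinear_tensor_eqI lin)
  then show ?thesis by (simp only: cocommutative_iff_sweedler fun_eq_iff) simp
qed

definition coalgebra_map ::
  "('a \<Rightarrow> 'a::complex_vector \<otimes> 'a) \<Rightarrow> ('a \<Rightarrow> complex) \<Rightarrow> ('b \<Rightarrow> 'b::complex_vector \<otimes> 'b) \<Rightarrow>
   ('b \<Rightarrow> complex) \<Rightarrow> ('a \<Rightarrow> 'b) \<Rightarrow> bool"
  where "coalgebra_map \<Delta> \<epsilon> \<Delta>' \<epsilon>' \<phi> \<longleftrightarrow> clinear \<phi> \<and>
    (\<forall>x. \<Delta>' (\<phi> x) = sweedler \<Delta> x (\<lambda>u v. \<phi> u \<otimes> \<phi> v)) \<and> (\<forall>x. \<epsilon>' (\<phi> x) = \<epsilon> x)"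

lemma sweedler_map:
  assumes "coalgebra_map \<Delta> \<epsilon> \<Delta>' \<epsilon>' \<phi>" "\<And>b. clinear (\<lambda>a. f a b)" "\<And>a. clinear (\<lambda>b. f a b)"
  shows "sweedler \<Delta>' (\<phi> x) f = sweedler \<Delta> x (\<lambda>u v. f (\<phi> u) (\<phi> v))"
proof -
  have f: "cbilinear f" by (intro cbilinearI assms)
  have "sweedler \<Delta>' (\<phi> x) f = tensor_lift f (sweedler \<Delta> x (\<lambda>u v. \<phi> u \<otimes> \<phi> v))"
    using assms(1) by (simp add: coalgebra_map_def sweedler_def)
  also have "\<dots> = sweedler \<Delta> x (\<lambda>u v. tensor_lift f (\<phi> u \<otimes> \<phi> v))"
    by (rule sweedler_linear[OF clinear_tensor_lift[OF f]])
  finally show ?thesis using f by simp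
qed

lemma coalgebra_map_comp:
  assumes "coalgebra_map \<Delta> \<epsilon> \<Delta>' \<epsilon>' \<phi>" "coalgebra_map \<Delta>' \<epsilon>' \<Delta>'' \<epsilon>'' \<psi>"
  shows "coalgebra_map \<Delta> \<epsilon> \<Delta>'' \<epsilon>'' (\<lambda>x. \<psi> (\<phi> x))"
proof -
  have l: "clinear \<phi>" "clinear \<psi>" using assms by (simp_all add: coalgebra_map_def)
  have "\<Delta>'' (\<psi> (\<phi> x)) = sweedler \<Delta>' (\<phi> x) (\<lambda>u v. \<psi> u \<otimes> \<psi> v)" for x
    using assms(2) by (simp add: coalgebra_map_def)
  also have "\<dots> x = sweedler \<Delta> x (\<lambda>u v. \<psi> (\<phi> u) \<otimes> \<psi> (\<phi> v))" for x
    by (rule sweedler_map[OF assms(1)]) (intro clinear_intros l)+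
  finally show ?thesis
    using l assms by (simp add: coalgebra_map_def clinear_comp)
qed

text \<open>Both sides of each condition are linear, so elementary tensors suffice.\<close>

lemma coalgebra_map_tensorI:
  assumes "clinear \<Delta>'" "clinear \<epsilon>'" "coalgebra \<Delta>\<^sub>1 \<epsilon>\<^sub>1" "coalgebra \<Delta>\<^sub>2 \<epsilon>\<^sub>2" "clinear \<phi>"
    and "\<And>a b. \<Delta>' (\<phi> (a \<otimes> b)) = sweedler \<Delta>\<^sub>1 a (\<lambda>u u'. sweedler \<Delta>\<^sub>2 b (\<lambda>v v'. \<phi> (u \<otimes> v) \<otimes> \<phi> (u' \<otimes> v')))"
    and "\<And>a b. \<epsilon>' (\<phi> (a \<otimes> b)) = \<epsilon>\<^sub>1 a * \<epsilon>\<^sub>2 b"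
  shows "coalgebra_map (comult_prod \<Delta>\<^sub>1 \<Delta>\<^sub>2) (counit_prod \<epsilon>\<^sub>1 \<epsilon>\<^sub>2) \<Delta>' \<epsilon>' \<phi>"
proof -
  interpret C: coalgebra \<Delta>\<^sub>1 \<epsilon>\<^sub>1 by fact
  interpret D: coalgebra \<Delta>\<^sub>2 \<epsilon>\<^sub>2 by fact
  note lin = clinear_intros clinear_sweedler C.clinear_comult D.clinear_comult clinear_comult_prod
    clinear_counit_prod C.clinear_counit D.clinear_counit clinear_comp[OF assms(1)] 
    clinear_comp[OF assms(2)] clinear_comp[OF assms(5)]
  have "(\<lambda>x. \<Delta>' (\<phi> x)) = (\<lambda>x. sweedler (comult_prod \<Delta>\<^sub>1 \<Delta>\<^sub>2) x (\<lambda>u v. \<phi> u \<otimes> \<phi> v))"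
  proof (intro clinear_tensor_eqI lin)
    fix a b
    show "\<Delta>' (\<phi> (a \<otimes> b)) = sweedler (comult_prod \<Delta>\<^sub>1 \<Delta>\<^sub>2) (a \<otimes> b) (\<lambda>u v. \<phi> u \<otimes> \<phi> v)"
      unfolding assms(6) by (rule sweedler_comult_prod[symmetric]) (intro lin)+
  qed
  moreover have "(\<lambda>x. \<epsilon>' (\<phi> x)) = counit_prod \<epsilon>\<^sub>1 \<epsilon>\<^sub>2"
    using assms(7) by (intro clinear_tensor_eqI lin) (simp add: counit_prod_tensor C.clinear_counit D.clinear_counit)
  ultimately show ?thesis using assms(5) by (simp add: coalgebra_map_def fun_eq_iff)
qed

lemma coalgebra_mapD:
  assumes "coalgebra_map \<Delta> \<epsilon> \<Delta>' \<epsilon>' \<phi>"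
  shows "clinear \<phi>" "\<Delta>' (\<phi> x) = sweedler \<Delta> x (\<lambda>u v. \<phi> u \<otimes> \<phi> v)" "\<epsilon>' (\<phi> x) = \<epsilon> x"
  using assms by (simp_all add: coalgebra_map_def)

lemma coalgebra_map_id: "coalgebra_map \<Delta> \<epsilon> \<Delta> \<epsilon> (\<lambda>x. x)"
  using comult_sweedler[of \<Delta>] by (simp only: coalgebra_map_def clinear_id) blast

text \<open>A coalgebra is cocommutative exactly when its comultiplication is a morphism of
  coalgebras. This makes \<open>(S \<otimes> id) \<circ> \<Delta>\<close> and \<open>(id \<otimes> S) \<circ> \<Delta>\<close> coalgebra maps, so that convolution
  exponentials can be pulled back along them.\<close>

lemma (in coalgebra) coalgebra_map_comult:
  assumes "cocommutative \<Delta>"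
  shows "coalgebra_map \<Delta> \<delta> (comult_prod \<Delta> \<Delta>) (counit_prod \<delta> \<delta>) \<Delta>"
  unfolding coalgebra_map_def
proof (intro conjI allI clinear_comult)
  fix x
  note lin = clinear_intros clinear_sweedler clinear_comult clinear_comp[OF clinear_comult]
    clinear_comp[OF clinear_comult_prod[OF clinear_comult clinear_comult]]
    clinear_counit_prod clinear_counit
  have "comult_prod \<Delta> \<Delta> (\<Delta> x) = sweedler \<Delta> x (\<lambda>u v. comult_prod \<Delta> \<Delta> (u \<otimes> v))"
    by (intro linear_sweedler lin)
  also have "\<dots> = sweedler \<Delta> x (\<lambda>u v. sweedler (comult_prod \<Delta> \<Delta>) (u \<otimes> v) (\<lambda>p q. p \<otimes> q))"
    by (rule sweedler_cong, rule comult_sweedler)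
  also have "\<dots> = sweedler \<Delta> x (\<lambda>u v. sweedler \<Delta> u (\<lambda>a b. sweedler \<Delta> v (\<lambda>c d. (a \<otimes> c) \<otimes> (b \<otimes> d))))"
    by (intro sweedler_cong sweedler_comult_prod lin)
  also have "\<dots> = sweedler \<Delta> x (\<lambda>u v. sweedler \<Delta> u (\<lambda>a b. sweedler \<Delta> v (\<lambda>c d. (a \<otimes> b) \<otimes> (c \<otimes> d))))"
    by (rule sweedler_middle_swap[OF assms]) (intro lin)+
  also have "\<dots> = sweedler \<Delta> x (\<lambda>u v. sweedler \<Delta> u (\<lambda>a b. (a \<otimes> b) \<otimes> \<Delta> v))"
    by (intro sweedler_cong, rule linear_sweedler[symmetric]) (intro lin)
  also have "\<dots> = sweedler \<Delta> x (\<lambda>u v. \<Delta> u \<otimes> \<Delta> v)"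
    by (intro sweedler_cong, rule linear_sweedler[symmetric]) (intro lin)
  finally show "comult_prod \<Delta> \<Delta> (\<Delta> x) = sweedler \<Delta> x (\<lambda>u v. \<Delta> u \<otimes> \<Delta> v)" .
  have "counit_prod \<delta> \<delta> (\<Delta> x) = sweedler \<Delta> x (\<lambda>u v. counit_prod \<delta> \<delta> (u \<otimes> v))"
    by (intro linear_sweedler lin)
  also have "\<dots> = \<delta> x"
    by (simp add: counit_prod_tensor clinear_counit sweedler_counit_mult)
  finally show "counit_prod \<delta> \<delta> (\<Delta> x) = \<delta> x" .
qed

lemma coalgebra_map_prod:
  assumes "coalgebra \<Delta>\<^sub>1 \<epsilon>\<^sub>1" "coalgebra \<Delta>\<^sub>2 \<epsilon>\<^sub>2" "coalgebra \<Delta>\<^sub>1' \<epsilon>\<^sub>1'" "coalgebra \<Delta>\<^sub>2' \<epsilon>\<^sub>2'"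
    and "coalgebra_map \<Delta>\<^sub>1 \<epsilon>\<^sub>1 \<Delta>\<^sub>1' \<epsilon>\<^sub>1' \<phi>" "coalgebra_map \<Delta>\<^sub>2 \<epsilon>\<^sub>2 \<Delta>\<^sub>2' \<epsilon>\<^sub>2' \<psi>"
  shows "coalgebra_map (comult_prod \<Delta>\<^sub>1 \<Delta>\<^sub>2) (counit_prod \<epsilon>\<^sub>1 \<epsilon>\<^sub>2)
    (comult_prod \<Delta>\<^sub>1' \<Delta>\<^sub>2') (counit_prod \<epsilon>\<^sub>1' \<epsilon>\<^sub>2') (\<phi> \<otimes>\<^sub>m \<psi>)"
proof -
  interpret C: coalgebra \<Delta>\<^sub>1 \<epsilon>\<^sub>1 by fact
  interpret D: coalgebra \<Delta>\<^sub>2 \<epsilon>\<^sub>2 by fact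
  interpret C': coalgebra \<Delta>\<^sub>1' \<epsilon>\<^sub>1' by fact
  interpret D': coalgebra \<Delta>\<^sub>2' \<epsilon>\<^sub>2' by fact
  note maps = coalgebra_mapD(1)[OF assms(5)] coalgebra_mapD(1)[OF assms(6)]
  note lin = clinear_intros clinear_sweedler C.clinear_comult D.clinear_comult
    clinear_comult_prod clinear_counit_prod clinear_tensor_map maps C'.clinear_comult D'.clinear_comult
    C'.clinear_counit D'.clinear_counit
  show ?thesis
  proof (rule coalgebra_map_tensorI[OF _ _ assms(1,2)])
    fix a b
    have "comult_prod \<Delta>\<^sub>1' \<Delta>\<^sub>2' ((\<phi> \<otimes>\<^sub>m \<psi>) (a \<otimes> b)) =
        sweedler (comult_prod \<Delta>\<^sub>1' \<Delta>\<^sub>2') (\<phi> a \<otimes> \<psi> b) (\<lambda>u v. u \<otimes> v)"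
      using maps by (subst comult_sweedler) simp
    also have "\<dots> = sweedler \<Delta>\<^sub>1' (\<phi> a) (\<lambda>u u'. sweedler \<Delta>\<^sub>2' (\<psi> b) (\<lambda>v v'. (u \<otimes> v) \<otimes> (u' \<otimes> v')))"
      by (rule sweedler_comult_prod) (intro lin)+
    also have "\<dots> = sweedler \<Delta>\<^sub>1 a (\<lambda>u u'. sweedler \<Delta>\<^sub>2' (\<psi> b) (\<lambda>v v'. (\<phi> u \<otimes> v) \<otimes> (\<phi> u' \<otimes> v')))"
      by (rule sweedler_map[OF assms(5)]) (intro lin)+
    also have "\<dots> = sweedler \<Delta>\<^sub>1 a (\<lambda>u u'. sweedler \<Delta>\<^sub>2 b (\<lambda>v v'. (\<phi> u \<otimes> \<psi> v) \<otimes> (\<phi> u' \<otimes> \<psi> v')))"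
      by (intro sweedler_cong sweedler_map[OF assms(6)] lin)
    finally show "comult_prod \<Delta>\<^sub>1' \<Delta>\<^sub>2' ((\<phi> \<otimes>\<^sub>m \<psi>) (a \<otimes> b)) = sweedler \<Delta>\<^sub>1 a
      (\<lambda>u u'. sweedler \<Delta>\<^sub>2 b (\<lambda>v v'. (\<phi> \<otimes>\<^sub>m \<psi>) (u \<otimes> v) \<otimes> (\<phi> \<otimes>\<^sub>m \<psi>) (u' \<otimes> v')))"
      using maps by simp
    show "counit_prod \<epsilon>\<^sub>1' \<epsilon>\<^sub>2' ((\<phi> \<otimes>\<^sub>m \<psi>) (a \<otimes> b)) = \<epsilon>\<^sub>1 a * \<epsilon>\<^sub>2 b"
      using maps coalgebra_mapD(3)[OF assms(5)] coalgebra_mapD(3)[OF assms(6)]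
      by (simp add: counit_prod_tensor C'.clinear_counit D'.clinear_counit)
  qed (intro lin)+
qed

lemma coalgebra_map_assoc:
  assumes "coalgebra \<Delta>\<^sub>1 \<epsilon>\<^sub>1" "coalgebra \<Delta>\<^sub>2 \<epsilon>\<^sub>2" "coalgebra \<Delta>\<^sub>3 \<epsilon>\<^sub>3"
  shows "coalgebra_map (comult_prod (comult_prod \<Delta>\<^sub>1 \<Delta>\<^sub>2) \<Delta>\<^sub>3) (counit_prod (counit_prod \<epsilon>\<^sub>1 \<epsilon>\<^sub>2) \<epsilon>\<^sub>3)
    (comult_prod \<Delta>\<^sub>1 (comult_prod \<Delta>\<^sub>2 \<Delta>\<^sub>3)) (counit_prod \<epsilon>\<^sub>1 (counit_prod \<epsilon>\<^sub>2 \<epsilon>\<^sub>3)) assoc"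
proof -
  interpret C: coalgebra \<Delta>\<^sub>1 \<epsilon>\<^sub>1 by fact
  interpret D: coalgebra \<Delta>\<^sub>2 \<epsilon>\<^sub>2 by fact
  interpret E: coalgebra \<Delta>\<^sub>3 \<epsilon>\<^sub>3 by fact
  let ?D = "comult_prod \<Delta>\<^sub>1 (comult_prod \<Delta>\<^sub>2 \<Delta>\<^sub>3)" and ?e = "counit_prod \<epsilon>\<^sub>1 (counit_prod \<epsilon>\<^sub>2 \<epsilon>\<^sub>3)"
  note lins = C.clinear_comult D.clinear_comult E.clinear_comult
    C.clinear_counit D.clinear_counit E.clinear_counit clinear_comult_prod clinear_counit_prod
  have D: "clinear ?D" and e: "clinear ?e" and e12: "clinear (counit_prod \<epsilon>\<^sub>1 \<epsilon>\<^sub>2)"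
    by (intro lins)+
  note lin = clinear_intros clinear_sweedler lins clinear_assoc clinear_comp[OF clinear_assoc]
    clinear_comp[OF D] clinear_comp[OF e] clinear_comp[OF e12]
  show ?thesis
  proof (rule coalgebra_map_tensorI[OF _ _ coalgebra_prod[OF assms(1,2)] assms(3)])
    fix x c
    let ?R = "\<lambda>x. sweedler (comult_prod \<Delta>\<^sub>1 \<Delta>\<^sub>2) x (\<lambda>u u'. sweedler \<Delta>\<^sub>3 c (\<lambda>w w'. assoc (u \<otimes> w) \<otimes> assoc (u' \<otimes> w')))"
    have "?D (assoc ((a \<otimes> b) \<otimes> c)) = ?R (a \<otimes> b)" for a b
    proof -
      have "?D (assoc ((a \<otimes> b) \<otimes> c)) = sweedler ?D (a \<otimes> (b \<otimes> c)) (\<lambda>u v. u \<otimes> v)"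
        by (subst comult_sweedler) simp
      also have "\<dots> = sweedler \<Delta>\<^sub>1 a (\<lambda>u u'. sweedler (comult_prod \<Delta>\<^sub>2 \<Delta>\<^sub>3) (b \<otimes> c) (\<lambda>z z'. (u \<otimes> z) \<otimes> (u' \<otimes> z')))"
        by (rule sweedler_comult_prod) (intro lin)+
      also have "\<dots> = sweedler \<Delta>\<^sub>1 a (\<lambda>u u'. sweedler \<Delta>\<^sub>2 b (\<lambda>v v'. sweedler \<Delta>\<^sub>3 c (\<lambda>w w'.
          (u \<otimes> (v \<otimes> w)) \<otimes> (u' \<otimes> (v' \<otimes> w')))))"
        by (rule sweedler_cong, rule sweedler_comult_prod) (intro lin)+
      also have "\<dots> = sweedler \<Delta>\<^sub>1 a (\<lambda>u u'. sweedler \<Delta>\<^sub>2 b (\<lambda>v v'. sweedler \<Delta>\<^sub>3 c (\<lambda>w w'.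
          assoc ((u \<otimes> v) \<otimes> w) \<otimes> assoc ((u' \<otimes> v') \<otimes> w'))))"
        by simp
      also have "\<dots> = ?R (a \<otimes> b)"
        by (rule sweedler_comult_prod[symmetric]) (intro lin)+
      finally show ?thesis .
    qed
    then have "(\<lambda>x. ?D (assoc (x \<otimes> c))) = ?R"
      by (intro clinear_tensor_eqI lin)
    then show "?D (assoc (x \<otimes> c)) = ?R x" by (rule fun_cong)
    have "(\<lambda>x. ?e (assoc (x \<otimes> c))) = (\<lambda>x. counit_prod \<epsilon>\<^sub>1 \<epsilon>\<^sub>2 x * \<epsilon>\<^sub>3 c)"
      by (intro clinear_tensor_eqI lin) (simp add: counit_prod_tensor lins)
    then show "?e (assoc (x \<otimes> c)) = counit_prod \<epsilon>\<^sub>1 \<epsilon>\<^sub>2 x * \<epsilon>\<^sub>3 c" by (rule fun_cong)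
  qed (intro lin)+
qed

text \<open>The maps \<open>x \<otimes> y \<mapsto> \<epsilon>\<^sub>2(y) x\<close> and \<open>x \<otimes> y \<mapsto> \<epsilon>\<^sub>1(x) y\<close>. Composing with them turns a
  functional of two arguments into one of three arguments that ignores the last or the first.\<close>

lemma coalgebra_map_drop:
  assumes "coalgebra \<Delta>\<^sub>1 \<epsilon>\<^sub>1" "coalgebra \<Delta>\<^sub>2 \<epsilon>\<^sub>2"
  shows coalgebra_map_drop_right: "coalgebra_map (comult_prod \<Delta>\<^sub>1 \<Delta>\<^sub>2) (counit_prod \<epsilon>\<^sub>1 \<epsilon>\<^sub>2) \<Delta>\<^sub>1 \<epsilon>\<^sub>1 (\<lambda>x. runit ((id \<otimes>\<^sub>m \<epsilon>\<^sub>2) x))"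
    and coalgebra_map_drop_left: "coalgebra_map (comult_prod \<Delta>\<^sub>1 \<Delta>\<^sub>2) (counit_prod \<epsilon>\<^sub>1 \<epsilon>\<^sub>2) \<Delta>\<^sub>2 \<epsilon>\<^sub>2 (\<lambda>x. lunit ((\<epsilon>\<^sub>1 \<otimes>\<^sub>m id) x))"
proof -
  interpret C: coalgebra \<Delta>\<^sub>1 \<epsilon>\<^sub>1 by fact
  interpret D: coalgebra \<Delta>\<^sub>2 \<epsilon>\<^sub>2 by fact
  have id: "clinear (id :: 'x::complex_vector \<Rightarrow> 'x)" by (simp add: clinear_iff)
  have scale: "\<Delta> (c *\<^sub>C a) = c *\<^sub>C \<Delta> a" if "clinear \<Delta>" for c a and \<Delta> :: "'x::complex_vector \<Rightarrow> 'y::complex_vector"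
    using that by (simp add: clinear_iff)
  note lins = C.clinear_comult D.clinear_comult C.clinear_counit D.clinear_counit
  show "coalgebra_map (comult_prod \<Delta>\<^sub>1 \<Delta>\<^sub>2) (counit_prod \<epsilon>\<^sub>1 \<epsilon>\<^sub>2) \<Delta>\<^sub>1 \<epsilon>\<^sub>1 (\<lambda>x. runit ((id \<otimes>\<^sub>m \<epsilon>\<^sub>2) x))"
  proof (rule coalgebra_map_tensorI[OF _ _ assms])
    fix a b
    have inner: "sweedler \<Delta>\<^sub>2 b (\<lambda>v v'. (\<epsilon>\<^sub>2 v *\<^sub>C u) \<otimes> (\<epsilon>\<^sub>2 v' *\<^sub>C u')) = \<epsilon>\<^sub>2 b *\<^sub>C (u \<otimes> u')" for u u'
    proof -
      have "sweedler \<Delta>\<^sub>2 b (\<lambda>v v'. (\<epsilon>\<^sub>2 v *\<^sub>C u) \<otimes> (\<epsilon>\<^sub>2 v' *\<^sub>C u')) =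
            sweedler \<Delta>\<^sub>2 b (\<lambda>v v'. \<epsilon>\<^sub>2 v *\<^sub>C (\<epsilon>\<^sub>2 v' *\<^sub>C (u \<otimes> u')))"
        by (simp only: tensor_of_simps scaleC_scaleC mult.commute)
      also have "\<dots> = \<epsilon>\<^sub>2 b *\<^sub>C (u \<otimes> u')"
        by (rule D.sweedler_counit_left) (intro clinear_intros lins)
      finally show ?thesis .
    qed
    have "sweedler \<Delta>\<^sub>1 a (\<lambda>u u'. sweedler \<Delta>\<^sub>2 b (\<lambda>v v'. (\<epsilon>\<^sub>2 v *\<^sub>C u) \<otimes> (\<epsilon>\<^sub>2 v' *\<^sub>C u'))) = \<epsilon>\<^sub>2 b *\<^sub>C \<Delta>\<^sub>1 a"
      by (simp only: inner sweedler_scaleC comult_sweedler[symmetric])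
    then show "\<Delta>\<^sub>1 (runit ((id \<otimes>\<^sub>m \<epsilon>\<^sub>2) (a \<otimes> b))) = sweedler \<Delta>\<^sub>1 a (\<lambda>u u'. sweedler \<Delta>\<^sub>2 b
        (\<lambda>v v'. runit ((id \<otimes>\<^sub>m \<epsilon>\<^sub>2) (u \<otimes> v)) \<otimes> runit ((id \<otimes>\<^sub>m \<epsilon>\<^sub>2) (u' \<otimes> v'))))"
      by (simp add: id lins scale)
    show "\<epsilon>\<^sub>1 (runit ((id \<otimes>\<^sub>m \<epsilon>\<^sub>2) (a \<otimes> b))) = \<epsilon>\<^sub>1 a * \<epsilon>\<^sub>2 b"
      by (simp add: id lins scale)
  qed (intro lins clinear_runit_tensor id)+
  show "coalgebra_map (comult_prod \<Delta>\<^sub>1 \<Delta>\<^sub>2) (counit_prod \<epsilon>\<^sub>1 \<epsilon>\<^sub>2) \<Delta>\<^sub>2 \<epsilon>\<^sub>2 (\<lambda>x. lunit ((\<epsilon>\<^sub>1 \<otimes>\<^sub>m id) x))"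
  proof (rule coalgebra_map_tensorI[OF _ _ assms])
    fix a b
    have inner: "sweedler \<Delta>\<^sub>2 b (\<lambda>v v'. (\<epsilon>\<^sub>1 u *\<^sub>C v) \<otimes> (\<epsilon>\<^sub>1 u' *\<^sub>C v')) = \<epsilon>\<^sub>1 u *\<^sub>C (\<epsilon>\<^sub>1 u' *\<^sub>C \<Delta>\<^sub>2 b)" for u u'
      by (simp only: tensor_of_simps sweedler_scaleC comult_sweedler[symmetric] scaleC_scaleC mult.commute)
    have "sweedler \<Delta>\<^sub>1 a (\<lambda>u u'. sweedler \<Delta>\<^sub>2 b (\<lambda>v v'. (\<epsilon>\<^sub>1 u *\<^sub>C v) \<otimes> (\<epsilon>\<^sub>1 u' *\<^sub>C v'))) =
       sweedler \<Delta>\<^sub>1 a (\<lambda>u u'. \<epsilon>\<^sub>1 u *\<^sub>C (\<epsilon>\<^sub>1 u' *\<^sub>C \<Delta>\<^sub>2 b))"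
      by (simp only: inner)
    also have "\<dots> = \<epsilon>\<^sub>1 a *\<^sub>C \<Delta>\<^sub>2 b"
      by (rule C.sweedler_counit_left) (intro clinear_intros lins)
    finally show "\<Delta>\<^sub>2 (lunit ((\<epsilon>\<^sub>1 \<otimes>\<^sub>m id) (a \<otimes> b))) = sweedler \<Delta>\<^sub>1 a (\<lambda>u u'. sweedler \<Delta>\<^sub>2 b
        (\<lambda>v v'. lunit ((\<epsilon>\<^sub>1 \<otimes>\<^sub>m id) (u \<otimes> v)) \<otimes> lunit ((\<epsilon>\<^sub>1 \<otimes>\<^sub>m id) (u' \<otimes> v'))))"
      by (simp add: id lins scale)
    show "\<epsilon>\<^sub>2 (lunit ((\<epsilon>\<^sub>1 \<otimes>\<^sub>m id) (a \<otimes> b))) = \<epsilon>\<^sub>1 a * \<epsilon>\<^sub>2 b"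
      by (simp add: id lins scale)
  qed (intro lins clinear_lunit_tensor id)+
qed

section \<open>The convolution exponential\<close>

lemma conv_left_mult:
  fixes A B :: "_ \<Rightarrow> complex"
  shows "clinear A \<Longrightarrow> clinear B \<Longrightarrow> conv_left \<Delta> A B x = sweedler \<Delta> x (\<lambda>u v. A u * B v)"
  by (simp add: conv_left_sweedler)

context coalgebra
begin

lemma clinear_conv_left:
  fixes A B :: "'b \<Rightarrow> complex"
  assumes "clinear A" "clinear B"
  shows "clinear (conv_left \<Delta> A B)"
proof -
  have "clinear (\<lambda>x. sweedler \<Delta> x (\<lambda>u v. A u * B v))"
    by (intro clinear_sweedler clinear_comult clinear_intros assms)
  moreover have "conv_left \<Delta> A B = (\<lambda>x. sweedler \<Delta> x (\<lambda>u v. A u * B v))"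
    using assms by (simp add: fun_eq_iff conv_left_mult)
  ultimately show ?thesis by simp
qed

lemma clinear_conv_power: "clinear A \<Longrightarrow> clinear (conv_power \<Delta> \<delta> A n)"
  by (induction n) (simp_all add: clinear_counit clinear_conv_left)

lemma conv_power_Suc:
  "clinear A \<Longrightarrow> conv_power \<Delta> \<delta> A (Suc n) x = sweedler \<Delta> x (\<lambda>u v. A u * conv_power \<Delta> \<delta> A n v)"
  by (simp add: conv_left_mult clinear_conv_power)

declare conv_power.simps(2) [simp del]

lemma conv_power_1: "clinear A \<Longrightarrow> conv_power \<Delta> \<delta> A (Suc 0) = A"
  by (simp add: fun_eq_iff conv_power_Suc sweedler_counit_mult)

lemma conv_power_zero: "conv_power \<Delta> \<delta> (\<lambda>x. 0) n = (if n = 0 then \<delta> else (\<lambda>x. 0))"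
proof (cases n)
  case (Suc m)
  have "clinear (\<lambda>x::'b. 0::complex)" by (simp add: clinear_iff)
  with Suc show ?thesis by (simp add: fun_eq_iff conv_power_Suc sweedler_0)
qed simp

lemma conv_power_scale:
  assumes "clinear A"
  shows "conv_power \<Delta> \<delta> (\<lambda>x. c * A x) n x = c ^ n * conv_power \<Delta> \<delta> A n x"
proof (induction n arbitrary: x)
  case (Suc n)
  have "clinear (\<lambda>x. c * A x)" by (intro clinear_intros assms)
  then have "conv_power \<Delta> \<delta> (\<lambda>x. c * A x) (Suc n) x =
      sweedler \<Delta> x (\<lambda>u v. c ^ Suc n * (A u * conv_power \<Delta> \<delta> A n v))"
    using assms by (simp only: conv_power_Suc Suc.IH) (simp add: mult_ac)
  then show ?case using assms by (simp only: sweedler_mult conv_power_Suc)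
qed simp

text \<open>Pulling back functionals along a coalgebra map is a homomorphism of convolution
  algebras. All comparisons of convolution exponentials on different coalgebras go through
  this.\<close>

lemma conv_power_map:
  assumes "coalgebra_map \<Delta> \<delta> \<Delta>' \<epsilon>' \<phi>" "coalgebra \<Delta>' \<epsilon>'" "clinear A"
  shows "conv_power \<Delta> \<delta> (\<lambda>x. A (\<phi> x)) n x = conv_power \<Delta>' \<epsilon>' A n (\<phi> x)"
proof (induction n arbitrary: x)
  case (Suc n)
  interpret D: coalgebra \<Delta>' \<epsilon>' by fact
  have A: "clinear (\<lambda>x. A (\<phi> x))" by (rule clinear_comp[OF assms(3) coalgebra_mapD(1)[OF assms(1)]])
  have "conv_power \<Delta> \<delta> (\<lambda>x. A (\<phi> x)) (Suc n) x =
      sweedler \<Delta> x (\<lambda>u v. A (\<phi> u) * conv_power \<Delta>' \<epsilon>' A n (\<phi> v))"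
    by (simp only: conv_power_Suc[OF A] Suc.IH)
  also have "\<dots> = sweedler \<Delta>' (\<phi> x) (\<lambda>u v. A u * conv_power \<Delta>' \<epsilon>' A n v)"
    by (rule sweedler_map[OF assms(1), symmetric])
       (intro clinear_intros assms(3) D.clinear_conv_power)+
  finally show ?case by (simp only: D.conv_power_Suc[OF assms(3)])
qed (simp add: coalgebra_mapD(3)[OF assms(1)])

text \<open>Geometric growth is what makes the exponential series converge. The powers of \<open>L\<close>
  are the iterates of the operator \<open>T y = L(y\<^bsub>(1)\<^esub>) y\<^bsub>(2)\<^esub>\<close> followed by the counit. By
  coassociativity \<open>T\<close> preserves the space \<open>W\<close> of all \<open>f(x\<^bsub>(1)\<^esub>) x\<^bsub>(2)\<^esub>\<close>. This space contains
  \<open>x\<close> (take the counit for \<open>f\<close>) and is finite dimensional, since it lies in the span of the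
  right-hand factors of one representation of \<open>\<Delta> x\<close>. So the growth is that of the powers of a
  matrix.\<close>

lemma conv_power_bound:
  assumes L: "clinear L"
  shows "\<exists>C K. \<forall>n. norm (conv_power \<Delta> \<delta> L n x) \<le> C * K ^ n"
proof -
  let ?P = "conv_power \<Delta> \<delta> L"
  define T where "T y = sweedler \<Delta> y (\<lambda>u v. L u *\<^sub>C v)" for y
  define W where "W = {sweedler \<Delta> x (\<lambda>u v. f u *\<^sub>C v) | f. clinear f}"
  note lin = clinear_intros clinear_sweedler clinear_comult L
  have T: "clinear T" unfolding T_def by (intro lin)
  have PT: "?P (Suc n) y = ?P n (T y)" for n y
    unfolding conv_power_Suc[OF L] T_def sweedler_linear[OF clinear_conv_power[OF L]]
    using clinear_conv_power[OF L] by (simp add: clinear_iff)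
  have "x \<in> W"
    unfolding W_def mem_Collect_eq
    using sweedler_counit_left[OF clinear_id, of x, symmetric] clinear_counit by blast
  have TW: "T w \<in> W" if "w \<in> W" for w
  proof -
    from that obtain f where f: "clinear f" "w = sweedler \<Delta> x (\<lambda>u v. f u *\<^sub>C v)"
      by (auto simp: W_def)
    have "T w = sweedler \<Delta> x (\<lambda>u v. f u *\<^sub>C T v)"
      unfolding f(2) sweedler_linear[OF T] using T by (simp add: clinear_iff)
    also have "\<dots> = sweedler \<Delta> x (\<lambda>u v. sweedler \<Delta> v (\<lambda>p q. f u *\<^sub>C (L p *\<^sub>C q)))"
      by (simp only: T_def sweedler_scaleC)
    also have "\<dots> = sweedler \<Delta> x (\<lambda>u v. sweedler \<Delta> u (\<lambda>p q. f p *\<^sub>C (L q *\<^sub>C v)))"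
      by (rule sweedler_coassoc[symmetric]) (intro lin f)+
    also have "\<dots> = sweedler \<Delta> x (\<lambda>u v. sweedler \<Delta> u (\<lambda>p q. f p * L q) *\<^sub>C v)"
      by (simp only: scaleC_scaleC sweedler_scaleC_left)
    finally show ?thesis
      unfolding W_def by (intro CollectI exI conjI) (assumption, intro lin f)
  qed
  have span: "W \<subseteq> complex_vector.span (snd ` Poly_Mapping.keys (rep_tensor (\<Delta> x)))"
    unfolding W_def sweedler_sum
    by clarify (intro complex_vector.span_sum complex_vector.span_scale complex_vector.span_base imageI)
  obtain B where B: "B \<subseteq> W" "complex_vector.independent B" "W \<subseteq> complex_vector.span B"
    by (rule complex_vector.basis_exists[of W])
  have fin: "finite B"
    using complex_vector.independent_span_bound[OF _ B(2) subset_trans[OF B(1) span]] by simp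
  have in_W: "\<exists>m. w = (\<Sum>b\<in>B. m b *\<^sub>C b)" if "w \<in> W" for w
    using subsetD[OF B(3) that] unfolding complex_vector.span_finite[OF fin] by (rule rangeE) (rule exI)
  have "\<forall>b\<in>B. \<exists>m. T b = (\<Sum>c\<in>B. m c *\<^sub>C c)"
    using B(1) by (intro ballI in_W TW) (rule subsetD)
  then have "\<exists>m. \<forall>b\<in>B. T b = (\<Sum>c\<in>B. m b c *\<^sub>C c)"
    by (rule bchoice)
  then obtain m where m: "T b = (\<Sum>c\<in>B. m b c *\<^sub>C c)" if "b \<in> B" for b by blast
  obtain k where k: "x = (\<Sum>b\<in>B. k b *\<^sub>C b)" using in_W[OF \<open>x \<in> W\<close>] by blast
  have P_sum: "?P n (\<Sum>b\<in>B. g b *\<^sub>C b) = (\<Sum>b\<in>B. g b * ?P n b)" for n g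
    using clinear_conv_power[OF L, of n] by (simp add: clinear_sum) (simp add: clinear_iff)
  define p where "p n = (\<Sum>b\<in>B. norm (?P n b))" for n
  define K where "K = (\<Sum>b\<in>B. \<Sum>c\<in>B. norm (m b c))"
  have le: "norm (?P n (\<Sum>b\<in>B. g b *\<^sub>C b)) \<le> (\<Sum>b\<in>B. norm (g b)) * p n" for n g
  proof -
    have "norm (?P n (\<Sum>b\<in>B. g b *\<^sub>C b)) \<le> (\<Sum>b\<in>B. norm (g b) * norm (?P n b))"
      unfolding P_sum norm_mult[symmetric] by (rule norm_sum)
    also have "\<dots> \<le> (\<Sum>b\<in>B. norm (g b) * p n)"
      unfolding p_def using fin by (intro sum_mono mult_left_mono member_le_sum) auto
    finally show ?thesis by (simp add: sum_distrib_right)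
  qed
  have "0 \<le> K" by (simp add: K_def sum_nonneg)
  have "p n \<le> K ^ n * p 0" for n
  proof (induction n)
    case (Suc n)
    have "p (Suc n) = (\<Sum>b\<in>B. norm (?P n (\<Sum>c\<in>B. m b c *\<^sub>C c)))"
      by (simp add: p_def PT m)
    also have "\<dots> \<le> K * p n"
      unfolding K_def sum_distrib_right[where f = "\<lambda>b. \<Sum>c\<in>B. norm (m b c)"] by (intro sum_mono le)
    also have "\<dots> \<le> K * (K ^ n * p 0)"
      using Suc \<open>0 \<le> K\<close> by (rule mult_left_mono)
    finally show ?case by (simp add: mult_ac)
  qed simp
  then have "(\<Sum>b\<in>B. norm (k b)) * p n \<le> (\<Sum>b\<in>B. norm (k b)) * (K ^ n * p 0)" for n
    by (intro mult_left_mono sum_nonneg) simp_all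
  then have "norm (?P n x) \<le> ((\<Sum>b\<in>B. norm (k b)) * p 0) * K ^ n" for n
    using order_trans[OF le[of n k]] unfolding k[symmetric] by (simp add: mult_ac)
  then show ?thesis by blast
qed

lemma summable_norm_conv_exp:
  assumes "clinear L"
  shows "summable (\<lambda>n. norm (z ^ n / fact n * conv_power \<Delta> \<delta> L n x))"
proof -
  obtain C K where bound: "norm (conv_power \<Delta> \<delta> L n x) \<le> C * K ^ n" for n
    using conv_power_bound[OF assms, of x] by blast
  have "summable (\<lambda>n. C * (inverse (fact n) * (norm z * K) ^ n))"
    by (intro summable_mult summable_exp)
  then show ?thesis
  proof (rule summable_comparison_test')
    fix n
    have "norm (norm (z ^ n / fact n * conv_power \<Delta> \<delta> L n x)) =
        (inverse (fact n) * norm z ^ n) * norm (conv_power \<Delta> \<delta> L n x)"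
      by (simp add: norm_mult norm_divide norm_power field_simps)
    also have "\<dots> \<le> (inverse (fact n) * norm z ^ n) * (C * K ^ n)"
      by (intro mult_left_mono bound) simp
    finally show "norm (norm (z ^ n / fact n * conv_power \<Delta> \<delta> L n x)) \<le>
        C * (inverse (fact n) * (norm z * K) ^ n)"
      by (simp add: power_mult_distrib mult_ac)
  qed
qed

lemma conv_exp_sums:
  assumes "clinear L"
  shows "(\<lambda>n. of_real t ^ n / fact n * conv_power \<Delta> \<delta> L n x) sums conv_exp \<Delta> \<delta> t L x"
  using summable_sums[OF summable_norm_cancel[OF summable_norm_conv_exp[OF assms, of "of_real t" x]]]
  by (simp add: conv_exp_def)

lemma clinear_conv_exp:
  assumes "clinear L"
  shows "clinear (conv_exp \<Delta> \<delta> t L)"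
  unfolding clinear_iff
proof (intro conjI allI)
  fix x y c
  have P: "conv_power \<Delta> \<delta> L n (x + y) = conv_power \<Delta> \<delta> L n x + conv_power \<Delta> \<delta> L n y"
    "conv_power \<Delta> \<delta> L n (c *\<^sub>C x) = c * conv_power \<Delta> \<delta> L n x" for n
    using clinear_conv_power[OF assms, of n] by (simp_all add: clinear_iff)
  have "(\<lambda>n. of_real t ^ n / fact n * conv_power \<Delta> \<delta> L n (x + y)) sums
      (conv_exp \<Delta> \<delta> t L x + conv_exp \<Delta> \<delta> t L y)"
    unfolding P distrib_left by (intro sums_add conv_exp_sums assms)
  then show "conv_exp \<Delta> \<delta> t L (x + y) = conv_exp \<Delta> \<delta> t L x + conv_exp \<Delta> \<delta> t L y"
    using conv_exp_sums[OF assms] sums_unique2 by blast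
  have "(\<lambda>n. of_real t ^ n / fact n * conv_power \<Delta> \<delta> L n (c *\<^sub>C x)) sums (c * conv_exp \<Delta> \<delta> t L x)"
    unfolding P mult.left_commute[of _ c] by (intro sums_mult conv_exp_sums assms)
  then show "conv_exp \<Delta> \<delta> t L (c *\<^sub>C x) = c *\<^sub>C conv_exp \<Delta> \<delta> t L x"
    using conv_exp_sums[OF assms] sums_unique2 by (metis scaleC_complex_def)
qed

lemma conv_exp_zero [simp]: "conv_exp \<Delta> \<delta> 0 L = \<delta>"
proof
  fix x
  have "(\<lambda>n. of_real (0 ^ n / fact n) * conv_power \<Delta> \<delta> L n x) =
      (\<lambda>n. if n = 0 then \<delta> x else 0)"
    by auto
  then show "conv_exp \<Delta> \<delta> 0 L x = \<delta> x"
    using sums_unique[OF sums_single[of 0 "\<lambda>_. \<delta> x"]] by (simp add: conv_exp_def)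
qed

lemma conv_exp_of_zero: "conv_exp \<Delta> \<delta> t (\<lambda>x. 0) = \<delta>"
proof
  fix x
  have "(\<lambda>n. of_real (t ^ n / fact n) * conv_power \<Delta> \<delta> (\<lambda>x. 0) n x) =
      (\<lambda>n. if n = 0 then \<delta> x else 0)"
    by (auto simp: conv_power_zero)
  then show "conv_exp \<Delta> \<delta> t (\<lambda>x. 0) x = \<delta> x"
    using sums_unique[OF sums_single[of 0 "\<lambda>_. \<delta> x"]] by (simp add: conv_exp_def)
qed

lemma conv_exp_map:
  assumes "coalgebra_map \<Delta> \<delta> \<Delta>' \<epsilon>' \<phi>" "coalgebra \<Delta>' \<epsilon>'" "clinear L"
  shows "conv_exp \<Delta>' \<epsilon>' t L (\<phi> x) = conv_exp \<Delta> \<delta> t (\<lambda>x. L (\<phi> x)) x"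
  using conv_power_map[OF assms] by (simp add: conv_exp_def)

lemma conv_exp_scale:
  assumes "clinear L"
  shows "conv_exp \<Delta> \<delta> 1 (\<lambda>x. of_real t * L x) = conv_exp \<Delta> \<delta> t L"
  by (simp add: fun_eq_iff conv_exp_def conv_power_scale[OF assms])

text \<open>For fixed \<open>x\<close> the exponential is an everywhere convergent power series in \<open>t\<close>, whose
  linear coefficient is \<open>L x\<close>.\<close>

lemma conv_exp_has_vector_derivative:
  assumes "clinear L"
  shows "((\<lambda>t. conv_exp \<Delta> \<delta> t L x) has_vector_derivative L x) (at 0 within A)"
proof -
  define c where "c n = conv_power \<Delta> \<delta> L n x / fact n" for n
  have "summable (\<lambda>n. c n * z ^ n)" for z
    using summable_norm_cancel[OF summable_norm_conv_exp[OF assms, of z x]]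
    by (simp add: c_def mult_ac)
  then have "((\<lambda>z. suminf (\<lambda>n. c n * z ^ n)) has_field_derivative suminf (\<lambda>n. diffs c n * 0 ^ n)) (at (of_real 0))"
    using termdiffs_strong_converges_everywhere[of c "0::complex"] by simp
  moreover have "suminf (\<lambda>n. diffs c n * 0 ^ n) = L x"
    by (simp add: diffs_def c_def conv_power_1[OF assms])
  moreover have "conv_exp \<Delta> \<delta> t L x = suminf (\<lambda>n. c n * of_real t ^ n)" for t
    by (simp add: conv_exp_def c_def mult_ac)
  ultimately show ?thesis
    using has_vector_derivative_real_field[of "\<lambda>z. suminf (\<lambda>n. c n * z ^ n)" _ 0 A] by simp
qed

text \<open>The binomial theorem: by cocommutativity, convolution of functionals is commutative.\<close>

lemma conv_power_add:
  assumes "cocommutative \<Delta>" "clinear A" "clinear B"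
  shows "conv_power \<Delta> \<delta> (\<lambda>x. A x + B x) n x = (\<Sum>i\<le>n. of_nat (n choose i) *
    sweedler \<Delta> x (\<lambda>u v. conv_power \<Delta> \<delta> A i u * conv_power \<Delta> \<delta> B (n - i) v))"
proof -
  let ?A = "conv_power \<Delta> \<delta> A" and ?B = "conv_power \<Delta> \<delta> B"
  define G where "G i j x = sweedler \<Delta> x (\<lambda>u v. ?A i u * ?B j v)" for i j x
  note lin = clinear_intros clinear_sweedler clinear_comult assms(2,3) clinear_conv_power
  have GA: "G (Suc i) j x = sweedler \<Delta> x (\<lambda>u v. A u * G i j v)" for i j x
  proof -
    have "G (Suc i) j x = sweedler \<Delta> x (\<lambda>u v. sweedler \<Delta> u (\<lambda>p q. A p * (?A i q * ?B j v)))"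
      by (simp only: G_def conv_power_Suc[OF assms(2)] sweedler_mult_right[symmetric] mult.assoc)
    also have "\<dots> = sweedler \<Delta> x (\<lambda>u v. sweedler \<Delta> v (\<lambda>p q. A u * (?A i p * ?B j q)))"
      by (rule sweedler_coassoc) (intro lin)+
    finally show ?thesis by (simp only: G_def sweedler_mult)
  qed
  have GB: "G i (Suc j) x = sweedler \<Delta> x (\<lambda>u v. B u * G i j v)" for i j x
  proof -
    have "G i (Suc j) x = sweedler \<Delta> x (\<lambda>u v. sweedler \<Delta> v (\<lambda>p q. ?A i u * (B p * ?B j q)))"
      by (simp only: G_def conv_power_Suc[OF assms(3)] sweedler_mult)
    also have "\<dots> = sweedler \<Delta> x (\<lambda>u v. sweedler \<Delta> u (\<lambda>p q. ?A i p * (B q * ?B j v)))"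
      by (rule sweedler_coassoc[symmetric]) (intro lin)+
    also have "\<dots> = sweedler \<Delta> x (\<lambda>u v. sweedler \<Delta> u (\<lambda>p q. ?A i q * (B p * ?B j v)))"
      by (intro sweedler_cong sweedler_cocommutative[OF assms(1)] lin)
    also have "\<dots> = sweedler \<Delta> x (\<lambda>u v. sweedler \<Delta> v (\<lambda>p q. ?A i p * (B u * ?B j q)))"
      by (rule sweedler_coassoc) (intro lin)+
    also have "\<dots> = sweedler \<Delta> x (\<lambda>u v. sweedler \<Delta> v (\<lambda>p q. B u * (?A i p * ?B j q)))"
      by (simp only: mult.left_commute)
    finally show ?thesis by (simp only: G_def sweedler_mult)
  qed
  have AB: "clinear (\<lambda>x. A x + B x)" by (intro lin)
  have "conv_power \<Delta> \<delta> (\<lambda>x. A x + B x) n x = (\<Sum>i\<le>n. of_nat (n choose i) * G i (n - i) x)" for x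
  proof (induction n arbitrary: x)
    case 0
    then show ?case by (simp add: G_def sweedler_counit_mult clinear_counit)
  next
    case (Suc n)
    have "conv_power \<Delta> \<delta> (\<lambda>x. A x + B x) (Suc n) x =
        (\<Sum>i\<le>n. of_nat (n choose i) * (G (Suc i) (n - i) x + G i (Suc (n - i)) x))"
      unfolding conv_power_Suc[OF AB] Suc.IH GA GB
      by (simp only: sum_distrib_left sweedler_sum_fun mult.left_commute[of _ "of_nat _"] sweedler_mult
        distrib_right sweedler_add)
    also have "\<dots> = (\<Sum>i\<le>n. of_nat (n choose i) * G (Suc i) (n - i) x) +
        (\<Sum>i\<le>n. of_nat (n choose i) * G i (Suc n - i) x)"
      by (simp add: distrib_left sum.distrib Suc_diff_le)
    also have "\<dots> = (\<Sum>i\<le>Suc n. of_nat (Suc n choose i) * G i (Suc n - i) x)"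
    proof -
      have "(\<Sum>i\<le>n. of_nat (n choose i) * G i (Suc n - i) x) =
            (\<Sum>i\<le>Suc n. of_nat (n choose i) * G i (Suc n - i) x)"
        by simp
      also have "\<dots> = G 0 (Suc n) x + (\<Sum>i\<le>n. of_nat (n choose Suc i) * G (Suc i) (n - i) x)"
        by (simp add: sum.atMost_Suc_shift del: sum.atMost_Suc)
      finally show ?thesis
        by (simp add: sum.atMost_Suc_shift distrib_right sum.distrib del: sum.atMost_Suc)
    qed
    finally show ?case .
  qed
  then show ?thesis by (simp add: G_def)
qed

lemma conv_exp_add:
  assumes "cocommutative \<Delta>" "clinear A" "clinear B"
  shows "conv_exp \<Delta> \<delta> t (\<lambda>x. A x + B x) x =
    sweedler \<Delta> x (\<lambda>u v. conv_exp \<Delta> \<delta> t A u * conv_exp \<Delta> \<delta> t B v)"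
proof -
  let ?A = "\<lambda>n u. of_real t ^ n / fact n * conv_power \<Delta> \<delta> A n u"
  let ?B = "\<lambda>n u. of_real t ^ n / fact n * conv_power \<Delta> \<delta> B n u"
  have "(\<lambda>n. \<Sum>i\<le>n. ?A i u * ?B (n - i) v) sums (conv_exp \<Delta> \<delta> t A u * conv_exp \<Delta> \<delta> t B v)" for u v
    using Cauchy_product_sums[OF summable_norm_conv_exp[OF assms(2)] summable_norm_conv_exp[OF assms(3)]]
      sums_unique[OF conv_exp_sums[OF assms(2)]] sums_unique[OF conv_exp_sums[OF assms(3)]] by simp
  then have 1: "(\<lambda>n. sweedler \<Delta> x (\<lambda>u v. \<Sum>i\<le>n. ?A i u * ?B (n - i) v)) sums
      sweedler \<Delta> x (\<lambda>u v. conv_exp \<Delta> \<delta> t A u * conv_exp \<Delta> \<delta> t B v)"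
    by (rule sweedler_sums)
  have "sweedler \<Delta> x (\<lambda>u v. \<Sum>i\<le>n. ?A i u * ?B (n - i) v) =
      of_real t ^ n / fact n * conv_power \<Delta> \<delta> (\<lambda>x. A x + B x) n x" for n
  proof -
    have "?A i u * ?B (n - i) v = of_real t ^ n / fact n * (of_nat (n choose i) *
        (conv_power \<Delta> \<delta> A i u * conv_power \<Delta> \<delta> B (n - i) v))" if "i \<le> n" for i u v
      using that by (simp add: binomial_fact power_add[symmetric] field_simps)
    then have "(\<lambda>u v. \<Sum>i\<le>n. ?A i u * ?B (n - i) v) = (\<lambda>u v. \<Sum>i\<le>n. of_real t ^ n / fact n * (of_nat (n choose i) *
        (conv_power \<Delta> \<delta> A i u * conv_power \<Delta> \<delta> B (n - i) v)))"
      by (intro ext sum.cong) auto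
    then show ?thesis
      by (simp only: sweedler_sum_fun sweedler_mult conv_power_add[OF assms] sum_distrib_left)
  qed
  with 1 conv_exp_sums[OF clinear_add_fun[OF assms(2,3)], of t x] show ?thesis
    using sums_unique2 by simp
qed

text \<open>The case of \<open>s L\<close> and \<open>t L\<close> in the addition theorem.\<close>

lemma conv_exp_semigroup:
  assumes "cocommutative \<Delta>" "clinear L"
  shows "conv_exp \<Delta> \<delta> (s + t) L x = sweedler \<Delta> x (\<lambda>u v. conv_exp \<Delta> \<delta> s L u * conv_exp \<Delta> \<delta> t L v)"
proof -
  have "conv_exp \<Delta> \<delta> (s + t) L x = conv_exp \<Delta> \<delta> 1 (\<lambda>x. of_real s * L x + of_real t * L x) x"
    using conv_exp_scale[OF assms(2), of "s + t"] by (simp add: distrib_right)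
  also have "\<dots> = sweedler \<Delta> x (\<lambda>u v. conv_exp \<Delta> \<delta> s L u * conv_exp \<Delta> \<delta> t L v)"
    using conv_exp_add[OF assms(1) clinear_mult_right[OF assms(2)] clinear_mult_right[OF assms(2)], of 1]
    by (simp add: conv_exp_scale[OF assms(2)])
  finally show ?thesis .
qed

end

section \<open>Cocommutative Hopf algebras\<close>

text \<open>A left and a right convolution inverse of the same map from a coalgebra to an
  algebra agree. The identities for \<open>S (a \<cdot> b)\<close>, \<open>S (S a)\<close> and \<open>\<Delta> (S a)\<close> are instances: in
  each, the two sides are inverse to one and the same map.\<close>

lemma conv_inverse_unique:
  assumes "coalgebra \<Lambda> \<epsilon>" and m: "clinear m"
    and assoc: "\<And>a b c. m (m (a \<otimes> b) \<otimes> c) = m (a \<otimes> m (b \<otimes> c))"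
    and unit: "\<And>a. m (e \<otimes> a) = a" "\<And>a. m (a \<otimes> e) = a"
    and lin: "clinear f" "clinear g" "clinear h"
    and inv: "\<And>x. sweedler \<Lambda> x (\<lambda>u v. m (f u \<otimes> g v)) = \<epsilon> x *\<^sub>C e"
      "\<And>x. sweedler \<Lambda> x (\<lambda>u v. m (g u \<otimes> h v)) = \<epsilon> x *\<^sub>C e"
  shows "f x = h x"
proof -
  interpret coalgebra \<Lambda> \<epsilon> by fact
  note lins = clinear_intros clinear_comp[OF m] clinear_comp[OF lin(1)] clinear_comp[OF lin(2)]
    clinear_comp[OF lin(3)]
  have scale: "m (c *\<^sub>C t) = c *\<^sub>C m t" for c t using m by (simp add: clinear_iff)
  have "f x = sweedler \<Lambda> x (\<lambda>u v. \<epsilon> v *\<^sub>C f u)"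
    by (rule sweedler_counit_right[symmetric]) (intro lins)
  also have "\<dots> = sweedler \<Lambda> x (\<lambda>u v. m (f u \<otimes> (\<epsilon> v *\<^sub>C e)))"
    by (simp only: tensor_of_simps scale unit)
  also have "\<dots> = sweedler \<Lambda> x (\<lambda>u v. sweedler \<Lambda> v (\<lambda>p q. m (f u \<otimes> m (g p \<otimes> h q))))"
    unfolding inv(2)[symmetric] by (rule sweedler_cong, rule sweedler_linear) (intro lins)
  also have "\<dots> = sweedler \<Lambda> x (\<lambda>u v. sweedler \<Lambda> u (\<lambda>p q. m (f p \<otimes> m (g q \<otimes> h v))))"
    by (rule sweedler_coassoc[symmetric]) (intro lins)+
  also have "\<dots> = sweedler \<Lambda> x (\<lambda>u v. m ((\<epsilon> u *\<^sub>C e) \<otimes> h v))"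
    unfolding inv(1)[symmetric] assoc[symmetric]
    by (rule sweedler_cong, rule sweedler_linear[symmetric]) (intro lins)
  also have "\<dots> = sweedler \<Lambda> x (\<lambda>u v. \<epsilon> u *\<^sub>C h v)"
    by (simp only: tensor_of_simps scale unit)
  also have "\<dots> = h x"
    by (rule sweedler_counit_left) (intro lins)
  finally show ?thesis .
qed

lemma (in unital_algebra) times_assoc: "mult (mult (a \<otimes> b) \<otimes> c) = mult (a \<otimes> mult (b \<otimes> c))"
  using fun_cong[OF mult_assoc, of "(a \<otimes> b) \<otimes> c"] clinear_mult by (simp add: complex_vector.linear_id)

context bialgebra
begin

abbreviation times (infixl "\<cdot>" 76) where "a \<cdot> b \<equiv> mult (a \<otimes> b)"
abbreviation comult2 ("\<Delta>\<^sub>2") where "\<Delta>\<^sub>2 \<equiv> comult_prod \<Delta> \<Delta>"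
abbreviation counit2 ("\<delta>\<^sub>2") where "\<delta>\<^sub>2 \<equiv> counit_prod \<delta> \<delta>"

lemma mult_scaleC: "mult (c *\<^sub>C x) = c *\<^sub>C mult x"
  using clinear_mult by (simp add: clinear_iff)

lemma times_scaleC: "(c *\<^sub>C a) \<cdot> b = c *\<^sub>C (a \<cdot> b)" "a \<cdot> (c *\<^sub>C b) = c *\<^sub>C (a \<cdot> b)"
  by (simp_all only: tensor_of_simps mult_scaleC)

lemma counit_times: "\<delta> (a \<cdot> b) = \<delta> a * \<delta> b"
  using fun_cong[OF counit_mult, of "a \<otimes> b"] by (simp add: tensor_counit_eq counit_prod_tensor clinear_counit)

lemma counit_mult2: "\<delta> (mult x) = \<delta>\<^sub>2 x"
  using fun_cong[OF counit_mult, of x] by (simp add: tensor_counit_eq)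

lemma counit2_tensor: "\<delta>\<^sub>2 (a \<otimes> b) = \<delta> a * \<delta> b"
  by (simp add: counit_prod_tensor clinear_counit)

lemma coalgebra2: "coalgebra \<Delta>\<^sub>2 \<delta>\<^sub>2"
  by (rule coalgebra_prod) (rule coalgebra_axioms)+

lemma coalgebra_map_mult: "coalgebra_map \<Delta>\<^sub>2 \<delta>\<^sub>2 \<Delta> \<delta> mult"
  unfolding coalgebra_map_def
proof (intro conjI allI clinear_mult counit_mult2)
  fix x
  have "\<Delta> (mult x) = (mult \<otimes>\<^sub>m mult) (\<Delta>\<^sub>2 x)"
    using fun_cong[OF comult_mult, of x] by (simp add: tensor_comult_eq)
  also have "\<dots> = sweedler \<Delta>\<^sub>2 x (\<lambda>u v. (mult \<otimes>\<^sub>m mult) (u \<otimes> v))"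
    by (intro linear_sweedler clinear_tensor_map clinear_mult)
  finally show "\<Delta> (mult x) = sweedler \<Delta>\<^sub>2 x (\<lambda>u v. mult u \<otimes> mult v)"
    by (simp add: clinear_mult)
qed

lemmas bialgebra_clinear = clinear_intros clinear_mult clinear_comp[OF clinear_mult] clinear_comult clinear_comp[OF clinear_comult]
  clinear_counit clinear_comp[OF clinear_counit] clinear_sweedler clinear_comult_prod clinear_counit_prod
  clinear_comp[OF clinear_counit_prod[OF clinear_counit clinear_counit]]
  clinear_comp[OF clinear_comult_prod[OF clinear_comult clinear_comult]]

lemma sweedler_tensor2:
  assumes "\<And>b. clinear (\<lambda>a. f a b)" "\<And>a. clinear (\<lambda>b. f a b)"
  shows "sweedler \<Delta>\<^sub>2 (x \<otimes> y) f = sweedler \<Delta> x (\<lambda>u u'. sweedler \<Delta> y (\<lambda>v v'. f (u \<otimes> v) (u' \<otimes> v')))"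
  by (rule sweedler_comult_prod[OF clinear_comult clinear_comult assms])

lemma sweedler_one:
  assumes "\<And>b. clinear (\<lambda>a. f a b)" "\<And>a. clinear (\<lambda>b. f a b)"
  shows "sweedler \<Delta> one f = f one one"
  using assms by (simp add: sweedler_def comult_one cbilinearI)

lemma coalgebra_map_one_left: "coalgebra_map \<Delta> \<delta> \<Delta>\<^sub>2 \<delta>\<^sub>2 (\<lambda>a. one \<otimes> a)"
  unfolding coalgebra_map_def
proof (intro conjI allI)
  fix x
  have "\<Delta>\<^sub>2 (one \<otimes> x) = sweedler \<Delta>\<^sub>2 (one \<otimes> x) (\<lambda>u v. u \<otimes> v)" by (rule comult_sweedler)
  also have "\<dots> = sweedler \<Delta> one (\<lambda>u u'. sweedler \<Delta> x (\<lambda>v v'. (u \<otimes> v) \<otimes> (u' \<otimes> v')))"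
    by (rule sweedler_tensor2) (intro bialgebra_clinear)+
  also have "\<dots> = sweedler \<Delta> x (\<lambda>v v'. (one \<otimes> v) \<otimes> (one \<otimes> v'))"
    by (rule sweedler_one) (intro bialgebra_clinear)+
  finally show "\<Delta>\<^sub>2 (one \<otimes> x) = sweedler \<Delta> x (\<lambda>v v'. (one \<otimes> v) \<otimes> (one \<otimes> v'))" .
qed (intro bialgebra_clinear, simp add: counit2_tensor counit_one)

lemma coalgebra_map_one_right: "coalgebra_map \<Delta> \<delta> \<Delta>\<^sub>2 \<delta>\<^sub>2 (\<lambda>a. a \<otimes> one)"
  unfolding coalgebra_map_def
proof (intro conjI allI)
  fix x
  have "\<Delta>\<^sub>2 (x \<otimes> one) = sweedler \<Delta>\<^sub>2 (x \<otimes> one) (\<lambda>u v. u \<otimes> v)" by (rule comult_sweedler)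
  also have "\<dots> = sweedler \<Delta> x (\<lambda>u u'. sweedler \<Delta> one (\<lambda>v v'. (u \<otimes> v) \<otimes> (u' \<otimes> v')))"
    by (rule sweedler_tensor2) (intro bialgebra_clinear)+
  also have "\<dots> = sweedler \<Delta> x (\<lambda>u u'. (u \<otimes> one) \<otimes> (u' \<otimes> one))"
    by (rule sweedler_cong, rule sweedler_one) (intro bialgebra_clinear)+
  finally show "\<Delta>\<^sub>2 (x \<otimes> one) = sweedler \<Delta> x (\<lambda>u u'. (u \<otimes> one) \<otimes> (u' \<otimes> one))" .
qed (intro bialgebra_clinear, simp add: counit2_tensor counit_one)

text \<open>The product of the algebra \<open>B \<otimes> B\<close> with unit \<open>1 \<otimes> 1\<close>. That the antipode respects the
  comultiplication is proved by inverting \<open>\<Delta>\<close> for the convolution of maps from \<open>B\<close> to this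
  algebra.\<close>

definition mult2 :: "('b \<otimes> 'b) \<otimes> ('b \<otimes> 'b) \<Rightarrow> 'b \<otimes> 'b"
  where "mult2 t = (mult \<otimes>\<^sub>m mult) (middle_flip t)"

lemma clinear_mult2: "clinear mult2"
  unfolding mult2_def by (intro clinear_comp[OF clinear_tensor_map] clinear_middle_flip clinear_mult)

lemma mult2_tensor: "mult2 ((a \<otimes> b) \<otimes> (c \<otimes> d)) = (a \<cdot> c) \<otimes> (b \<cdot> d)"
  by (simp add: mult2_def clinear_mult)

lemma mult2_comult: "mult2 (\<Delta> a \<otimes> \<Delta> b) = \<Delta> (a \<cdot> b)"
  using fun_cong[OF comult_mult, of "a \<otimes> b"]
  by (simp add: mult2_def tensor_comult_eq comult_prod_def clinear_comult)

lemma mult2_assoc: "mult2 (mult2 (x \<otimes> y) \<otimes> z) = mult2 (x \<otimes> mult2 (y \<otimes> z))"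
proof -
  note l = clinear_intros clinear_comp[OF clinear_mult2]
  have 1: "mult2 (mult2 ((a \<otimes> b) \<otimes> (c \<otimes> d)) \<otimes> (e \<otimes> f)) = mult2 ((a \<otimes> b) \<otimes> mult2 ((c \<otimes> d) \<otimes> (e \<otimes> f)))"
    for a b c d e f by (simp add: mult2_tensor times_assoc)
  have "(\<lambda>z. mult2 (mult2 ((a \<otimes> b) \<otimes> (c \<otimes> d)) \<otimes> z)) = (\<lambda>z. mult2 ((a \<otimes> b) \<otimes> mult2 ((c \<otimes> d) \<otimes> z)))"
    for a b c d by (intro clinear_tensor_eqI l 1)
  note 2 = fun_cong[OF this]
  have "(\<lambda>y. mult2 (mult2 ((a \<otimes> b) \<otimes> y) \<otimes> z)) = (\<lambda>y. mult2 ((a \<otimes> b) \<otimes> mult2 (y \<otimes> z)))"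
    for a b z by (intro clinear_tensor_eqI l 2)
  note 3 = fun_cong[OF this]
  have "(\<lambda>x. mult2 (mult2 (x \<otimes> y) \<otimes> z)) = (\<lambda>x. mult2 (x \<otimes> mult2 (y \<otimes> z)))"
    for y z by (intro clinear_tensor_eqI l 3)
  then show ?thesis by (rule fun_cong)
qed

lemma mult2_one: "mult2 ((one \<otimes> one) \<otimes> x) = x" "mult2 (x \<otimes> (one \<otimes> one)) = x"
proof -
  note l = clinear_intros clinear_comp[OF clinear_mult2]
  have "(\<lambda>x. mult2 ((one \<otimes> one) \<otimes> x)) = (\<lambda>x. x)" "(\<lambda>x. mult2 (x \<otimes> (one \<otimes> one))) = (\<lambda>x. x)"
    by (intro clinear_tensor_eqI l, simp add: mult2_tensor mult_one_left mult_one_right)+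
  then show "mult2 ((one \<otimes> one) \<otimes> x) = x" "mult2 (x \<otimes> (one \<otimes> one)) = x" by (simp_all add: fun_eq_iff)
qed

end

locale cocommutative_hopf_algebra = hopf_algebra +
  assumes cocommutative: "cocommutative \<Delta>"
begin

lemmas hopf_clinear = bialgebra_clinear clinear_antipode clinear_comp[OF clinear_antipode]

lemma sweedler_antipode:
  "sweedler \<Delta> a (\<lambda>u v. S u \<cdot> v) = \<delta> a *\<^sub>C one" "sweedler \<Delta> a (\<lambda>u v. u \<cdot> S v) = \<delta> a *\<^sub>C one"
proof -
  have id: "clinear (id :: 'a \<Rightarrow> 'a)" by (simp add: clinear_iff)
  have "sweedler \<Delta> a (\<lambda>u v. mult ((S \<otimes>\<^sub>m id) (u \<otimes> v))) = mult ((S \<otimes>\<^sub>m id) (\<Delta> a))"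
    by (rule linear_sweedler[symmetric])
       (intro clinear_comp[OF clinear_mult] clinear_tensor_map clinear_antipode id)
  then show "sweedler \<Delta> a (\<lambda>u v. S u \<cdot> v) = \<delta> a *\<^sub>C one"
    using fun_cong[OF antipode_left, of a] by (simp add: clinear_antipode id)
  have "sweedler \<Delta> a (\<lambda>u v. mult ((id \<otimes>\<^sub>m S) (u \<otimes> v))) = mult ((id \<otimes>\<^sub>m S) (\<Delta> a))"
    by (rule linear_sweedler[symmetric])
       (intro clinear_comp[OF clinear_mult] clinear_tensor_map clinear_antipode id)
  then show "sweedler \<Delta> a (\<lambda>u v. u \<cdot> S v) = \<delta> a *\<^sub>C one"
    using fun_cong[OF antipode_right, of a] by (simp add: clinear_antipode id)
qed

lemma antipode_one: "S one = one"
proof -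
  have "sweedler \<Delta> one (\<lambda>u v. S u \<cdot> v) = S one \<cdot> one"
    by (rule sweedler_one) (intro hopf_clinear)+
  then show ?thesis by (simp add: sweedler_antipode mult_one_right counit_one scaleC_one)
qed

lemma counit_antipode: "\<delta> (S a) = \<delta> a"
proof -
  have "\<delta> (sweedler \<Delta> a (\<lambda>u v. S u \<cdot> v)) = sweedler \<Delta> a (\<lambda>u v. \<delta> (S u) * \<delta> v)"
    by (simp only: sweedler_linear[OF clinear_counit] counit_times)
  also have "\<dots> = \<delta> (S a)" by (rule sweedler_counit_mult) (intro hopf_clinear)
  finally show ?thesis using clinear_counit by (simp add: sweedler_antipode clinear_iff counit_one)
qed

text \<open>Both sides are convolution inverse to the product, as maps from \<open>B \<otimes> B\<close> to \<open>B\<close>.\<close>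

lemma antipode_times: "S (a \<cdot> b) = S b \<cdot> S a"
proof -
  let ?h = "\<lambda>x. mult ((S \<otimes>\<^sub>m S) (flip x))"
  have h: "clinear ?h"
    by (intro clinear_comp[OF clinear_mult] clinear_comp[OF clinear_tensor_map] clinear_flip clinear_antipode)
  note l = hopf_clinear clinear_comp[OF h]
  have "S (mult (a \<otimes> b)) = ?h (a \<otimes> b)"
  proof (rule conv_inverse_unique[OF coalgebra2 clinear_mult times_assoc mult_one_left mult_one_right,
        where f = "\<lambda>x. S (mult x)" and g = mult and h = ?h])
    fix x
    have "sweedler \<Delta>\<^sub>2 x (\<lambda>u v. S (mult u) \<cdot> mult v) = sweedler \<Delta> (mult x) (\<lambda>u v. S u \<cdot> v)"
      by (rule sweedler_map[OF coalgebra_map_mult, symmetric]) (intro l)+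
    then show "sweedler \<Delta>\<^sub>2 x (\<lambda>u v. S (mult u) \<cdot> mult v) = \<delta>\<^sub>2 x *\<^sub>C one"
      by (simp only: sweedler_antipode counit_mult2)
    have "sweedler \<Delta>\<^sub>2 (a \<otimes> b) (\<lambda>u v. mult u \<cdot> ?h v) = \<delta>\<^sub>2 (a \<otimes> b) *\<^sub>C one" for a b
    proof -
      have "sweedler \<Delta>\<^sub>2 (a \<otimes> b) (\<lambda>u v. mult u \<cdot> ?h v) =
          sweedler \<Delta> a (\<lambda>u u'. sweedler \<Delta> b (\<lambda>v v'. (u \<cdot> v) \<cdot> ?h (u' \<otimes> v')))"
        by (rule sweedler_tensor2) (intro l)+
      also have "\<dots> = sweedler \<Delta> a (\<lambda>u u'. sweedler \<Delta> b (\<lambda>v v'. (u \<cdot> (v \<cdot> S v')) \<cdot> S u'))"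
        by (simp add: times_assoc clinear_antipode)
      also have "\<dots> = sweedler \<Delta> a (\<lambda>u u'. (u \<cdot> (sweedler \<Delta> b (\<lambda>v v'. v \<cdot> S v'))) \<cdot> S u')"
        by (rule sweedler_cong, rule sweedler_linear[symmetric]) (intro l)
      also have "\<dots> = \<delta> b *\<^sub>C sweedler \<Delta> a (\<lambda>u u'. u \<cdot> S u')"
        by (simp only: sweedler_antipode times_scaleC mult_one_right sweedler_scaleC)
      finally show ?thesis
        by (simp add: sweedler_antipode counit2_tensor scaleC_scaleC mult.commute)
    qed
    then have "(\<lambda>x. sweedler \<Delta>\<^sub>2 x (\<lambda>u v. mult u \<cdot> ?h v)) = (\<lambda>x. \<delta>\<^sub>2 x *\<^sub>C one)"
      by (intro clinear_tensor_eqI l)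
    then show "sweedler \<Delta>\<^sub>2 x (\<lambda>u v. mult u \<cdot> ?h v) = \<delta>\<^sub>2 x *\<^sub>C one" by (rule fun_cong)
  qed (intro l h)+
  then show ?thesis by (simp add: clinear_antipode)
qed

text \<open>Both sides are convolution inverse to \<open>S\<close>; for \<open>S \<circ> S\<close> one applies \<open>S\<close> to the
  antipode identity, which reverses the order of the factors, and restores it by
  cocommutativity.\<close>

lemma antipode_antipode: "S (S a) = a"
proof (rule conv_inverse_unique[OF coalgebra_axioms clinear_mult times_assoc mult_one_left mult_one_right,
      where f = "\<lambda>x. S (S x)" and g = S and h = "\<lambda>x. x"])
  fix x
  have "sweedler \<Delta> x (\<lambda>u v. S (S u) \<cdot> S v) = S (sweedler \<Delta> x (\<lambda>u v. v \<cdot> S u))"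
    by (simp only: sweedler_linear[OF clinear_antipode] antipode_times)
  also have "sweedler \<Delta> x (\<lambda>u v. v \<cdot> S u) = sweedler \<Delta> x (\<lambda>u v. u \<cdot> S v)"
    by (rule sweedler_cocommutative[OF cocommutative]) (intro hopf_clinear)+
  finally show "sweedler \<Delta> x (\<lambda>u v. S (S u) \<cdot> S v) = \<delta> x *\<^sub>C one"
    using clinear_antipode by (simp add: sweedler_antipode antipode_one clinear_iff)
qed (intro hopf_clinear sweedler_antipode)+

text \<open>In general \<open>S\<close> reverses the comultiplication; here \<open>\<Delta> \<circ> S\<close> and \<open>(S \<otimes> S) \<circ> \<Delta>\<close> are
  both convolution inverse to \<open>\<Delta>\<close>, as maps from \<open>B\<close> to the algebra \<open>B \<otimes> B\<close>.\<close>

lemma coalgebra_map_antipode: "coalgebra_map \<Delta> \<delta> \<Delta> \<delta> S"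
  unfolding coalgebra_map_def
proof (intro conjI allI clinear_antipode counit_antipode)
  fix x
  let ?h = "\<lambda>x. (S \<otimes>\<^sub>m S) (\<Delta> x)"
  have SS: "clinear (S \<otimes>\<^sub>m S)" by (intro clinear_tensor_map clinear_antipode)
  note l = hopf_clinear clinear_mult2 clinear_comp[OF clinear_mult2] SS clinear_comp[OF SS]
  have "\<Delta> (S x) = ?h x"
  proof (rule conv_inverse_unique[OF coalgebra_axioms clinear_mult2 mult2_assoc mult2_one,
        where f = "\<lambda>x. \<Delta> (S x)" and g = \<Delta> and h = ?h])
    fix x
    have "sweedler \<Delta> x (\<lambda>u v. mult2 (\<Delta> (S u) \<otimes> \<Delta> v)) = \<Delta> (sweedler \<Delta> x (\<lambda>u v. S u \<cdot> v))"
      by (simp only: mult2_comult sweedler_linear[OF clinear_comult])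
    then show "sweedler \<Delta> x (\<lambda>u v. mult2 (\<Delta> (S u) \<otimes> \<Delta> v)) = \<delta> x *\<^sub>C (one \<otimes> one)"
      using clinear_comult by (simp add: sweedler_antipode comult_one clinear_iff)
    have "mult2 (\<Delta> u \<otimes> ?h v) = sweedler \<Delta> u (\<lambda>a b. sweedler \<Delta> v (\<lambda>c d. (a \<cdot> S c) \<otimes> (b \<cdot> S d)))" for u v
    proof -
      have "mult2 (\<Delta> u \<otimes> ?h v) = sweedler \<Delta> u (\<lambda>a b. mult2 ((a \<otimes> b) \<otimes> ?h v))"
        by (rule linear_sweedler) (intro l)
      also have "\<dots> = sweedler \<Delta> u (\<lambda>a b. sweedler \<Delta> v (\<lambda>c d. mult2 ((a \<otimes> b) \<otimes> (S \<otimes>\<^sub>m S) (c \<otimes> d))))"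
        by (rule sweedler_cong, rule linear_sweedler) (intro l)
      finally show ?thesis by (simp add: mult2_tensor clinear_antipode)
    qed
    then have "sweedler \<Delta> x (\<lambda>u v. mult2 (\<Delta> u \<otimes> ?h v)) =
        sweedler \<Delta> x (\<lambda>u v. sweedler \<Delta> u (\<lambda>a b. sweedler \<Delta> v (\<lambda>c d. (a \<cdot> S c) \<otimes> (b \<cdot> S d))))"
      by simp
    also have "\<dots> = sweedler \<Delta> x (\<lambda>u v. sweedler \<Delta> u (\<lambda>a b. sweedler \<Delta> v (\<lambda>c d. (a \<cdot> S b) \<otimes> (c \<cdot> S d))))"
      by (rule sweedler_middle_swap[OF cocommutative]) (intro l)+
    also have "\<dots> = sweedler \<Delta> x (\<lambda>u v. sweedler \<Delta> u (\<lambda>a b. (a \<cdot> S b) \<otimes> (\<delta> v *\<^sub>C one)))"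
      unfolding sweedler_antipode(2)[symmetric]
      by (rule sweedler_cong, rule sweedler_cong, rule sweedler_linear[symmetric]) (intro l)
    also have "\<dots> = sweedler \<Delta> x (\<lambda>u v. (\<delta> u *\<^sub>C one) \<otimes> (\<delta> v *\<^sub>C one))"
      unfolding sweedler_antipode(2)[of u for u, symmetric]
      by (rule sweedler_cong, rule sweedler_linear[symmetric]) (intro l)
    also have "\<dots> = sweedler \<Delta> x (\<lambda>u v. \<delta> u *\<^sub>C (\<delta> v *\<^sub>C (one \<otimes> one)))"
      by (simp only: tensor_of_simps scaleC_scaleC mult.commute)
    also have "\<dots> = \<delta> x *\<^sub>C (one \<otimes> one)"
      by (rule sweedler_counit_left) (intro l)
    finally show "sweedler \<Delta> x (\<lambda>u v. mult2 (\<Delta> u \<otimes> ?h v)) = \<delta> x *\<^sub>C (one \<otimes> one)" .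
  qed (intro l)+
  also have "?h x = sweedler \<Delta> x (\<lambda>u v. (S \<otimes>\<^sub>m S) (u \<otimes> v))"
    by (rule linear_sweedler[OF SS])
  finally show "\<Delta> (S x) = sweedler \<Delta> x (\<lambda>u v. S u \<otimes> S v)"
    by (simp add: clinear_antipode)
qed

end

section \<open>Generators of additive deformations\<close>

text \<open>Deformations are only constrained at times \<open>t \<ge> 0\<close>, so derivatives at \<open>0\<close> are
  one-sided.\<close>

lemma vector_derivative_unique_right:
  fixes f g :: "real \<Rightarrow> complex"
  assumes "(f has_vector_derivative a) (at 0 within {0..})"
    and "(g has_vector_derivative b) (at 0 within {0..})"
    and eq: "\<And>t. t \<ge> 0 \<Longrightarrow> f t = g t"
  shows "a = b"
proof -
  have "((\<lambda>t. f t - g t) has_vector_derivative (a - b)) (at 0 within {0..})"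
    by (intro has_vector_derivative_diff assms)
  then have "((\<lambda>t. (1 / norm t) *\<^sub>R (f t - g t - (f 0 - g 0 + t *\<^sub>R (a - b)))) \<longlongrightarrow> 0) (at_right 0)"
    by (simp add: has_vector_derivative_def has_derivative_within at_within_Ici_at_right)
  moreover have "\<forall>\<^sub>F t in at_right 0. (1 / norm t) *\<^sub>R (f t - g t - (f 0 - g 0 + t *\<^sub>R (a - b))) = b - a"
    unfolding eventually_at_right_field
    using eq by (intro exI[of _ 1]) (simp add: algebra_simps flip: scaleR_diff_right)
  ultimately have "((\<lambda>t. b - a) \<longlongrightarrow> 0) (at_right (0::real))"
    using tendsto_cong by fast
  then show ?thesis
    using tendsto_unique[OF _ tendsto_const] trivial_limit_at_right_real by fastforce
qed

context bialgebra
begin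

text \<open>Hochschild 2-cocycles with values in the trivial bimodule \<open>\<complex>\<close>, written without
  subtraction. On a cocommutative bialgebra every functional is central for convolution, so
  these are exactly the generators of additive deformations.\<close>

definition normalized_cocycle :: "('b \<otimes> 'b \<Rightarrow> complex) \<Rightarrow> bool" where
  "normalized_cocycle L \<longleftrightarrow> clinear L \<and> L (one \<otimes> one) = 0 \<and>
    (\<forall>a b c. \<delta> a * L (b \<otimes> c) + L (a \<otimes> b \<cdot> c) = L (a \<cdot> b \<otimes> c) + L (a \<otimes> b) * \<delta> c)"

lemma normalized_cocycleD:
  assumes "normalized_cocycle L"
  shows "clinear L" "L (one \<otimes> one) = 0"
    "\<delta> a * L (b \<otimes> c) + L (a \<otimes> b \<cdot> c) = L (a \<cdot> b \<otimes> c) + L (a \<otimes> b) * \<delta> c"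
  using assms unfolding normalized_cocycle_def by blast+

lemma normalized_cocycle_one:
  assumes "normalized_cocycle L"
  shows "L (one \<otimes> a) = 0" "L (a \<otimes> one) = 0"
  using normalized_cocycleD(3)[OF assms, of one one a] normalized_cocycleD(3)[OF assms, of a one one]
  by (simp_all add: normalized_cocycleD(2)[OF assms] mult_one_left mult_one_right counit_one)

lemma normalized_cocycle_diff:
  assumes "normalized_cocycle L" "normalized_cocycle M"
  shows "normalized_cocycle (\<lambda>x. L x - M x)"
  unfolding normalized_cocycle_def
proof (intro conjI allI)
  show "clinear (\<lambda>x. L x - M x)"
    using normalized_cocycleD(1)[OF assms(1)] normalized_cocycleD(1)[OF assms(2)]
    by (simp add: clinear_iff algebra_simps)
  fix a b c
  show "\<delta> a * (L (b \<otimes> c) - M (b \<otimes> c)) + (L (a \<otimes> b \<cdot> c) - M (a \<otimes> b \<cdot> c)) =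
      L (a \<cdot> b \<otimes> c) - M (a \<cdot> b \<otimes> c) + (L (a \<otimes> b) - M (a \<otimes> b)) * \<delta> c"
    using normalized_cocycleD(3)[OF assms(1), of a b c] normalized_cocycleD(3)[OF assms(2), of a b c]
    by (simp add: algebra_simps)
qed (simp add: normalized_cocycleD(2) assms)

lemma clinear_coboundary:
  assumes "clinear \<psi>"
  shows "clinear (coboundary mult \<delta> \<psi>)"
  unfolding coboundary_def
  using assms clinear_mult clinear_counit
  by (intro clinear_tensor_lift) (simp add: cbilinear_iff clinear_iff tensor_of_simps algebra_simps)

lemma normalized_cocycle_coboundary:
  assumes "clinear \<psi>" "\<psi> one = 0"
  shows "normalized_cocycle (coboundary mult \<delta> \<psi>)"
  unfolding normalized_cocycle_def
  by (simp add: clinear_coboundary assms coboundary_tensor[OF clinear_mult clinear_counit assms(1)]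
      mult_one_left counit_times times_assoc algebra_simps)

text \<open>Put \<open>\<phi>\<^sub>t = \<delta> \<circ> \<mu>\<^sub>t\<close>. Comparing the comultiplication of \<open>\<mu>\<close> at the times \<open>0\<close> and \<open>t\<close>
  gives \<open>\<mu>\<^sub>t = \<mu> \<star> \<phi>\<^sub>t\<close>. Hence the counit of \<open>\<mu>\<^sub>t (\<mu>\<^sub>t (a \<otimes> b) \<otimes> c)\<close> is a finite sum of
  products of two values of \<open>\<phi>\<^sub>t\<close>, and likewise for the other bracketing. Differentiating
  associativity at \<open>t = 0\<close> by the product rule yields the cocycle identity.\<close>

lemma normalized_cocycle_generator:
  assumes "additive_deformation mult one \<Delta> \<delta> \<mu>" "has_generator \<delta> \<mu> L"
  shows "normalized_cocycle L"
proof -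
  have alg: "unital_algebra (\<mu> t) one" if "t \<ge> 0" for t
    using assms(1) that by (simp add: additive_deformation_def)
  have \<mu>0: "\<mu> 0 = mult"
    using assms(1) by (simp add: additive_deformation_def)
  have \<mu>_comult: "\<Delta> (\<mu> t x) = (mult \<otimes>\<^sub>m \<mu> t) (\<Delta>\<^sub>2 x)" if "t \<ge> 0" for t x
  proof -
    have "\<Delta> \<circ> \<mu> (0 + t) = (\<mu> 0 \<otimes>\<^sub>m \<mu> t) \<circ> tensor_comult \<Delta>"
      using assms(1) that unfolding additive_deformation_def by blast
    then show ?thesis by (simp add: fun_eq_iff \<mu>0 tensor_comult_eq)
  qed
  have clin: "clinear (\<mu> t)" if "t \<ge> 0" for t
    using alg[OF that] by (rule unital_algebra.clinear_mult)
  define \<phi> where "\<phi> t x = \<delta> (\<mu> t x)" for t x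
  have \<phi>_lin: "clinear (\<phi> t)" if "t \<ge> 0" for t
    unfolding \<phi>_def by (intro clinear_comp[OF clinear_counit] clin that)
  have \<phi>0: "\<phi> 0 x = \<delta>\<^sub>2 x" for x by (simp add: \<phi>_def \<mu>0 counit_mult2)
  have deriv: "((\<lambda>t. \<phi> t x) has_vector_derivative L x) (at 0 within {0..})" for x
    using assms(2) by (simp add: has_generator_def \<phi>_def)
  have id: "clinear (id :: 'b \<Rightarrow> 'b)" by (simp add: clinear_iff)
  have \<mu>: "\<mu> t x = sweedler \<Delta>\<^sub>2 x (\<lambda>u v. \<phi> t v *\<^sub>C mult u)" if "t \<ge> 0" for t x
  proof -
    have "\<mu> t x = runit ((id \<otimes>\<^sub>m \<delta>) (\<Delta> (\<mu> t x)))"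
      using fun_cong[OF counit_right, of "\<mu> t x"] by simp
    also have "\<dots> = runit ((id \<otimes>\<^sub>m \<delta>) ((mult \<otimes>\<^sub>m \<mu> t) (\<Delta>\<^sub>2 x)))"
      by (simp add: \<mu>_comult that)
    also have "\<dots> = sweedler \<Delta>\<^sub>2 x (\<lambda>u v. runit ((id \<otimes>\<^sub>m \<delta>) ((mult \<otimes>\<^sub>m \<mu> t) (u \<otimes> v))))"
      by (rule linear_sweedler)
        (intro clinear_comp[OF clinear_runit] clinear_comp[OF clinear_tensor_map]
          clinear_tensor_map id clinear_counit clinear_mult clin that)
    finally show ?thesis by (simp add: id clinear_counit clinear_mult clin that \<phi>_def)
  qed
  have L: "clinear L"
    unfolding clinear_iff
  proof (intro conjI allI)
    fix x y c
    show "L (x + y) = L x + L y"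
      by (rule vector_derivative_unique_right[OF deriv has_vector_derivative_add[OF deriv deriv]])
        (use \<phi>_lin in \<open>simp add: clinear_iff\<close>)
    show "L (c *\<^sub>C x) = c *\<^sub>C L x"
      unfolding scaleC_complex_def
      by (rule vector_derivative_unique_right[OF deriv has_vector_derivative_mult_right[OF deriv]])
        (use \<phi>_lin in \<open>simp add: clinear_iff\<close>)
  qed
  note l = bialgebra_clinear clinear_comp[OF L]
  have "L (one \<otimes> one) = 0"
  proof (rule vector_derivative_unique_right[OF deriv has_vector_derivative_const])
    fix t :: real assume "t \<ge> 0"
    then show "\<phi> t (one \<otimes> one) = 1"
      by (simp add: \<phi>_def unital_algebra.mult_one_left[OF alg] counit_one)
  qed
  moreover have "\<delta> a * L (b \<otimes> c) + L (a \<otimes> b \<cdot> c) = L (a \<cdot> b \<otimes> c) + L (a \<otimes> b) * \<delta> c" for a b c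
  proof -
    have left: "((\<lambda>t. sweedler \<Delta>\<^sub>2 (a \<otimes> b) (\<lambda>u v. \<phi> t v * \<phi> t (mult u \<otimes> c)))
        has_vector_derivative L (a \<cdot> b \<otimes> c) + L (a \<otimes> b) * \<delta> c) (at 0 within {0..})"
    proof -
      have "((\<lambda>t. sweedler \<Delta>\<^sub>2 (a \<otimes> b) (\<lambda>u v. \<phi> t v * \<phi> t (mult u \<otimes> c))) has_vector_derivative
          sweedler \<Delta>\<^sub>2 (a \<otimes> b) (\<lambda>u v. \<phi> 0 v * L (mult u \<otimes> c) + L v * \<phi> 0 (mult u \<otimes> c))) (at 0 within {0..})"
        by (intro sweedler_has_vector_derivative has_vector_derivative_mult deriv)
      also have "sweedler \<Delta>\<^sub>2 (a \<otimes> b) (\<lambda>u v. \<phi> 0 v * L (mult u \<otimes> c) + L v * \<phi> 0 (mult u \<otimes> c)) =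
          sweedler \<Delta>\<^sub>2 (a \<otimes> b) (\<lambda>u v. L (mult u \<otimes> c) * \<delta>\<^sub>2 v) + sweedler \<Delta>\<^sub>2 (a \<otimes> b) (\<lambda>u v. \<delta>\<^sub>2 u * (L v * \<delta> c))"
        by (simp add: sweedler_add \<phi>0 counit2_tensor counit_mult2 mult_ac)
      also have "\<dots> = L (a \<cdot> b \<otimes> c) + L (a \<otimes> b) * \<delta> c"
        by (intro arg_cong2[of _ _ _ _ "(+)"] coalgebra.sweedler_counit_mult[OF coalgebra2] l L)
      finally show ?thesis .
    qed
    have right: "((\<lambda>t. sweedler \<Delta>\<^sub>2 (b \<otimes> c) (\<lambda>u v. \<phi> t v * \<phi> t (a \<otimes> mult u)))
        has_vector_derivative L (a \<otimes> b \<cdot> c) + \<delta> a * L (b \<otimes> c)) (at 0 within {0..})"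
    proof -
      have "((\<lambda>t. sweedler \<Delta>\<^sub>2 (b \<otimes> c) (\<lambda>u v. \<phi> t v * \<phi> t (a \<otimes> mult u))) has_vector_derivative
          sweedler \<Delta>\<^sub>2 (b \<otimes> c) (\<lambda>u v. \<phi> 0 v * L (a \<otimes> mult u) + L v * \<phi> 0 (a \<otimes> mult u))) (at 0 within {0..})"
        by (intro sweedler_has_vector_derivative has_vector_derivative_mult deriv)
      also have "sweedler \<Delta>\<^sub>2 (b \<otimes> c) (\<lambda>u v. \<phi> 0 v * L (a \<otimes> mult u) + L v * \<phi> 0 (a \<otimes> mult u)) =
          sweedler \<Delta>\<^sub>2 (b \<otimes> c) (\<lambda>u v. L (a \<otimes> mult u) * \<delta>\<^sub>2 v) + sweedler \<Delta>\<^sub>2 (b \<otimes> c) (\<lambda>u v. \<delta>\<^sub>2 u * (\<delta> a * L v))"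
        by (simp add: sweedler_add \<phi>0 counit2_tensor counit_mult2 mult_ac)
      also have "\<dots> = L (a \<otimes> b \<cdot> c) + \<delta> a * L (b \<otimes> c)"
        by (intro arg_cong2[of _ _ _ _ "(+)"] coalgebra.sweedler_counit_mult[OF coalgebra2] l L)
      finally show ?thesis .
    qed
    have "L (a \<cdot> b \<otimes> c) + L (a \<otimes> b) * \<delta> c = L (a \<otimes> b \<cdot> c) + \<delta> a * L (b \<otimes> c)"
    proof (rule vector_derivative_unique_right[OF left right])
      fix t :: real assume t: "t \<ge> 0"
      note pull = sweedler_linear[OF clinear_comp[OF \<phi>_lin[OF t]]]
      have scale: "\<phi> t (r *\<^sub>C x) = r * \<phi> t x" for r x using \<phi>_lin[OF t] by (simp add: clinear_iff)
      have "sweedler \<Delta>\<^sub>2 (a \<otimes> b) (\<lambda>u v. \<phi> t v * \<phi> t (mult u \<otimes> c)) = \<phi> t (\<mu> t (a \<otimes> b) \<otimes> c)"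
        unfolding \<mu>[OF t, of "a \<otimes> b"] pull[OF clinear_tensor_left[OF clinear_id]]
        by (simp only: tensor_of_simps scale)
      also have "\<dots> = \<phi> t (a \<otimes> \<mu> t (b \<otimes> c))"
        by (simp add: \<phi>_def unital_algebra.times_assoc[OF alg[OF t]])
      also have "\<dots> = sweedler \<Delta>\<^sub>2 (b \<otimes> c) (\<lambda>u v. \<phi> t v * \<phi> t (a \<otimes> mult u))"
        unfolding \<mu>[OF t, of "b \<otimes> c"] pull[OF clinear_tensor_right[OF clinear_id]]
        by (simp only: tensor_of_simps scale)
      finally show "sweedler \<Delta>\<^sub>2 (a \<otimes> b) (\<lambda>u v. \<phi> t v * \<phi> t (mult u \<otimes> c)) =
          sweedler \<Delta>\<^sub>2 (b \<otimes> c) (\<lambda>u v. \<phi> t v * \<phi> t (a \<otimes> mult u))" .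
    qed
    then show ?thesis by (simp add: add.commute)
  qed
  ultimately show ?thesis using L by (simp add: normalized_cocycle_def)
qed

end

section \<open>The deformation generated by a cocycle\<close>

context bialgebra
begin

context
  fixes L :: "'b \<otimes> 'b \<Rightarrow> complex"
  assumes L: "clinear L"
begin

abbreviation cocycle_exp ("E") where "E t \<equiv> conv_exp \<Delta>\<^sub>2 \<delta>\<^sub>2 t L"
abbreviation deformation ("D") where "D t \<equiv> deformation_by mult \<Delta> \<delta> L t"

lemma clinear_cocycle_exp: "clinear (E t)"
  by (rule coalgebra.clinear_conv_exp[OF coalgebra2 L])

lemma deformation_sweedler: "D t x = sweedler \<Delta>\<^sub>2 x (\<lambda>u v. E t v *\<^sub>C mult u)"
  unfolding deformation_by_def tensor_comult_eq tensor_counit_eq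
  by (rule conv_right_sweedler[OF clinear_mult clinear_cocycle_exp])

lemma clinear_deformation: "clinear (D t)"
proof -
  have "clinear (\<lambda>x. sweedler \<Delta>\<^sub>2 x (\<lambda>u v. E t v *\<^sub>C mult u))"
    by (intro bialgebra_clinear clinear_cocycle_exp)
  moreover have "D t = (\<lambda>x. sweedler \<Delta>\<^sub>2 x (\<lambda>u v. E t v *\<^sub>C mult u))"
    by (rule ext) (rule deformation_sweedler)
  ultimately show ?thesis by simp
qed

lemmas deformation_clinear = bialgebra_clinear clinear_cocycle_exp clinear_comp[OF clinear_cocycle_exp] clinear_deformation
  clinear_comp[OF clinear_deformation]

lemma counit_deformation: "\<delta> (D t x) = E t x"
proof -
  have "\<delta> (D t x) = sweedler \<Delta>\<^sub>2 x (\<lambda>u v. \<delta> (E t v *\<^sub>C mult u))"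
    unfolding deformation_sweedler by (rule sweedler_linear[OF clinear_counit])
  also have "\<dots> = sweedler \<Delta>\<^sub>2 x (\<lambda>u v. \<delta>\<^sub>2 u * E t v)"
    using clinear_counit by (simp add: clinear_iff counit_mult2 mult.commute)
  also have "\<dots> = E t x"
    by (rule coalgebra.sweedler_counit_mult[OF coalgebra2 clinear_cocycle_exp])
  finally show ?thesis .
qed

lemma deformation_map:
  assumes "coalgebra_map \<Lambda> \<epsilon> \<Delta>\<^sub>2 \<delta>\<^sub>2 \<alpha>"
  shows "D t (\<alpha> x) = sweedler \<Lambda> x (\<lambda>u v. E t (\<alpha> v) *\<^sub>C mult (\<alpha> u))"
  unfolding deformation_sweedler by (rule sweedler_map[OF assms]) (intro deformation_clinear)+

text \<open>If \<open>L \<circ> \<alpha> = 0\<close> then the exponential of \<open>L\<close>, pulled back along \<open>\<alpha>\<close>, is the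
  exponential of zero, the counit: along \<open>\<alpha>\<close> the product is not deformed. With \<open>\<alpha> a = 1 \<otimes> a\<close>
  and \<open>\<alpha> a = a \<otimes> 1\<close> this gives the unit laws, with \<open>\<alpha> = (S \<otimes> id) \<circ> \<Delta>\<close> and \<open>\<alpha> = (id \<otimes> S) \<circ> \<Delta>\<close>
  the constancy of the antipode.\<close>

lemma deformation_vanishing:
  assumes "coalgebra \<Lambda> \<epsilon>" "coalgebra_map \<Lambda> \<epsilon> \<Delta>\<^sub>2 \<delta>\<^sub>2 \<alpha>" "\<And>x. L (\<alpha> x) = 0"
  shows "D t (\<alpha> x) = mult (\<alpha> x)"
proof -
  interpret C: coalgebra \<Lambda> \<epsilon> by fact
  have "E t (\<alpha> x) = \<epsilon> x" for x
    using C.conv_exp_map[OF assms(2) coalgebra2 L, of t x] by (simp add: assms(3) C.conv_exp_of_zero)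
  then have "D t (\<alpha> x) = sweedler \<Lambda> x (\<lambda>u v. \<epsilon> v *\<^sub>C mult (\<alpha> u))"
    by (simp add: deformation_map[OF assms(2)])
  also have "\<dots> = mult (\<alpha> x)"
    by (rule C.sweedler_counit_right) (intro deformation_clinear coalgebra_mapD(1)[OF assms(2)])
  finally show ?thesis .
qed

lemma deformation_0: "D 0 = mult"
proof
  fix x
  show "D 0 x = mult x"
    unfolding deformation_sweedler coalgebra.conv_exp_zero[OF coalgebra2]
    by (rule coalgebra.sweedler_counit_right[OF coalgebra2 clinear_mult])
qed

lemma has_generator_deformation: "has_generator \<delta> (deformation_by mult \<Delta> \<delta> L) L"
  unfolding has_generator_def counit_deformation
  by (intro allI coalgebra.conv_exp_has_vector_derivative[OF coalgebra2 L])

lemma tendsto_counit_deformation: "((\<lambda>t. \<delta> (D t x)) \<longlongrightarrow> \<delta>\<^sub>2 x) (at_right 0)"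
proof -
  have "continuous (at_right 0) (\<lambda>t. E t x)"
    by (rule has_vector_derivative_continuous,
        rule coalgebra.conv_exp_has_vector_derivative[OF coalgebra2 L])
  then show ?thesis
    by (simp add: continuous_within counit_deformation coalgebra.conv_exp_zero[OF coalgebra2])
qed

text \<open>With the semigroup law, both sides are \<open>e\<^sup>t\<^sup>L(x\<^bsub>(3)\<^esub>) e\<^sup>s\<^sup>L(x\<^bsub>(4)\<^esub>) \<mu>(x\<^bsub>(1)\<^esub>) \<otimes>
  \<mu>(x\<^bsub>(2)\<^esub>)\<close>, up to an exchange of the two middle Sweedler factors.\<close>

lemma comult_deformation:
  assumes cocomm: "cocommutative \<Delta>"
  shows "\<Delta> \<circ> D (t + s) = (D t \<otimes>\<^sub>m D s) \<circ> \<Delta>\<^sub>2"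
proof
  fix x
  have cocomm2: "cocommutative \<Delta>\<^sub>2"
    by (rule cocommutative_prod[OF clinear_comult clinear_comult cocomm cocomm])
  interpret C: coalgebra \<Delta>\<^sub>2 \<delta>\<^sub>2 by (rule coalgebra2)
  have scale: "\<Delta> (c *\<^sub>C y) = c *\<^sub>C \<Delta> y" for c y using clinear_comult by (simp add: clinear_iff)
  let ?f = "\<lambda>a b c d. (E t c * E s d) *\<^sub>C (mult a \<otimes> mult b)"
  have "\<Delta> (D (t + s) x) = sweedler \<Delta>\<^sub>2 x (\<lambda>u v. E (t + s) v *\<^sub>C \<Delta> (mult u))"
    unfolding deformation_sweedler sweedler_linear[OF clinear_comult] scale ..
  also have "\<dots> = sweedler \<Delta>\<^sub>2 x (\<lambda>u v. sweedler \<Delta>\<^sub>2 u (\<lambda>a b. sweedler \<Delta>\<^sub>2 v (\<lambda>c d. ?f a b c d)))"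
    unfolding C.conv_exp_semigroup[OF cocomm2 L] coalgebra_mapD(2)[OF coalgebra_map_mult]
      sweedler_scaleC[symmetric] sweedler_scaleC_left[symmetric] ..
  also have "\<dots> = sweedler \<Delta>\<^sub>2 x (\<lambda>u v. sweedler \<Delta>\<^sub>2 u (\<lambda>a b. sweedler \<Delta>\<^sub>2 v (\<lambda>c d. ?f a c b d)))"
    by (rule C.sweedler_middle_swap[OF cocomm2]) (intro deformation_clinear)+
  also have "\<dots> = sweedler \<Delta>\<^sub>2 x (\<lambda>u v. sweedler \<Delta>\<^sub>2 u (\<lambda>a b. sweedler \<Delta>\<^sub>2 v
      (\<lambda>c d. (E t b *\<^sub>C mult a) \<otimes> (E s d *\<^sub>C mult c))))"
    by (simp only: tensor_of_simps scaleC_scaleC mult.commute)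
  also have "\<dots> = sweedler \<Delta>\<^sub>2 x (\<lambda>u v. sweedler \<Delta>\<^sub>2 u (\<lambda>a b. (E t b *\<^sub>C mult a) \<otimes> D s v))"
    unfolding deformation_sweedler
    by (rule sweedler_cong, rule sweedler_cong, rule sweedler_linear[symmetric]) (intro deformation_clinear)
  also have "\<dots> = sweedler \<Delta>\<^sub>2 x (\<lambda>u v. D t u \<otimes> D s v)"
    unfolding deformation_sweedler[of t]
    by (rule sweedler_cong, rule sweedler_linear[symmetric]) (intro deformation_clinear)
  also have "\<dots> = (D t \<otimes>\<^sub>m D s) (\<Delta>\<^sub>2 x)"
    using linear_sweedler[OF clinear_tensor_map[OF clinear_deformation clinear_deformation], of t s \<Delta>\<^sub>2 x]
    by (simp add: clinear_deformation)
  finally show "(\<Delta> \<circ> D (t + s)) x = ((D t \<otimes>\<^sub>m D s) \<circ> \<Delta>\<^sub>2) x" by simp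
qed

end

text \<open>On the triple tensor product, \<open>\<mu>\<^sub>t (\<mu>\<^sub>t (a \<otimes> b) \<otimes> c)\<close> is the convolution of the
  triple product with the pullbacks of \<open>e\<^sup>t\<^sup>L\<close> along \<open>p1 (a \<otimes> b \<otimes> c) = a b \<otimes> c\<close> and \<open>p2 (a \<otimes> b
  \<otimes> c) = \<delta>(c) a \<otimes> b\<close>. By the addition theorem these combine to the exponential of \<open>t (L \<circ> p1 +
  L \<circ> p2)\<close>. The other bracketing gives \<open>L \<circ> p3 + L \<circ> p4\<close>, with \<open>p3 (a \<otimes> b \<otimes> c) = a \<otimes> b c\<close> and
  \<open>p4 (a \<otimes> b \<otimes> c) = \<delta>(a) b \<otimes> c\<close>, and the cocycle identity says that the two sums agree.\<close>

lemma deformation_assoc: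
  assumes cocomm: "cocommutative \<Delta>" and cocycle: "normalized_cocycle L"
  shows "deformation_by mult \<Delta> \<delta> L t (deformation_by mult \<Delta> \<delta> L t (a \<otimes> b) \<otimes> c) =
    deformation_by mult \<Delta> \<delta> L t (a \<otimes> deformation_by mult \<Delta> \<delta> L t (b \<otimes> c))"
proof -
  note L = normalized_cocycleD(1)[OF cocycle]
  let ?E = "conv_exp \<Delta>\<^sub>2 \<delta>\<^sub>2 t L" and ?D = "deformation_by mult \<Delta> \<delta> L t"
  let ?\<Lambda> = "comult_prod \<Delta>\<^sub>2 \<Delta>" and ?\<epsilon> = "counit_prod \<delta>\<^sub>2 \<delta>"
  interpret C: coalgebra \<Delta>\<^sub>2 \<delta>\<^sub>2 by (rule coalgebra2)
  interpret T: coalgebra ?\<Lambda> ?\<epsilon> by (rule coalgebra_prod[OF coalgebra2 coalgebra_axioms])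
  have cocomm3: "cocommutative ?\<Lambda>"
    by (intro cocommutative_prod clinear_comult_prod clinear_comult cocomm)
  have id: "clinear (id :: 'b \<Rightarrow> 'b)" by (simp add: clinear_iff)
  have id2: "clinear (id :: 'b \<otimes> 'b \<Rightarrow> 'b \<otimes> 'b)" by (simp add: clinear_iff)
  have map_id: "coalgebra_map \<Delta> \<delta> \<Delta> \<delta> id"
    unfolding id_def by (rule coalgebra_map_id)
  define p1 where "p1 = mult \<otimes>\<^sub>m (id :: 'b \<Rightarrow> 'b)"
  define p2 where "p2 y = runit ((id \<otimes>\<^sub>m \<delta>) y)" for y :: "('b \<otimes> 'b) \<otimes> 'b"
  define p3 where "p3 y = ((id :: 'b \<Rightarrow> 'b) \<otimes>\<^sub>m mult) (assoc y)" for y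
  define p4 where "p4 y = lunit ((\<delta> \<otimes>\<^sub>m id) (assoc y))" for y :: "('b \<otimes> 'b) \<otimes> 'b"
  note assoc_map = coalgebra_map_assoc[OF coalgebra_axioms coalgebra_axioms coalgebra_axioms]
  have m1: "coalgebra_map ?\<Lambda> ?\<epsilon> \<Delta>\<^sub>2 \<delta>\<^sub>2 p1"
    unfolding p1_def by (rule coalgebra_map_prod[OF coalgebra2 coalgebra_axioms coalgebra_axioms
          coalgebra_axioms coalgebra_map_mult map_id])
  have m2: "coalgebra_map ?\<Lambda> ?\<epsilon> \<Delta>\<^sub>2 \<delta>\<^sub>2 p2"
    unfolding p2_def by (rule coalgebra_map_drop_right[OF coalgebra2 coalgebra_axioms])
  have m3: "coalgebra_map ?\<Lambda> ?\<epsilon> \<Delta>\<^sub>2 \<delta>\<^sub>2 p3"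
    unfolding p3_def by (rule coalgebra_map_comp[OF assoc_map coalgebra_map_prod[OF coalgebra_axioms
          coalgebra2 coalgebra_axioms coalgebra_axioms map_id coalgebra_map_mult]])
  have m4: "coalgebra_map ?\<Lambda> ?\<epsilon> \<Delta>\<^sub>2 \<delta>\<^sub>2 p4"
    unfolding p4_def by (rule coalgebra_map_comp[OF assoc_map coalgebra_map_drop_left[OF coalgebra_axioms
          coalgebra2]])
  have p: "p1 ((a \<otimes> b) \<otimes> c) = (a \<cdot> b) \<otimes> c" "p2 (x \<otimes> c) = \<delta> c *\<^sub>C x"
    "p3 ((a \<otimes> b) \<otimes> c) = a \<otimes> (b \<cdot> c)" "p4 ((a \<otimes> b) \<otimes> c) = \<delta> a *\<^sub>C (b \<otimes> c)" for a b c x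
    by (simp_all add: p1_def p2_def p3_def p4_def id id2 clinear_mult clinear_counit)
  have p1: "p1 (x \<otimes> c) = mult x \<otimes> c" for x c
    by (simp add: p1_def id clinear_mult)
  note clin_p = coalgebra_mapD(1)[OF m1] coalgebra_mapD(1)[OF m2] coalgebra_mapD(1)[OF m3] coalgebra_mapD(1)[OF m4]
  note l = deformation_clinear[OF L] clin_p clin_p[THEN clinear_comp] clinear_comp[OF L]
  have scale: "f (r *\<^sub>C y) = r *\<^sub>C f y" if "clinear f" for f :: "'b \<otimes> 'b \<Rightarrow> 'c::complex_vector" and r y
    using that by (simp add: clinear_iff)
  have L_sum: "(\<lambda>y. L (p1 y) + L (p2 y)) = (\<lambda>y. L (p3 y) + L (p4 y))"
  proof (intro clinear_tensor_eqI l)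
    fix x c
    have "(\<lambda>x. L (p1 (x \<otimes> c)) + L (p2 (x \<otimes> c))) = (\<lambda>x. L (p3 (x \<otimes> c)) + L (p4 (x \<otimes> c)))"
    proof (intro clinear_tensor_eqI l)
      fix a b
      show "L (p1 ((a \<otimes> b) \<otimes> c)) + L (p2 ((a \<otimes> b) \<otimes> c)) = L (p3 ((a \<otimes> b) \<otimes> c)) + L (p4 ((a \<otimes> b) \<otimes> c))"
        using normalized_cocycleD(3)[OF cocycle, of a b c] by (simp add: p scale[OF L] mult.commute add.commute)
    qed
    then show "L (p1 (x \<otimes> c)) + L (p2 (x \<otimes> c)) = L (p3 (x \<otimes> c)) + L (p4 (x \<otimes> c))" by (rule fun_cong)
  qed
  have conv: "sweedler ?\<Lambda> y (\<lambda>u v. ?E (p u) * ?E (q v)) = conv_exp ?\<Lambda> ?\<epsilon> t (\<lambda>y. L (p y) + L (q y)) y"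
    if "coalgebra_map ?\<Lambda> ?\<epsilon> \<Delta>\<^sub>2 \<delta>\<^sub>2 p" "coalgebra_map ?\<Lambda> ?\<epsilon> \<Delta>\<^sub>2 \<delta>\<^sub>2 q" for p q y
    unfolding T.conv_exp_map[OF that(1) coalgebra2 L] T.conv_exp_map[OF that(2) coalgebra2 L]
    by (rule T.conv_exp_add[OF cocomm3, symmetric])
      (intro clinear_comp[OF L] coalgebra_mapD(1)[OF that(1)] coalgebra_mapD(1)[OF that(2)])+
  have iterate: "sweedler ?\<Lambda> y (\<lambda>u v. ?E (q v) *\<^sub>C ?D (p u)) =
      sweedler ?\<Lambda> y (\<lambda>u v. conv_exp ?\<Lambda> ?\<epsilon> t (\<lambda>y. L (p y) + L (q y)) v *\<^sub>C mult (p u))"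
    if p: "coalgebra_map ?\<Lambda> ?\<epsilon> \<Delta>\<^sub>2 \<delta>\<^sub>2 p" and q: "coalgebra_map ?\<Lambda> ?\<epsilon> \<Delta>\<^sub>2 \<delta>\<^sub>2 q" for p q y
  proof -
    note l' = deformation_clinear[OF L] clinear_comp[OF coalgebra_mapD(1)[OF p]] clinear_comp[OF coalgebra_mapD(1)[OF q]]
    have "sweedler ?\<Lambda> y (\<lambda>u v. ?E (q v) *\<^sub>C ?D (p u)) =
        sweedler ?\<Lambda> y (\<lambda>u v. sweedler ?\<Lambda> u (\<lambda>s t. (?E (p t) * ?E (q v)) *\<^sub>C mult (p s)))"
      unfolding deformation_map[OF L p] sweedler_scaleC[symmetric] scaleC_scaleC
      by (simp only: mult.commute)
    also have "\<dots> = sweedler ?\<Lambda> y (\<lambda>u v. sweedler ?\<Lambda> v (\<lambda>s t. (?E (p s) * ?E (q t)) *\<^sub>C mult (p u)))"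
      by (rule T.sweedler_coassoc) (intro l')+
    finally show ?thesis
      by (simp only: sweedler_scaleC_left conv[OF p q])
  qed
  have "?D (?D (a \<otimes> b) \<otimes> c) = sweedler \<Delta>\<^sub>2 (a \<otimes> b) (\<lambda>u u'. ?D ((?E u' *\<^sub>C mult u) \<otimes> c))"
    unfolding deformation_sweedler[OF L, of t "a \<otimes> b"] by (rule sweedler_linear) (intro l)
  also have "\<dots> = sweedler \<Delta>\<^sub>2 (a \<otimes> b) (\<lambda>u u'. sweedler \<Delta> c (\<lambda>v v'. \<delta> v' *\<^sub>C ?D ((?E u' *\<^sub>C mult u) \<otimes> v)))"
    by (rule sweedler_cong, rule sweedler_counit_right[symmetric]) (intro l)
  also have "\<dots> = sweedler \<Delta>\<^sub>2 (a \<otimes> b) (\<lambda>u u'. sweedler \<Delta> c (\<lambda>v v'. ?E (p2 (u' \<otimes> v')) *\<^sub>C ?D (p1 (u \<otimes> v))))"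
    by (simp only: p p1 tensor_of_simps scale clinear_cocycle_exp[OF L] clinear_deformation[OF L] scaleC_scaleC
        scaleC_complex_def)
  also have "\<dots> = sweedler ?\<Lambda> ((a \<otimes> b) \<otimes> c) (\<lambda>u v. ?E (p2 v) *\<^sub>C ?D (p1 u))"
    by (rule sweedler_comult_prod[symmetric]) (intro l)+
  also have "\<dots> = sweedler ?\<Lambda> ((a \<otimes> b) \<otimes> c) (\<lambda>u v. conv_exp ?\<Lambda> ?\<epsilon> t (\<lambda>y. L (p1 y) + L (p2 y)) v *\<^sub>C mult (p1 u))"
    by (rule iterate[OF m1 m2])
  finally have left: "?D (?D (a \<otimes> b) \<otimes> c) =
    sweedler ?\<Lambda> ((a \<otimes> b) \<otimes> c) (\<lambda>u v. conv_exp ?\<Lambda> ?\<epsilon> t (\<lambda>y. L (p1 y) + L (p2 y)) v *\<^sub>C mult (p1 u))" .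
  have "?D (a \<otimes> ?D (b \<otimes> c)) = sweedler \<Delta>\<^sub>2 (b \<otimes> c) (\<lambda>u u'. ?D (a \<otimes> (?E u' *\<^sub>C mult u)))"
    unfolding deformation_sweedler[OF L, of t "b \<otimes> c"] by (rule sweedler_linear) (intro l)
  also have "\<dots> = sweedler \<Delta> b (\<lambda>v v'. sweedler \<Delta> c (\<lambda>w w'. ?D (a \<otimes> (?E (v' \<otimes> w') *\<^sub>C (v \<cdot> w)))))"
    by (rule sweedler_tensor2) (intro l)+
  also have "\<dots> = sweedler \<Delta> a (\<lambda>u u'. \<delta> u' *\<^sub>C sweedler \<Delta> b (\<lambda>v v'. sweedler \<Delta> c (\<lambda>w w'. ?D (u \<otimes> (?E (v' \<otimes> w') *\<^sub>C (v \<cdot> w))))))"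
    by (rule sweedler_counit_right[symmetric]) (intro l)
  also have "\<dots> = sweedler \<Delta> a (\<lambda>u u'. sweedler \<Delta> b (\<lambda>v v'. sweedler \<Delta> c (\<lambda>w w'.
      ?E (p4 ((u' \<otimes> v') \<otimes> w')) *\<^sub>C ?D (p3 ((u \<otimes> v) \<otimes> w)))))"
    by (simp only: p tensor_of_simps scale clinear_cocycle_exp[OF L] clinear_deformation[OF L] scaleC_scaleC
        scaleC_complex_def sweedler_scaleC[symmetric])
  also have "\<dots> = sweedler \<Delta>\<^sub>2 (a \<otimes> b) (\<lambda>u u'. sweedler \<Delta> c (\<lambda>w w'. ?E (p4 (u' \<otimes> w')) *\<^sub>C ?D (p3 (u \<otimes> w))))"
    by (rule sweedler_tensor2[symmetric]) (intro l)+
  also have "\<dots> = sweedler ?\<Lambda> ((a \<otimes> b) \<otimes> c) (\<lambda>u v. ?E (p4 v) *\<^sub>C ?D (p3 u))"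
    by (rule sweedler_comult_prod[symmetric]) (intro l)+
  also have "\<dots> = sweedler ?\<Lambda> ((a \<otimes> b) \<otimes> c) (\<lambda>u v. conv_exp ?\<Lambda> ?\<epsilon> t (\<lambda>y. L (p3 y) + L (p4 y)) v *\<^sub>C mult (p3 u))"
    by (rule iterate[OF m3 m4])
  also have "(\<lambda>u. mult (p3 u)) = (\<lambda>u. mult (p1 u))"
    using mult_assoc by (simp add: fun_eq_iff p1_def p3_def)
  finally show ?thesis unfolding left L_sum by (metis (lifting))
qed

lemma additive_deformation_cocycle:
  assumes cocomm: "cocommutative \<Delta>" and cocycle: "normalized_cocycle L"
  shows "additive_deformation mult one \<Delta> \<delta> (deformation_by mult \<Delta> \<delta> L)"
proof -
  note L = normalized_cocycleD(1)[OF cocycle]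
  let ?D = "deformation_by mult \<Delta> \<delta> L"
  have id: "clinear (id :: 'b \<Rightarrow> 'b)" by (simp add: clinear_iff)
  have "unital_algebra (?D t) one" for t
  proof (rule unital_algebra.intro)
    show D: "clinear (?D t)" by (rule clinear_deformation[OF L])
    note l = clinear_comp[OF D] clinear_tensor_map D id clinear_comp[OF clinear_tensor_map[OF D id]]
      clinear_comp[OF clinear_tensor_map[OF id D]] clinear_assoc clinear_intros
    have "(\<lambda>y. ?D t ((?D t \<otimes>\<^sub>m id) y)) = (\<lambda>y. ?D t ((id \<otimes>\<^sub>m ?D t) (assoc y)))"
    proof (intro clinear_tensor_eqI l)
      fix x c
      have "(\<lambda>x. ?D t ((?D t \<otimes>\<^sub>m id) (x \<otimes> c))) = (\<lambda>x. ?D t ((id \<otimes>\<^sub>m ?D t) (assoc (x \<otimes> c))))"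
        by (intro clinear_tensor_eqI l clinear_comp[OF clinear_assoc])
          (simp add: D id deformation_assoc[OF assms])
      then show "?D t ((?D t \<otimes>\<^sub>m id) (x \<otimes> c)) = ?D t ((id \<otimes>\<^sub>m ?D t) (assoc (x \<otimes> c)))"
        by (rule fun_cong)
    qed
    then show "?D t \<circ> (?D t \<otimes>\<^sub>m id) = ?D t \<circ> (id \<otimes>\<^sub>m ?D t) \<circ> assoc" by (simp add: o_def)
    show "?D t (one \<otimes> a) = a" "?D t (a \<otimes> one) = a" for a
      using deformation_vanishing[OF L coalgebra_axioms coalgebra_map_one_left, of t a]
        deformation_vanishing[OF L coalgebra_axioms coalgebra_map_one_right, of t a]
      by (simp_all add: normalized_cocycle_one[OF cocycle] mult_one_left mult_one_right)
  qed
  then show ?thesis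
    unfolding additive_deformation_def tensor_comult_eq tensor_counit_eq
    by (simp only: deformation_0[OF L] comult_deformation[OF L cocomm] tendsto_counit_deformation[OF L])
      simp
qed

end

section \<open>Cocycles and the antipode\<close>

context cocommutative_hopf_algebra
begin

text \<open>Expand \<open>\<sigma>(a b) = L(a\<^bsub>(1)\<^esub>b\<^bsub>(1)\<^esub> \<otimes> S(b\<^bsub>(2)\<^esub>) S(a\<^bsub>(2)\<^esub>))\<close> by the cocycle identity at
  \<open>(a\<^bsub>(1)\<^esub>, b\<^bsub>(1)\<^esub>, S(b\<^bsub>(2)\<^esub>) S(a\<^bsub>(2)\<^esub>))\<close>. Two of the three terms collapse by the antipode and
  counit axioms to \<open>\<sigma>(a) \<delta>(b)\<close> and \<open>L(a \<otimes> b)\<close>. The remaining \<open>L(b\<^bsub>(1)\<^esub> \<otimes> S(b\<^bsub>(2)\<^esub>) S(a))\<close> is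
  expanded once more, at \<open>(b\<^bsub>(1)\<^esub>, S(b\<^bsub>(2)\<^esub>), S(a))\<close>, and equals \<open>\<delta>(a) \<sigma>(b) - L(S(b) \<otimes> S(a))\<close>.\<close>

lemma cocycle_antipode:
  assumes cocycle: "normalized_cocycle L"
  defines "\<sigma> \<equiv> L \<circ> (id \<otimes>\<^sub>m S) \<circ> \<Delta>"
  shows "clinear \<sigma>" "\<sigma> one = 0" "coboundary mult \<delta> \<sigma> (a \<otimes> b) = L (a \<otimes> b) + L (S b \<otimes> S a)"
proof -
  note L = normalized_cocycleD(1)[OF cocycle]
  have id: "clinear (id :: 'a \<Rightarrow> 'a)" by (simp add: clinear_iff)
  note l = hopf_clinear clinear_comp[OF L] L
  have scale: "L (c *\<^sub>C x) = c * L x" for c x using L by (simp add: clinear_iff)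
  have \<sigma>: "\<sigma> x = sweedler \<Delta> x (\<lambda>u v. L (u \<otimes> S v))" for x
    using linear_sweedler[OF clinear_comp[OF L clinear_tensor_map[OF id clinear_antipode]], of \<Delta> x]
    by (simp add: \<sigma>_def id clinear_antipode)
  show \<sigma>_lin: "clinear \<sigma>"
    unfolding \<sigma>_def o_def by (intro clinear_comp[OF L] clinear_comp[OF clinear_tensor_map] id l)
  show "\<sigma> one = 0"
    by (simp add: \<sigma>_def comult_one id clinear_antipode antipode_one normalized_cocycleD(2)[OF cocycle])
  have split: "L (u \<cdot> v \<otimes> w) = \<delta> u * L (v \<otimes> w) + L (u \<otimes> v \<cdot> w) - L (u \<otimes> v) * \<delta> w" for u v w
    using normalized_cocycleD(3)[OF cocycle, of u v w] by (simp add: algebra_simps)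
  have split': "L (u \<otimes> v \<cdot> w) = L (u \<cdot> v \<otimes> w) + L (u \<otimes> v) * \<delta> w - \<delta> u * L (v \<otimes> w)" for u v w
    using normalized_cocycleD(3)[OF cocycle, of u v w] by (simp add: algebra_simps)
  have T1: "sweedler \<Delta> a (\<lambda>u u'. sweedler \<Delta> b (\<lambda>v v'. \<delta> u * L (v \<otimes> S v' \<cdot> S u'))) =
      \<delta> a * \<sigma> b - L (S b \<otimes> S a)"
  proof -
    have "sweedler \<Delta> a (\<lambda>u u'. sweedler \<Delta> b (\<lambda>v v'. \<delta> u * L (v \<otimes> S v' \<cdot> S u'))) =
        sweedler \<Delta> b (\<lambda>v v'. L (v \<otimes> S v' \<cdot> S a))"
      unfolding sweedler_mult by (rule sweedler_counit_mult) (intro l)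
    also have "\<dots> = sweedler \<Delta> b (\<lambda>v v'. L (v \<cdot> S v' \<otimes> S a)) + sweedler \<Delta> b (\<lambda>v v'. L (v \<otimes> S v')) * \<delta> a
        - sweedler \<Delta> b (\<lambda>v v'. \<delta> v * L (S v' \<otimes> S a))"
      unfolding split' sweedler_diff sweedler_add sweedler_mult_right counit_antipode ..
    also have "sweedler \<Delta> b (\<lambda>v v'. L (v \<cdot> S v' \<otimes> S a)) = L (sweedler \<Delta> b (\<lambda>v v'. v \<cdot> S v') \<otimes> S a)"
      by (rule sweedler_linear[symmetric]) (intro l)
    also have "\<dots> = 0"
      by (simp add: sweedler_antipode tensor_of_simps scale normalized_cocycle_one[OF cocycle])
    also have "sweedler \<Delta> b (\<lambda>v v'. \<delta> v * L (S v' \<otimes> S a)) = L (S b \<otimes> S a)"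
      by (rule sweedler_counit_mult) (intro l)
    finally show ?thesis by (simp add: \<sigma>)
  qed
  have T2: "sweedler \<Delta> a (\<lambda>u u'. sweedler \<Delta> b (\<lambda>v v'. L (u \<otimes> v \<cdot> (S v' \<cdot> S u')))) = \<sigma> a * \<delta> b"
  proof -
    have "sweedler \<Delta> a (\<lambda>u u'. sweedler \<Delta> b (\<lambda>v v'. L (u \<otimes> v \<cdot> (S v' \<cdot> S u')))) =
        sweedler \<Delta> a (\<lambda>u u'. L (u \<otimes> sweedler \<Delta> b (\<lambda>v v'. v \<cdot> S v') \<cdot> S u'))"
      unfolding times_assoc[symmetric] by (rule sweedler_cong, rule sweedler_linear[symmetric]) (intro l)
    also have "\<dots> = sweedler \<Delta> a (\<lambda>u u'. \<delta> b * L (u \<otimes> S u'))"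
      by (simp only: sweedler_antipode mult_scaleC mult_one_left tensor_of_simps scale)
    finally show ?thesis by (simp only: sweedler_mult \<sigma> mult.commute)
  qed
  have T3: "sweedler \<Delta> a (\<lambda>u u'. sweedler \<Delta> b (\<lambda>v v'. L (u \<otimes> v) * \<delta> (S v' \<cdot> S u'))) = L (a \<otimes> b)"
  proof -
    have "sweedler \<Delta> a (\<lambda>u u'. sweedler \<Delta> b (\<lambda>v v'. L (u \<otimes> v) * \<delta> (S v' \<cdot> S u'))) =
        sweedler \<Delta> a (\<lambda>u u'. sweedler \<Delta> b (\<lambda>v v'. L (u \<otimes> v) * \<delta> v') * \<delta> u')"
      by (simp only: counit_times counit_antipode mult.assoc[symmetric] sweedler_mult_right)
    also have "\<dots> = sweedler \<Delta> a (\<lambda>u u'. L (u \<otimes> b) * \<delta> u')"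
      by (rule sweedler_cong, subst sweedler_counit_mult) (intro l refl)+
    also have "\<dots> = L (a \<otimes> b)" by (rule sweedler_counit_mult) (intro l)
    finally show ?thesis .
  qed
  have "\<sigma> (a \<cdot> b) = sweedler \<Delta>\<^sub>2 (a \<otimes> b) (\<lambda>u v. L (mult u \<otimes> S (mult v)))"
    unfolding \<sigma> by (rule sweedler_map[OF coalgebra_map_mult]) (intro l)+
  also have "\<dots> = sweedler \<Delta> a (\<lambda>u u'. sweedler \<Delta> b (\<lambda>v v'. L (u \<cdot> v \<otimes> S (u' \<cdot> v'))))"
    by (rule sweedler_tensor2) (intro l)+
  also have "\<dots> = \<delta> a * \<sigma> b - L (S b \<otimes> S a) + \<sigma> a * \<delta> b - L (a \<otimes> b)"
    unfolding antipode_times split sweedler_diff sweedler_add T1 T2 T3 ..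
  finally show "coboundary mult \<delta> \<sigma> (a \<otimes> b) = L (a \<otimes> b) + L (S b \<otimes> S a)"
    by (simp add: coboundary_tensor[OF clinear_mult clinear_counit \<sigma>_lin])
qed

text \<open>Since \<open>S \<circ> S = id\<close>, skewness gives \<open>L(S(a\<^bsub>(1)\<^esub>) \<otimes> a\<^bsub>(2)\<^esub>) = - L(S(a\<^bsub>(2)\<^esub>) \<otimes>
  a\<^bsub>(1)\<^esub>)\<close>. By cocommutativity the left-hand side is its own negative, hence zero, and the
  same holds with \<open>S\<close> on the second factor.\<close>

lemma constant_antipode_deformation:
  assumes L: "clinear L" and skew: "\<And>a b. L (S b \<otimes> S a) = - L (a \<otimes> b)"
  shows "constant_antipode one \<Delta> \<delta> S (deformation_by mult \<Delta> \<delta> L)"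
proof -
  have id: "clinear (id :: 'a \<Rightarrow> 'a)" by (simp add: clinear_iff)
  have map_id: "coalgebra_map \<Delta> \<delta> \<Delta> \<delta> id"
    unfolding id_def by (rule coalgebra_map_id)
  note l = hopf_clinear clinear_comp[OF L]
  note prod = coalgebra_map_prod[OF coalgebra_axioms coalgebra_axioms coalgebra_axioms coalgebra_axioms]
  note comult = coalgebra_map_comult[OF cocommutative]
  have left: "L ((S \<otimes>\<^sub>m id) (\<Delta> x)) = 0" for x
  proof -
    have "L ((S \<otimes>\<^sub>m id) (\<Delta> x)) = sweedler \<Delta> x (\<lambda>u v. L ((S \<otimes>\<^sub>m id) (u \<otimes> v)))"
      by (rule linear_sweedler) (intro clinear_comp[OF L] clinear_tensor_map clinear_antipode id)
    then have 1: "L ((S \<otimes>\<^sub>m id) (\<Delta> x)) = sweedler \<Delta> x (\<lambda>u v. L (S u \<otimes> v))"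
      by (simp add: id clinear_antipode)
    also have "\<dots> = sweedler \<Delta> x (\<lambda>u v. L (S v \<otimes> u))"
      by (rule sweedler_cocommutative[OF cocommutative]) (intro l)+
    also have "\<dots> = sweedler \<Delta> x (\<lambda>u v. - L (S u \<otimes> v))"
      by (rule sweedler_cong) (rule skew[where a = "S u" for u, unfolded antipode_antipode])
    also have "\<dots> = - sweedler \<Delta> x (\<lambda>u v. L (S u \<otimes> v))"
      using sweedler_mult[of \<Delta> x "-1"] by simp
    finally show ?thesis by (simp add: 1)
  qed
  have right: "L ((id \<otimes>\<^sub>m S) (\<Delta> x)) = 0" for x
  proof -
    have "L ((id \<otimes>\<^sub>m S) (\<Delta> x)) = sweedler \<Delta> x (\<lambda>u v. L ((id \<otimes>\<^sub>m S) (u \<otimes> v)))"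
      by (rule linear_sweedler) (intro clinear_comp[OF L] clinear_tensor_map clinear_antipode id)
    then have 1: "L ((id \<otimes>\<^sub>m S) (\<Delta> x)) = sweedler \<Delta> x (\<lambda>u v. L (u \<otimes> S v))"
      by (simp add: id clinear_antipode)
    also have "\<dots> = sweedler \<Delta> x (\<lambda>u v. L (v \<otimes> S u))"
      by (rule sweedler_cocommutative[OF cocommutative]) (intro l)+
    also have "\<dots> = sweedler \<Delta> x (\<lambda>u v. - L (u \<otimes> S v))"
      by (rule sweedler_cong) (rule skew[where b = "S v" for v, unfolded antipode_antipode])
    also have "\<dots> = - sweedler \<Delta> x (\<lambda>u v. L (u \<otimes> S v))"
      using sweedler_mult[of \<Delta> x "-1"] by simp
    finally show ?thesis by (simp add: 1)
  qed
  show ?thesis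
    unfolding constant_antipode_def
  proof (intro allI conjI ext)
    fix t a
    show "(deformation_by mult \<Delta> \<delta> L t \<circ> (S \<otimes>\<^sub>m id) \<circ> \<Delta>) a = \<delta> a *\<^sub>C one"
      using deformation_vanishing[OF L coalgebra_axioms coalgebra_map_comp[OF comult prod[OF coalgebra_map_antipode map_id]] left]
        fun_cong[OF antipode_left, of a] by simp
    show "(deformation_by mult \<Delta> \<delta> L t \<circ> (id \<otimes>\<^sub>m S) \<circ> \<Delta>) a = \<delta> a *\<^sub>C one"
      using deformation_vanishing[OF L coalgebra_axioms coalgebra_map_comp[OF comult prod[OF map_id coalgebra_map_antipode]] right]
        fun_cong[OF antipode_right, of a] by simp
  qed
qed

end

section \<open>Splitting a generator\<close>

theorem mainTheorem6:
  fixes mult :: "'b \<otimes> 'b \<Rightarrow> 'b::complex_vector" and one :: 'b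
    and \<Delta> :: "'b \<Rightarrow> 'b \<otimes> 'b" and \<delta> :: "'b \<Rightarrow> complex" and S :: "'b \<Rightarrow> 'b"
    and L L\<^sub>1 L\<^sub>2 :: "'b \<otimes> 'b \<Rightarrow> complex" and \<sigma> :: "'b \<Rightarrow> complex"
  assumes "hopf_algebra mult one \<Delta> \<delta> S"
    and "cocommutative \<Delta>"
    and "\<exists>\<mu>. additive_deformation mult one \<Delta> \<delta> \<mu> \<and> has_generator \<delta> \<mu> L"
    and "\<sigma> = L \<circ> (id \<otimes>\<^sub>m S) \<circ> \<Delta>"
    and "L\<^sub>1 = (\<lambda>x. 1/2 * coboundary mult \<delta> \<sigma> x)"
    and "L\<^sub>2 = (\<lambda>x. 1/2 * (L x - (L \<circ> (S \<otimes>\<^sub>m S) \<circ> flip) x))"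
  shows "L = (\<lambda>x. L\<^sub>1 x + L\<^sub>2 x) \<and>
    (\<exists>\<mu>. trivial_deformation mult one \<Delta> \<delta> \<mu> \<and> has_generator \<delta> \<mu> L\<^sub>1) \<and>
    additive_deformation mult one \<Delta> \<delta> (deformation_by mult \<Delta> \<delta> L\<^sub>2) \<and>
    has_generator \<delta> (deformation_by mult \<Delta> \<delta> L\<^sub>2) L\<^sub>2 \<and>
    constant_antipode one \<Delta> \<delta> S (deformation_by mult \<Delta> \<delta> L\<^sub>2)"
proof -
  interpret H: cocommutative_hopf_algebra mult one \<Delta> \<delta> S
    using assms(1,2) by (simp add: cocommutative_hopf_algebra_def cocommutative_hopf_algebra_axioms_def)
  have L: "H.normalized_cocycle L"
    using assms(3) H.normalized_cocycle_generator by blast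
  note L_lin = H.normalized_cocycleD(1)[OF L]
  note \<sigma> = H.cocycle_antipode[OF L, folded assms(4)]
  define \<psi> where "\<psi> x = 1/2 * \<sigma> x" for x
  have \<psi>: "clinear \<psi>" "\<psi> one = 0"
    unfolding \<psi>_def by (intro clinear_mult_right \<sigma>) (simp add: \<sigma>)
  have L1: "L\<^sub>1 = coboundary mult \<delta> \<psi>"
    unfolding assms(5)
    by (intro clinear_tensor_eqI clinear_mult_right H.clinear_coboundary \<sigma> \<psi>)
      (simp add: coboundary_tensor H.clinear_mult H.clinear_counit \<sigma>(1) \<psi>(1), simp add: \<psi>_def algebra_simps)
  note L1_cocycle = H.normalized_cocycle_coboundary[OF \<psi>, folded L1]
  have flip_lin: "clinear (\<lambda>x. L ((S \<otimes>\<^sub>m S) (flip x)))"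
    by (intro clinear_comp[OF L_lin] clinear_comp[OF clinear_tensor_map] clinear_flip H.clinear_antipode)
  have cob: "coboundary mult \<delta> \<sigma> = (\<lambda>x. L x + L ((S \<otimes>\<^sub>m S) (flip x)))"
    by (intro clinear_tensor_eqI H.clinear_coboundary \<sigma>(1) clinear_add_fun L_lin flip_lin)
      (simp add: \<sigma>(3) H.clinear_antipode)
  have sum: "L x = L\<^sub>1 x + L\<^sub>2 x" for x
    by (simp add: assms(5,6) cob field_simps)
  have "L\<^sub>2 = (\<lambda>x. L x - L\<^sub>1 x)" by (simp add: fun_eq_iff sum)
  then have L2: "H.normalized_cocycle L\<^sub>2"
    using H.normalized_cocycle_diff[OF L L1_cocycle] by simp
  have skew: "L\<^sub>2 (S b \<otimes> S a) = - L\<^sub>2 (a \<otimes> b)" for a b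
    by (simp add: assms(6) H.clinear_antipode H.antipode_antipode field_simps)
  have "conv_left \<Delta> \<psi> id = conv_right \<Delta> id \<psi>"
  proof
    fix x
    have id: "clinear (id :: 'b \<Rightarrow> 'b)" by (simp add: clinear_iff)
    have "conv_left \<Delta> \<psi> id x = sweedler \<Delta> x (\<lambda>u v. \<psi> u *\<^sub>C v)"
      by (simp add: conv_left_sweedler \<psi> id)
    also have "\<dots> = sweedler \<Delta> x (\<lambda>u v. \<psi> v *\<^sub>C u)"
      by (rule sweedler_cocommutative[OF assms(2)]) (intro clinear_intros \<psi>)+
    also have "\<dots> = conv_right \<Delta> id \<psi> x"
      by (simp add: conv_right_sweedler \<psi> id)
    finally show "conv_left \<Delta> \<psi> id x = conv_right \<Delta> id \<psi> x" .
  qed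
  then have "trivial_deformation mult one \<Delta> \<delta> (deformation_by mult \<Delta> \<delta> L\<^sub>1)"
    unfolding trivial_deformation_def
    using \<psi> H.additive_deformation_cocycle[OF assms(2) L1_cocycle]
      H.has_generator_deformation[OF H.normalized_cocycleD(1)[OF L1_cocycle]] L1 by blast
  then show ?thesis
    using sum H.additive_deformation_cocycle[OF assms(2)] L1_cocycle L2
      H.has_generator_deformation H.normalized_cocycleD(1)
      H.constant_antipode_deformation[OF H.normalized_cocycleD(1)[OF L2] skew]
    by blast
qed

end
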